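(* Let $\gamma\ge 0$, $\mathfrak{a}>0$ and $a(x)=\mathfrak{a}x^\gamma$ for $x>0$. Let $$b(x,y)=\frac1y h\left(\frac xy\right),\qquad 0<x<y,$$ where $h\in L_1((0,1),z\mathrm{d}z)$ is a nonnegative function satisfying $\int_0^1 zh(z)\,\mathrm{d}z=1$ and $$\int_0^1 z^m h(z)\,\mathrm{d}z\le\frac{\chi}{m},\qquad m\ge m_0,$$ for some $m_0\ge1$ and $\chi>0$. Set $\alpha:=(\gamma+2)/2$. There is a unique solution $f$ to $$-f''(x)+a(x)f(x)=\int_x^\infty a(y)b(x,y)f(y)\,\mathrm{d}y,\quad x\in(0,\infty),\qquad f(0)=0,$$ with $\int_0^\infty xf(x)\,\mathrm{d}x=1$, and it satisfies: (a) (Large size behavior) For each $\mu>(\alpha+\chi-1)/2$ there is $\kappa_\mu>0$ such that $$f(1)x^{-\gamma/4}e^{-\sqrt{\mathfrak{a}}x^\alpha/\alpha}\le f(x)\le\kappa_\mu x^{1+\alpha+\mu}e^{-\sqrt{\mathfrak{a}}x^\alpha/\alpha},\qquad x\ge1.$$ (b) (Small size behavior) If $h\in L_1(0,1)$, then there is $\ell_0>0$ such that $f(z)\sim\ell_0 z$ as $z\to0$. If $h\notin L_1(0,1)$ and if, with $H(z):=\int_0^z yh(y)\,\mathrm{d}y$ for $z\in[0,1]$, there is $\lambda\in[-1,0]$ such that $$H\left(\frac zy\right)\sim y^\lambda H(z)\ \text{ as } z\to0\ \text{ for all } y>0,\qquad H\left(\frac zy\right)\le y^\lambda(y+1)H(z)\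 \text{ for all } z\in(0,1),\ y>z,$$ then $$f(z)\sim\Lambda_0 z\int_z^1\frac{H(y)}{y^2}\,\mathrm{d}y\ \text{ as } z\to0,\qquad\text{with } \Lambda_0:=\int_0^\infty y^{1+\lambda}a(y)f(y)\,\mathrm{d}y.$$
   Context: For $m\in\mathbb{R}$, $X_m:=L_1((0,\infty),x^m\mathrm{d}x)$. A solution means a nonnegative function $f\in C([0,\infty))\cap C^\infty((0,\infty))$ satisfying the equation on $(0,\infty)$ and $f(0)=0$, with $f\in\bigcap_{m>-1}X_m$, $af\in\bigcap_{m>-1}X_m$, $f''\in\bigcap_{m\ge1}X_m$, and $\lim_{z\to\infty}f(z)=\lim_{z\to\infty}zf'(z)=0$. The notation $u(z)\sim v(z)$ as $z\to 0$ means $u(z)/v(z)\to1$. *)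

theory Defs
  imports "HOL-Analysis.Analysis"
begin

definition X :: "real \<Rightarrow> (real \<Rightarrow> real) set" where
  "X m = {f. set_integrable lebesgue {0<..} (\<lambda>x. x powr m * f x)}"

(* Only the values on (0, infinity) matter: deriv at x > 0 is determined by any neighbourhood of x. *)
definition smooth_on_pos :: "(real \<Rightarrow> real) \<Rightarrow> bool" where
  "smooth_on_pos f \<longleftrightarrow> (\<forall>n. \<forall>x>0. (deriv ^^ n) f field_differentiable (at x))"

(* Integrability of the gain term is stated because the library integral of a
   non-integrable function is 0 by convention. *)
definition satisfies_equation ::
    "(real \<Rightarrow> real) \<Rightarrow> (real \<Rightarrow> real \<Rightarrow> real) \<Rightarrow> (real \<Rightarrow> real) \<Rightarrow> bool" where
  "satisfies_equation a b f \<longleftrightarrow>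
     (\<forall>x>0. set_integrable lebesgue {x<..} (\<lambda>y. a y * b x y * f y) \<and>
        - deriv (deriv f) x + a x * f x = (LINT y:{x<..}|lebesgue. a y * b x y * f y))"

(* Functions on [0, infinity) are represented by total functions whose values on the
   negative half-line are irrelevant. *)
definition is_solution ::
    "(real \<Rightarrow> real) \<Rightarrow> (real \<Rightarrow> real \<Rightarrow> real) \<Rightarrow> (real \<Rightarrow> real) \<Rightarrow> bool" where
  "is_solution a b f \<longleftrightarrow>
     (\<forall>x\<ge>0. f x \<ge> 0) \<and>
     continuous_on {0..} f \<and> smooth_on_pos f \<and>
     satisfies_equation a b f \<and> f 0 = 0 \<and>
     (\<forall>m>-1. f \<in> X m) \<and>
     (\<forall>m>-1. (\<lambda>x. a x * f x) \<in> X m) \<and>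
     (\<forall>m\<ge>1. deriv (deriv f) \<in> X m) \<and>
     (f \<longlongrightarrow> 0) at_top \<and> ((\<lambda>z. z * deriv f z) \<longlongrightarrow> 0) at_top"

(* Literal quotient form; unlike asymp_equiv there is no special case for 0/0. *)
definition sim_at_0 :: "(real \<Rightarrow> real) \<Rightarrow> (real \<Rightarrow> real) \<Rightarrow> bool" where
  "sim_at_0 u v \<longleftrightarrow> ((\<lambda>z. u z / v z) \<longlongrightarrow> 1) (at_right 0)"

end

theory Submission
  imports Defs "HOL-Probability.Helly_Selection" "HOL-Real_Asymp.Real_Asymp"
begin

text \<open>
  Put \<open>\<phi> x = f x / x\<close> and \<open>W t = \<integral>\<^sub>t\<^sup>1 H r / r\<^sup>2 dr\<close>. Integrating the equation against \<open>x\<close> over a half-line gives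
  the mass flux \<open>f x - x f' x = \<integral>\<^sub>x\<^sup>\<infinity> s a(s) f(s) H(x/s) ds\<close>, and one more integration turns the
  problem into the Volterra equation \<open>\<phi> x = \<integral>\<^sub>x\<^sup>\<infinity> s a(s) \<phi>(s) W(x/s) ds\<close>, whose kernel is nonnegative and
  homogeneous; hence the moments of \<open>\<phi>\<close> of orders \<open>m\<close> and \<open>m + \<gamma> + 2\<close> are proportional.

  Existence: feed mass in at size \<open>L\<close>, solve by Picard iteration, normalise, and let \<open>L \<rightarrow> \<infinity>\<close>; the moment relation
  gives uniform bounds and monotonicity in \<open>x\<close> gives compactness (Helly). Uniqueness: Kato's inequality for a difference
  of two solutions forces \<open>|f - g| / x\<close> to be monotone, so \<open>f - g\<close> has one sign, and the masses agree.
  The upper bound at infinity comes from optimising \<open>\<phi> x \<le> s M(s) x\<^sup>-\<^sup>s\<close> over \<open>s\<close>, the lower one from the maximum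
  principle, and the behaviour at \<open>0\<close> from dominated convergence (after l'Hospital for \<open>W(z/s) / W z\<close>) in the Volterra equation.
\<close>

text \<open>The equation without source is homogeneous, so approximations could collapse to zero in
  the limit. The normalisation of the second moment of \<phi>, which is the mass of f, and one
  integrable majorant \<open>Bd\<close> valid for all sources exclude this. The majorant rests on
  \<open>W t \<le> 1 / t\<close>, so that \<phi> is at most of order 1/x at zero, and on the
  monotonicity of \<phi>, which turns every moment bound into a pointwise power bound. Since \<phi>
  may be unbounded at zero, smoothness and decay are controlled on half-lines away from zero, and
  the boundary value of f comes from t W(t) -> 0. Moments and the Volterra operator take values in
  \<open>ennreal\<close>, so Fubini applies before anything is known to be finite. The constant chi
  enters through the Mellin transform of \<open>W\<close>: it equals (1 - int z^(m+1) h) / (m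
  (m+1)), and this factor governs the growth of the moments, hence the power in the upper bound. As
  h is only Lebesgue measurable, the analysis uses a Borel representative and is carried over at the
  end.\<close>

abbreviation nn_lborel :: "(real \<Rightarrow> ennreal) \<Rightarrow> ennreal" (binder "NN " 10) where
  "nn_lborel f \<equiv> integral\<^sup>N lborel f"

section \<open>Parameter integrals and measurability\<close>

lemma isCont_integral_dominated:
  fixes F :: "real \<Rightarrow> 'a \<Rightarrow> real"
  assumes d: "d > 0"
    and meas: "\<And>x. \<bar>x - x0\<bar> < d \<Longrightarrow> F x \<in> borel_measurable M"
    and cont: "AE s in M. isCont (\<lambda>x. F x s) x0"
    and bound: "\<And>x. \<bar>x - x0\<bar> < d \<Longrightarrow> AE s in M. \<bar>F x s\<bar> \<le> B s"
    and B: "integrable M B"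
  shows "isCont (\<lambda>x. \<integral>s. F x s \<partial>M) x0"
  unfolding continuous_at_sequentially
proof (intro allI impI)
  fix X :: "nat \<Rightarrow> real" assume X: "X \<longlonglongrightarrow> x0"
  then have "eventually (\<lambda>n. \<bar>X n - x0\<bar> < d) sequentially"
    using d by (auto simp: tendsto_iff dist_real_def)
  \<comment> \<open>The majorant covers only points within distance d of x0; shifting the sequence
    by N discards the others.\<close>
  then obtain N where N: "\<And>n. n \<ge> N \<Longrightarrow> \<bar>X n - x0\<bar> < d"
    by (auto simp: eventually_sequentially)
  have "(\<lambda>n. \<integral>s. F (X (n + N)) s \<partial>M) \<longlonglongrightarrow> (\<integral>s. F x0 s \<partial>M)"
  proof (rule integral_dominated_convergence[where w = B])
    show "F x0 \<in> borel_measurable M" using meas[of x0] d by auto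
    show "\<And>i. F (X (i + N)) \<in> borel_measurable M" using meas N by auto
    show "integrable M B" by fact
    show "\<And>i. AE s in M. norm (F (X (i + N)) s) \<le> B s"
      using bound N by auto
    have X': "(\<lambda>n. X (n + N)) \<longlonglongrightarrow> x0" using X by (rule LIMSEQ_ignore_initial_segment)
    show "AE s in M. (\<lambda>i. F (X (i + N)) s) \<longlonglongrightarrow> F x0 s"
      using cont by eventually_elim (auto intro: isCont_tendsto_compose[OF _ X'])
  qed
  then show "((\<lambda>x. \<integral>s. F x s \<partial>M) \<circ> X) \<longlonglongrightarrow> (\<integral>s. F x0 s \<partial>M)"
    unfolding comp_def by (rule LIMSEQ_offset)
qed

lemma nn_integral_scale:
  fixes u :: "real \<Rightarrow> ennreal"
  assumes [measurable]: "u \<in> borel_measurable borel" and "c > 0"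
  shows "(NN x. u x) = ennreal c * (NN t. u (c * t))"
  using nn_integral_real_affine[of u c 0] assms by simp

lemma borel_measurable_zero_ext:
  fixes f :: "real \<Rightarrow> real"
  assumes "continuous_on {0<..} f"
  shows "(\<lambda>x. if 0 < x then f x else 0) \<in> borel_measurable borel"
proof -
  have "(\<lambda>x. indicator {0<..} x *\<^sub>R f x) \<in> borel_measurable borel"
    by (rule borel_measurable_continuous_on_indicator) (use assms in auto)
  also have "(\<lambda>x. indicator {0<..} x *\<^sub>R f x) = (\<lambda>x. if 0 < x then f x else 0)"
    by (auto simp: fun_eq_iff)
  finally show ?thesis .
qed

text \<open>For s different from r0 the indicator is locally constant in r near r0. Continuity thus
  fails for at most one s, which is why \<open>isCont_integral_dominated\<close> asks for it almost
  everywhere.\<close>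

lemma isCont_integral_indicator_lessThan:
  fixes g :: "real \<Rightarrow> real"
  assumes "integrable lborel g"
  shows "isCont (\<lambda>r. LBINT z. indicator {..<r} z * g z) r0"
proof (rule isCont_integral_dominated[where d = 1 and B = "\<lambda>z. \<bar>g z\<bar>"])
  show "AE s in lborel. isCont (\<lambda>r. indicator {..<r} s * g s) r0"
    using AE_lborel_singleton[of r0]
  proof eventually_elim
    case (elim s)
    have "eventually (\<lambda>r. indicator {..<r} s * g s = indicator {..<r0} s * g s) (nhds r0)"
    proof (cases "s < r0")
      case True
      then have "eventually (\<lambda>r. s < r) (nhds r0)" by (rule order_tendstoD(1)[OF filterlim_ident])
      then show ?thesis by eventually_elim (use True in auto)
    next
      case False
      then have "r0 < s" using elim by auto
      then have "eventually (\<lambda>r. r < s) (nhds r0)" by (rule order_tendstoD(2)[OF filterlim_ident])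
      then show ?thesis by eventually_elim (use False in auto)
    qed
    from isCont_cong[OF this] show ?case by simp
  qed
qed (use assms in \<open>auto split: split_indicator\<close>)

text \<open>A Borel representative of the daughter distribution, extended by zero outside \<open>(0,1)\<close>.\<close>

locale daughter_kernel =
  fixes h :: "real \<Rightarrow> real"
  assumes h_meas[measurable]: "h \<in> borel_measurable borel"
    and h_ge0: "0 \<le> h z"
    and h_out: "z \<notin> {0<..<1} \<Longrightarrow> h z = 0"
    and h_mass: "(NN z. ennreal (z * h z)) = 1"
begin

section \<open>The cumulative daughter mass \<open>H\<close> and the kernel \<open>W\<close> built
  from it\<close>

lemma zh_ge0: "0 \<le> z * h z"
  using h_ge0[of z] h_out[of z] by (cases "z \<in> {0<..<1}") auto

lemma zh_integrable: "integrable lborel (\<lambda>z. z * h z)"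
  by (rule integrableI_nonneg) (auto simp: zh_ge0 h_mass)

lemma integral_zh: "(LBINT z. z * h z) = 1"
  by (subst integral_eq_nn_integral) (auto simp: zh_ge0 h_mass)

text \<open>The half-line \<open>{..<r}\<close> stands for (0,r): as \<open>h\<close> vanishes off
  (0,1), this makes the cumulative mass total, with value 0 for r \<le> 0 and 1 for r \<ge>
  1.\<close>

definition H :: "real \<Rightarrow> real" where
  "H r = (LBINT z. indicator {..<r} z * (z * h z))"

lemma H_integrable: "integrable lborel (\<lambda>z. indicator {..<r} z * (z * h z))"
  using integrable_mult_indicator[OF _ zh_integrable, of "{..<r}"] by simp

lemma ennreal_H: "ennreal (H r) = (NN z. indicator {..<r} z * ennreal (z * h z))"
proof -
  have "ennreal (H r) = (NN z. ennreal (indicator {..<r} z * (z * h z)))"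
    unfolding H_def by (subst nn_integral_eq_integral[OF H_integrable]) (auto simp: zh_ge0)
  then show ?thesis by (simp add: ennreal_mult' ennreal_indicator)
qed

lemma H_ge0: "0 \<le> H r"
  unfolding H_def by (rule integral_nonneg_AE) (auto simp: zh_ge0)

lemma H_mono: "r \<le> s \<Longrightarrow> H r \<le> H s"
  unfolding H_def
  by (rule integral_mono[OF H_integrable H_integrable]) (auto simp: zh_ge0 split: split_indicator)

lemma H_eq1:
  assumes "1 \<le> r" shows "H r = 1"
proof -
  have "indicator {..<r} z * (z * h z) = z * h z" for z
    using h_out[of z] assms by (cases "z < r") auto
  then show ?thesis unfolding H_def by (simp only: integral_zh)
qed

lemma H_le1: "H r \<le> 1"
  using H_mono[of r "max r 1"] H_eq1[of "max r 1"] by simp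

lemma H_eq0: "r \<le> 0 \<Longrightarrow> H r = 0"
  unfolding H_def using h_out
  by (intro integral_eq_zero_AE AE_I2) (auto split: split_indicator)

lemma isCont_H: "isCont H r"
  unfolding H_def[abs_def] by (rule isCont_integral_indicator_lessThan[OF zh_integrable])

lemma continuous_on_H: "continuous_on S H"
  using isCont_H by (auto intro: continuous_at_imp_continuous_on)

lemma H_meas[measurable]: "H \<in> borel_measurable borel"
  by (intro borel_measurable_continuous_onI continuous_on_H)

lemma H_pos_near_1: "\<exists>r0<1. \<forall>r>r0. 0 < H r"
proof -
  have "(H \<longlongrightarrow> 1) (at 1)" using isCont_H[of 1] H_eq1[of 1] by (simp add: isCont_def)
  then have "eventually (\<lambda>r. H r > 0) (at 1)" by (auto intro: order_tendstoD)
  then obtain d where d: "d > 0" "\<And>r. r \<noteq> 1 \<Longrightarrow> dist r 1 < d \<Longrightarrow> 0 < H r"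
    by (auto simp: eventually_at)
  have "0 < H r" if "r > 1 - d / 2" for r
    using H_mono[of "1 - d/2" r] d(2)[of "1 - d / 2"] d(1) that by (auto simp: dist_real_def)
  then show ?thesis using d(1) by (intro exI[of _ "1 - d/2"]) auto
qed

text \<open>This is the integral in the nonintegrable case of (b). It vanishes for t \<ge> 1 because
  the interval is empty and is set to 0 for t \<le> 0, so for x > 0 the factor
  \<open>W (x / s)\<close> selects s > x by itself.\<close>

definition W :: "real \<Rightarrow> real" where
  "W t = (if 0 < t then (LBINT r. indicator {t<..<1} r * (H r / r\<^sup>2)) else 0)"

lemma integrable_indicator_Ioo [simp]: "integrable lborel (\<lambda>r. indicator {a<..<b} r * c :: real)" for a b c :: real
  using integrable_mult_left[of c lborel "indicator {a<..<b}"]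
  by (cases "a \<le> b") auto

lemma W_integrand_integrable:
  assumes "0 < t"
  shows "integrable lborel (\<lambda>r. indicator {t<..<1} r * (H r / r\<^sup>2))"
proof (rule Bochner_Integration.integrable_bound)
  show "integrable lborel (\<lambda>r. indicator {t<..<1} r * (1 / t\<^sup>2) :: real)"
    by (rule integrable_indicator_Ioo)
  show "AE r in lborel. norm (indicator {t<..<1} r * (H r / r\<^sup>2)) \<le> norm (indicator {t<..<1} r * (1 / t\<^sup>2) :: real)"
    using assms H_ge0 H_le1 by (intro AE_I2) (auto split: split_indicator intro!: frac_le power_mono)
qed measurable

lemma ennreal_W:
  assumes "0 < t"
  shows "ennreal (W t) = (NN r. indicator {t<..<1} r * ennreal (H r / r\<^sup>2))"
proof -
  have "ennreal (W t) = (NN r. ennreal (indicator {t<..<1} r * (H r / r\<^sup>2)))"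
    unfolding W_def if_P[OF assms]
    by (subst nn_integral_eq_integral[OF W_integrand_integrable[OF assms]]) (auto simp: H_ge0)
  then show ?thesis by (simp add: ennreal_mult' ennreal_indicator del: times_divide_eq_right)
qed

lemma W_ge0: "0 \<le> W t"
  unfolding W_def by (auto intro!: integral_nonneg_AE simp: H_ge0)

lemma W_out: "t \<notin> {0<..<1} \<Longrightarrow> W t = 0"
  unfolding W_def by auto

lemma W_eq: "0 < t \<Longrightarrow> W t = (LBINT r. indicator {t<..<1} r * (H r / r\<^sup>2))"
  by (simp only: W_def if_True)

lemma W_antimono:
  assumes "0 < s" "s \<le> t" shows "W t \<le> W s"
proof -
  have t: "0 < t" using assms by simp
  show ?thesis unfolding W_eq[OF assms(1)] W_eq[OF t]
    by (rule integral_mono[OF W_integrand_integrable[OF t] W_integrand_integrable[OF assms(1)]])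
      (use assms H_ge0 in \<open>auto split: split_indicator\<close>)
qed

lemma integral_inverse_square:
  assumes "0 < a" "a \<le> b"
  shows "integrable lborel (\<lambda>r. indicator {a<..<b} r * (1 / r\<^sup>2) :: real)"
    and "(LBINT r. indicator {a<..<b} r * (1 / r\<^sup>2)) = 1 / a - 1 / (b::real)"
proof -
  have D: "((\<lambda>r. - (1 / r)) has_real_derivative 1 / r\<^sup>2) (at r)" if "a \<le> r" for r
    using that assms by (auto intro!: derivative_eq_intros simp: power2_eq_square)
  have c: "continuous_on {a..b} (\<lambda>r. 1 / r\<^sup>2)"
    using assms by (intro continuous_intros) auto
  have eq: "AE r in lborel. indicator {a<..<b} r * (1 / r\<^sup>2) = indicator {a..b} r *\<^sub>R (1 / r\<^sup>2 :: real)"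
    using AE_lborel_singleton[of a] AE_lborel_singleton[of b]
    by eventually_elim (auto split: split_indicator)
  have i: "set_integrable lborel {a..b} (\<lambda>r. 1 / r\<^sup>2)"
    using c by (rule borel_integrable_atLeastAtMost')
  then show "integrable lborel (\<lambda>r. indicator {a<..<b} r * (1 / r\<^sup>2) :: real)"
    unfolding set_integrable_def by (subst integrable_cong_AE[OF _ _ eq]) auto
  have "(LBINT r. indicator {a<..<b} r * (1 / r\<^sup>2)) = (LBINT r. indicator {a..b} r *\<^sub>R (1 / r\<^sup>2 :: real))"
    using eq by (intro integral_cong_AE) auto
  also have "\<dots> = - (1 / b) - (- (1 / a))"
    by (rule integral_FTC_atLeastAtMost[OF assms(2) _ c])
      (use D in \<open>auto simp: has_real_derivative_iff_has_vector_derivative[symmetric] intro: has_field_derivative_at_within\<close>)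
  finally show "(LBINT r. indicator {a<..<b} r * (1 / r\<^sup>2)) = 1 / a - 1 / b" by simp
qed

text \<open>Since \<open>H\<close> is at most 1, the comparison integral is that of 1/r^2 over
  (t,1), which is 1/t - 1. In the scaled form \<open>W (x / s) \<le> s / x\<close> this controls the
  Volterra operator.\<close>

lemma W_le: 
  assumes "0 < t" shows "W t \<le> 1 / t"
proof (cases "t < 1")
  case True
  have "W t \<le> (LBINT r. indicator {t<..<1} r * (1 / r\<^sup>2))"
    unfolding W_eq[OF assms] using assms True H_le1
    by (intro integral_mono W_integrand_integrable integral_inverse_square)
      (auto intro!: divide_right_mono split: split_indicator)
  also have "\<dots> \<le> 1 / t" using integral_inverse_square[of t 1] assms True by simp
  finally show ?thesis .
qed (use assms W_out in auto)

lemma W_pos: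
  assumes "0 < t" "t < 1" shows "0 < W t"
proof -
  obtain r0 where r0: "r0 < 1" "\<And>r. r > r0 \<Longrightarrow> 0 < H r" using H_pos_near_1 by auto
  \<comment> \<open>On (p,1) one has H r \<ge> H p > 0 and 1/r^2 \<ge> 1, so this interval alone
    contributes at least (1 - p) H p.\<close>
  define p where "p = (max r0 t + 1) / 2"
  have p: "max r0 t < p" "p < 1" using r0 assms by (auto simp: p_def)
  have "0 < (1 - p) * H p" using p r0 by auto
  also have "\<dots> = (LBINT r. indicator {p<..<1} r * H p)"
    using p by simp
  also have "\<dots> \<le> W t" unfolding W_eq[OF assms(1)]
  proof (intro integral_mono W_integrand_integrable integrable_indicator_Ioo assms(1))
    fix r :: real
    show "indicat_real {p<..<1} r * H p \<le> indicat_real {t<..<1} r * (H r / r\<^sup>2)"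
    proof (cases "p < r \<and> r < 1")
      case True
      then have "H p \<le> H r" "0 < r" "r\<^sup>2 \<le> 1" "r > t"
        using H_mono p assms by (auto simp: power_le_one)
      then have "H p \<le> H r / r\<^sup>2"
        using H_ge0[of r] H_ge0[of p] mult_left_le[of "r\<^sup>2" "H p"] by (simp add: pos_le_divide_eq)
      then show ?thesis using True \<open>r > t\<close> by auto
    qed (use H_ge0 in \<open>auto split: split_indicator\<close>)
  qed
  finally show ?thesis .
qed

text \<open>Away from zero the integrand is one fixed integrable function g, and W t is its total
  integral minus the part up to t.\<close>

lemma isCont_W:
  assumes "0 < t0" shows "isCont W t0"
proof -
  define g where "g r = indicator {t0/2<..<1} r * (H r / r\<^sup>2)" for r
  have g: "integrable lborel g" unfolding g_def using assms W_integrand_integrable[of "t0/2"] by simp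
  have eq: "W t = (LBINT r. g r) - (LBINT r. indicator {..<t} r * g r)" if "t > t0/2" for t
  proof -
    have i: "integrable lborel (\<lambda>r. indicator {..<t} r * g r)"
      using integrable_mult_indicator[OF _ g, of "{..<t}"] by simp
    have "W t = (LBINT r. g r - indicator {..<t} r * g r)"
    proof -
      have t: "0 < t" using that assms by simp
      have "AE r in lborel. indicator {t<..<1} r * (H r / r\<^sup>2) = g r - indicator {..<t} r * g r"
        using AE_lborel_singleton[of t] by eventually_elim (use that in \<open>auto simp: g_def split: split_indicator\<close>)
      then show ?thesis unfolding W_eq[OF t] by (intro integral_cong_AE) (auto simp: g_def[abs_def])
    qed
    then show ?thesis using g i by simp
  qed
  have "isCont (\<lambda>t. (LBINT r. g r) - (LBINT r. indicator {..<t} r * g r)) t0"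
    by (intro continuous_intros isCont_integral_indicator_lessThan g)
  moreover have "eventually (\<lambda>t. W t = (LBINT r. g r) - (LBINT r. indicator {..<t} r * g r)) (nhds t0)"
    using order_tendstoD(1)[OF filterlim_ident, of "t0/2" t0] assms
    by (auto elim!: eventually_mono simp: eq)
  ultimately show ?thesis by (subst isCont_cong) 
qed

lemma W_meas[measurable]: "W \<in> borel_measurable borel"
proof -
  have "continuous_on {0<..} W" by (auto intro!: continuous_at_imp_continuous_on isCont_W)
  from borel_measurable_zero_ext[OF this]
  show ?thesis by (rule measurable_cong[THEN iffD1, rotated]) (auto simp: W_out)
qed

text \<open>\<open>H\<close> tends to 0 at 0, so the integral is split at a small d: below d it is
  at most (e/2)/t, above d at most 1/d, and multiplication by t leaves e/2 + t/d. This later yields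
  f(0) = 0.\<close>

lemma tendsto_tW: "((\<lambda>t. t * W t) \<longlongrightarrow> 0) (at_right 0)"
proof (rule tendstoI)
  fix e :: real assume e: "e > 0"
  have "(H \<longlongrightarrow> 0) (at 0)" using isCont_H[of 0] H_eq0[of 0] by (simp add: isCont_def)
  then have "eventually (\<lambda>r. H r < e/2) (at 0)" by (rule order_tendstoD) (use e in simp)
  then obtain d' where d': "d' > 0" "\<And>r. r \<noteq> 0 \<Longrightarrow> dist r 0 < d' \<Longrightarrow> H r < e/2"
    by (auto simp: eventually_at)
  define d where "d = min (d'/2) (1/2)"
  have d: "0 < d" "d < 1" "\<And>r. 0 < r \<Longrightarrow> r \<le> d \<Longrightarrow> H r \<le> e/2"
    using d' by (auto simp: d_def dist_real_def less_imp_le)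
  have "t * W t \<le> e/2 + t / d" if t: "0 < t" "t < d" for t
  proof -
    have "W t \<le> (LBINT r. e/2 * (indicator {t<..<1} r * (1 / r\<^sup>2)) + indicator {d<..<1} r * (1 / r\<^sup>2))"
      unfolding W_eq[OF t(1)]
    proof (intro integral_mono W_integrand_integrable Bochner_Integration.integrable_add integrable_mult_right integral_inverse_square)
      fix r :: real
      have "H r / r\<^sup>2 \<le> e / 2 / r\<^sup>2" if "t < r" "r \<le> d" using that t d(3)[of r] by (intro divide_right_mono) auto
      moreover have "H r / r\<^sup>2 \<le> 1 / r\<^sup>2" using H_le1 by (intro divide_right_mono) auto
      ultimately show "indicat_real {t<..<1} r * (H r / r\<^sup>2)
         \<le> e / 2 * (indicat_real {t<..<1} r * (1 / r\<^sup>2)) + indicat_real {d<..<1} r * (1 / r\<^sup>2)"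
        using e by (auto split: split_indicator simp: add_increasing)
    qed (use t d in auto)
    also have "\<dots> = e/2 * (1/t - 1) + (1/d - 1)"
    proof -
      have i: "integrable lborel (\<lambda>r. indicator {p<..<1} r * (1 / r\<^sup>2) :: real)"
        "(LBINT r. indicator {p<..<1} r * (1 / r\<^sup>2)) = 1 / p - 1" if "0 < p" "p < 1" for p :: real
        using integral_inverse_square[of p 1] that by simp_all
      have "t < 1" using t d by simp
      then show ?thesis
        using Bochner_Integration.integral_add[OF integrable_mult_right[OF i(1)[of t]] i(1)[of d], of "e/2"]
          i(2)[of t] i(2)[of d] t d
        by (simp only: integral_mult_right_zero) 
    qed
    also have "\<dots> \<le> e/2 * (1/t) + 1/d" using e by (simp add: algebra_simps)
    finally have "t * W t \<le> t * (e/2 * (1/t) + 1/d)" using t by (intro mult_left_mono) auto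
    also have "\<dots> = e/2 + t / d" using t by (simp add: distrib_left)
    finally show ?thesis .
  qed
  \<comment> \<open>The radius \<open>d * min 1 (e/2)\<close> secures t < d and t/d < e/2 at
    once.\<close>
  then have *: "\<bar>t * W t\<bar> < e" if "0 < t" "t < d * min 1 (e/2)" for t
  proof -
    have "t < d" using that(2) d(1) by (smt (verit, best) min.cobounded1 mult_left_le)
    moreover have "t / d < e/2"
    proof -
      have "d * min 1 (e/2) \<le> d * (e/2)" using d(1) by (intro mult_left_mono) auto
      then have "t < d * (e/2)" using that by simp
      then show ?thesis using d(1) by (simp add: divide_less_eq mult.commute)
    qed
    moreover have "\<bar>t * W t\<bar> = t * W t" using that W_ge0[of t] by simp
    ultimately show ?thesis using \<open>\<And>t. 0 < t \<Longrightarrow> t < d \<Longrightarrow> t * W t \<le> e / 2 + t / d\<close>[of t] that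
      by linarith
  qed
  show "\<forall>\<^sub>F t in at_right 0. dist (t * W t) 0 < e"
    unfolding eventually_at_right_field
    using e d(1) * by (intro exI[of _ "d * min 1 (e/2)"]) (auto simp: dist_real_def)
qed

end

section \<open>The Volterra operator and its moments\<close>

lemma nn_integral_powr_from_0:
  assumes "m > -1" "0 \<le> c"
  shows "(NN y. indicator {0..c} y * ennreal (y powr m)) = ennreal (c powr (m + 1) / (m + 1))"
  using nn_integral_has_integral_lebesgue'[OF _ has_integral_powr_from_0[OF assms]]
  by (simp add: mult.commute)

lemma nn_integral_powr_to_inf:
  assumes "e < -1" "0 < a"
  shows "(NN y. indicator {a..} y * ennreal (y powr e)) = ennreal (- (a powr (e + 1)) / (e + 1))"
  using nn_integral_has_integral_lebesgue'[OF _ has_integral_powr_to_inf[OF assms]]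
  by (simp add: mult.commute)

text \<open>With \<phi> = f/x, order 2 is the mass of f.\<close>

definition Mo :: "real \<Rightarrow> (real \<Rightarrow> ennreal) \<Rightarrow> ennreal" where
  "Mo m \<phi> = (NN x. ennreal (x powr m) * \<phi> x)"

locale fragmentation = daughter_kernel +
  fixes \<gamma> A :: real
  assumes \<gamma>_ge0: "0 \<le> \<gamma>" and A_pos: "0 < A"
begin

definition T :: "(real \<Rightarrow> ennreal) \<Rightarrow> real \<Rightarrow> ennreal" where
  "T \<phi> x = ennreal A * (NN s. ennreal (s powr (\<gamma> + 1) * W (x / s)) * \<phi> s)"

text \<open>The Mellin transform of \<open>W\<close>, taken at m + 1.\<close>

definition What :: "real \<Rightarrow> ennreal" where
  "What m = (NN t. ennreal (t powr m * W t))"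

lemma T_meas[measurable]:
  assumes [measurable]: "\<phi> \<in> borel_measurable borel"
  shows "T \<phi> \<in> borel_measurable borel"
  unfolding T_def[abs_def] by measurable

lemma T_mono: "(\<And>s. \<phi> s \<le> \<psi> s) \<Longrightarrow> T \<phi> x \<le> T \<psi> x"
  unfolding T_def by (intro mult_left_mono nn_integral_mono) auto

lemma T_out: "x \<le> 0 \<Longrightarrow> (\<And>s. s \<le> 0 \<Longrightarrow> \<phi> s = 0) \<Longrightarrow> T \<phi> x = 0"
proof -
  assume x: "x \<le> 0" and \<phi>: "\<And>s. s \<le> 0 \<Longrightarrow> \<phi> s = 0"
  have "ennreal (s powr (\<gamma> + 1) * W (x / s)) * \<phi> s = 0" for s
  proof (cases "s \<le> 0")
    case False
    then have "x / s \<le> 0" using x by (simp add: divide_le_0_iff)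
    then show ?thesis using W_out[of "x / s"] by simp
  qed (simp add: \<phi>)
  note z = this
  show ?thesis unfolding T_def by (simp only: z nn_integral_const mult_zero_left mult_zero_right)
qed

text \<open>By homogeneity, x = s t turns the integral of x^m W(x/s) over x into s^(m+1) times
  \<open>What m\<close>; after Fubini the powers of s add up to m + \<gamma> + 2.\<close>

lemma Mo_T:
  assumes [measurable]: "\<phi> \<in> borel_measurable borel" and \<phi>: "\<And>s. s \<le> 0 \<Longrightarrow> \<phi> s = 0"
  shows "Mo m (T \<phi>) = ennreal A * What m * Mo (m + \<gamma> + 2) \<phi>"
proof -
  have "Mo m (T \<phi>) = (NN x. NN s. ennreal A * (ennreal (x powr m) * (ennreal (s powr (\<gamma> + 1) * W (x / s)) * \<phi> s)))"
    unfolding Mo_def T_def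
  proof (rule nn_integral_cong)
    fix x :: real
    let ?g = "\<lambda>s. ennreal (s powr (\<gamma> + 1) * W (x / s)) * \<phi> s"
    have "ennreal (x powr m) * (ennreal A * (NN s. ?g s)) = ennreal A * (ennreal (x powr m) * (NN s. ?g s))"
      by (simp only: mult.left_commute)
    also have "\<dots> = ennreal A * (NN s. ennreal (x powr m) * ?g s)"
      by (subst nn_integral_cmult) auto
    also have "\<dots> = (NN s. ennreal A * (ennreal (x powr m) * ?g s))"
      by (subst nn_integral_cmult) auto
    finally show "ennreal (x powr m) * (ennreal A * (NN s. ?g s)) = (NN s. ennreal A * (ennreal (x powr m) * ?g s))" .
  qed
  also have "\<dots> = (NN s. NN x. ennreal A * (ennreal (x powr m) * (ennreal (s powr (\<gamma> + 1) * W (x / s)) * \<phi> s)))"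
    by (rule lborel_pair.Fubini') measurable
  also have "\<dots> = (NN s. ennreal A * What m * (ennreal (s powr (m + \<gamma> + 2)) * \<phi> s))"
  proof (rule nn_integral_cong)
    fix s :: real
    show "(NN x. ennreal A * (ennreal (x powr m) * (ennreal (s powr (\<gamma> + 1) * W (x / s)) * \<phi> s)))
      = ennreal A * What m * (ennreal (s powr (m + \<gamma> + 2)) * \<phi> s)"
    proof (cases "s \<le> 0")
      case False
      then have s: "0 < s" by simp
      have "(NN x. ennreal (x powr m) * ennreal (W (x / s)))
          = ennreal s * (NN t. ennreal ((s * t) powr m) * ennreal (W t))"
        using s by (subst nn_integral_scale[OF _ s]) auto
      also have "(NN t. ennreal ((s * t) powr m) * ennreal (W t))
          = (NN t. ennreal (s powr m) * ennreal (t powr m * W t))"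
      proof (rule nn_integral_cong)
        fix t :: real
        show "ennreal ((s * t) powr m) * ennreal (W t) = ennreal (s powr m) * ennreal (t powr m * W t)"
          using s W_out[of t] W_ge0[of t]
          by (cases "0 < t") (auto simp: powr_mult ennreal_mult' mult.assoc)
      qed
      also have "\<dots> = ennreal (s powr m) * What m"
        unfolding What_def by (rule nn_integral_cmult) measurable
      finally have 1: "(NN x. ennreal (x powr m) * ennreal (W (x / s))) = ennreal (s powr (m + 1)) * What m"
        using s by (simp add: powr_add ennreal_mult' mult_ac)
      have "(NN x. ennreal A * (ennreal (x powr m) * (ennreal (s powr (\<gamma> + 1) * W (x / s)) * \<phi> s)))
         = (NN x. (ennreal A * ennreal (s powr (\<gamma> + 1)) * \<phi> s) * (ennreal (x powr m) * ennreal (W (x / s))))"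
        by (subst ennreal_mult) (auto simp: W_ge0 mult_ac)
      also have "\<dots> = (ennreal A * ennreal (s powr (\<gamma> + 1)) * \<phi> s) * (ennreal (s powr (m + 1)) * What m)"
        by (subst nn_integral_cmult) (auto simp: 1)
      also have "\<dots> = ennreal A * What m * (ennreal (s powr (\<gamma> + 1) * s powr (m + 1)) * \<phi> s)"
        by (simp add: ennreal_mult' mult_ac)
      also have "s powr (\<gamma> + 1) * s powr (m + 1) = s powr (m + \<gamma> + 2)"
        by (simp add: powr_add[symmetric] add_ac)
      finally show ?thesis .
    qed (simp add: \<phi>)
  qed
  also have "\<dots> = ennreal A * What m * Mo (m + \<gamma> + 2) \<phi>"
    unfolding Mo_def by (rule nn_integral_cmult) measurable
  finally show ?thesis .
qed

text \<open>By \<open>W_le\<close> the integrand is at most t^(m-1) on (0,1).\<close>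

lemma What_le: 
  assumes "0 < m" shows "What m \<le> ennreal (1 / m)"
proof -
  have "What m \<le> (NN y. indicator {0..1} y * ennreal (y powr (m - 1)))"
    unfolding What_def
  proof (rule nn_integral_mono)
    fix t :: real
    have "t powr m * W t \<le> t powr (m - 1)" if "0 < t"
    proof -
      have "t powr m * W t \<le> t powr m * (1 / t)" using W_le that by (intro mult_left_mono) auto
      then show ?thesis using that by (simp add: powr_diff)
    qed
    then show "ennreal (t powr m * W t) \<le> indicator {0..1} t * ennreal (t powr (m - 1))"
      using W_out[of t] by (cases "0 < t \<and> t < 1") (auto intro: ennreal_leI)
  qed
  also have "\<dots> = ennreal (1 / m)" using assms by (subst nn_integral_powr_from_0) auto
  finally show ?thesis .
qed

lemma What_pos: "0 < What m"
proof (rule ccontr)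
  assume "\<not> 0 < What m"
  then have "What m = 0" by simp
  then have "AE t in lborel. ennreal (t powr m * W t) = 0"
    unfolding What_def by (subst (asm) nn_integral_0_iff_AE) auto
  then have "AE t in lborel. t \<notin> {0<..<1::real}"
    by eventually_elim (use W_pos in \<open>force simp: ennreal_eq_0_iff mult_le_0_iff\<close>)
  then have "emeasure lborel {0<..<1::real} = 0"
    by (subst (asm) AE_iff_measurable[OF _ refl]) (auto simp: greaterThanLessThan_def greaterThan_def lessThan_def Int_def)
  then show False by simp
qed

text \<open>For m > 0 the conversion loses nothing, since \<open>What_le\<close> gives
  finiteness.\<close>

definition Wm :: "real \<Rightarrow> real" where "Wm m = enn2real (What m)"

lemma ennreal_Wm: "0 < m \<Longrightarrow> ennreal (Wm m) = What m"
  using What_le[of m] unfolding Wm_def by (intro ennreal_enn2real) (auto simp: less_top[symmetric] top_unique)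

lemma Wm_pos: "0 < m \<Longrightarrow> 0 < Wm m"
  using What_pos[of m] What_le[of m] unfolding Wm_def
  by (auto simp: enn2real_positive_iff less_top[symmetric] top_unique)

text \<open>The source term \<open>ennreal (W (x / L))\<close> stands for unit mass entering at size \<open>L\<close>.\<close>

lemma picard_solution:
  assumes L: "0 < L"
  obtains \<phi> :: "real \<Rightarrow> real" and C :: real where "\<phi> \<in> borel_measurable borel" "\<And>x. 0 \<le> \<phi> x"
    "\<And>x. x \<notin> {0<..<L} \<Longrightarrow> \<phi> x = 0"
    "\<And>x. ennreal (\<phi> x) = ennreal (W (x / L)) + T (\<lambda>s. ennreal (\<phi> s)) x"
    "\<And>x. 0 < x \<Longrightarrow> \<phi> x \<le> C / x"
proof -
  \<comment> \<open>\<open>c\<close> and \<open>B\<close> are made so that \<open>B\<close> is a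
    supersolution: with W(x/s) \<le> s/x the operator maps \<open>B\<close> to at most (L/x) (exp (c
    (L - x)) - 1), and the source adds at most L/x. Hence all Picard iterates from 0 stay below
    \<open>B\<close>.\<close>
  define c where "c = A * L powr (\<gamma> + 1)"
  have c: "0 < c" using A_pos L by (simp add: c_def)
  define B where "B x = indicator {0<..<L} x * (L / x * exp (c * (L - x)))" for x
  define S where "S = rec_nat (\<lambda>x. 0) (\<lambda>_ \<phi> x. ennreal (W (x / L)) + T \<phi> x)"
  have S0: "S 0 = (\<lambda>x. 0)" and SS: "S (Suc n) = (\<lambda>x. ennreal (W (x / L)) + T (S n) x)" for n
    by (simp_all add: S_def)
  have Sm[measurable]: "S n \<in> borel_measurable borel" for n
    by (induction n) (simp_all add: S0 SS)
  have B0: "0 \<le> B x" for x unfolding B_def using L by (auto split: split_indicator)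
  have super: "ennreal (W (x / L)) + T (\<lambda>s. ennreal (B s)) x \<le> ennreal (B x)" for x
  proof (cases "0 < x \<and> x < L")
    case False
    have "W (x / L) = 0" using False L by (intro W_out) (auto simp: divide_simps)
    moreover have "s powr (\<gamma> + 1) * W (x / s) * B s = 0" for s
    proof (cases "0 < s \<and> s < L")
      case True
      then have "W (x / s) = 0" using False by (intro W_out) (auto simp: divide_simps)
      then show ?thesis by simp
    qed (auto simp: B_def)
    note z0 = this
    have z: "ennreal (s powr (\<gamma> + 1) * W (x / s)) * ennreal (B s) = 0" for s
    proof -
      have "ennreal (s powr (\<gamma> + 1) * W (x / s)) * ennreal (B s) = ennreal (s powr (\<gamma> + 1) * W (x / s) * B s)"
        by (subst ennreal_mult') (auto simp: W_ge0)
      then show ?thesis by (simp only: z0 ennreal_0)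
    qed
    have "T (\<lambda>s. ennreal (B s)) x = 0"
      unfolding T_def by (simp only: z nn_integral_const mult_zero_left mult_zero_right)
    ultimately show ?thesis by simp
  next
    case True
    then have x: "0 < x" "x < L" by auto
    have "(NN s. ennreal (s powr (\<gamma> + 1) * W (x / s)) * ennreal (B s))
       \<le> (NN s. ennreal (L powr (\<gamma> + 2) / x) * (ennreal (exp (c * (L - s))) * indicator {x..L} s))"
    proof (rule nn_integral_mono)
      fix s
      show "ennreal (s powr (\<gamma> + 1) * W (x / s)) * ennreal (B s)
        \<le> ennreal (L powr (\<gamma> + 2) / x) * (ennreal (exp (c * (L - s))) * indicator {x..L} s)"
      proof (cases "x < s \<and> s < L")
        case True
        then have s: "0 < s" "x < s" "s < L" using x by auto
        have "W (x / s) \<le> s / x" using W_le[of "x / s"] s x by simp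
        then have "s powr (\<gamma> + 1) * W (x / s) * B s \<le> L powr (\<gamma> + 1) * (s / x) * B s"
          using s \<gamma>_ge0 B0 W_ge0 by (intro mult_right_mono mult_mono powr_mono2) auto
        also have "\<dots> = L powr (\<gamma> + 2) / x * exp (c * (L - s))"
        proof -
          have "L powr (\<gamma> + 2) = L powr (\<gamma> + 1) * L" using L powr_add[of L "\<gamma> + 1" 1] by (simp add: add.assoc)
          then show ?thesis using s L by (simp add: B_def)
        qed
        finally have le: "s powr (\<gamma> + 1) * W (x / s) * B s \<le> L powr (\<gamma> + 2) / x * exp (c * (L - s))" .
        have "ennreal (s powr (\<gamma> + 1) * W (x / s)) * ennreal (B s) = ennreal (s powr (\<gamma> + 1) * W (x / s) * B s)"
          by (subst ennreal_mult) (auto simp: W_ge0 B0)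
        also have "\<dots> \<le> ennreal (L powr (\<gamma> + 2) / x * exp (c * (L - s)))" using le by (rule ennreal_leI)
        also have "\<dots> = ennreal (L powr (\<gamma> + 2) / x) * ennreal (exp (c * (L - s)))"
          using x by (subst ennreal_mult) auto
        finally show ?thesis using s by simp
      next
        case False
        have "s powr (\<gamma> + 1) * W (x / s) * B s = 0"
        proof (cases "s \<le> 0 \<or> s \<ge> L")
          case False
          then have "W (x / s) = 0" using \<open>\<not> (x < s \<and> s < L)\<close> x by (intro W_out) (auto simp: divide_simps)
          then show ?thesis by simp
        qed (auto simp: B_def)
        then have "ennreal (s powr (\<gamma> + 1) * W (x / s)) * ennreal (B s) = 0"
          by (simp add: ennreal_mult[symmetric] W_ge0 B0)
        then show ?thesis by (simp only: zero_le)
      qed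
    qed
    also have "\<dots> = ennreal (L powr (\<gamma> + 2) / x) * (NN s. ennreal (exp (c * (L - s))) * indicator {x..L} s)"
      by (rule nn_integral_cmult) measurable
    also have "(NN s. ennreal (exp (c * (L - s))) * indicator {x..L} s) = ennreal (- exp (c * (L - L)) / c - (- exp (c * (L - x)) / c))"
      using c x by (intro nn_integral_FTC_Icc[where F = "\<lambda>s. - exp (c * (L - s)) / c"])
        (auto intro!: derivative_eq_intros)
    finally have "T (\<lambda>s. ennreal (B s)) x
        \<le> ennreal A * (ennreal (L powr (\<gamma> + 2) / x) * ennreal (- exp (c * (L - L)) / c - (- exp (c * (L - x)) / c)))"
      unfolding T_def by (intro mult_left_mono) auto
    also have "- exp (c * (L - L)) / c - (- exp (c * (L - x)) / c) = (exp (c * (L - x)) - 1) / c"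
      by (simp add: diff_divide_distrib)
    also have "ennreal A * (ennreal (L powr (\<gamma> + 2) / x) * ennreal ((exp (c * (L - x)) - 1) / c))
        = ennreal (A * (L powr (\<gamma> + 2) / x * ((exp (c * (L - x)) - 1) / c)))"
      using A_pos x by (subst ennreal_mult', simp, subst ennreal_mult', simp_all)
    also have "A * (L powr (\<gamma> + 2) / x * ((exp (c * (L - x)) - 1) / c)) = L / x * (exp (c * (L - x)) - 1)"
    proof -
      have "L powr (\<gamma> + 2) = L powr (\<gamma> + 1) * L" using L powr_add[of L "\<gamma> + 1" 1] by (simp add: add.assoc)
      then show ?thesis using A_pos x L by (simp add: c_def)
    qed
    finally have TB: "T (\<lambda>s. ennreal (B s)) x \<le> ennreal (L / x * (exp (c * (L - x)) - 1))" .
    have "ennreal (W (x / L)) \<le> ennreal (L / x)"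
      using W_le[of "x / L"] x L by (intro ennreal_leI) simp
    then have "ennreal (W (x / L)) + T (\<lambda>s. ennreal (B s)) x \<le> ennreal (L / x) + ennreal (L / x * (exp (c * (L - x)) - 1))"
      using TB by (rule add_mono)
    also have "\<dots> = ennreal (B x)"
    proof -
      have "1 \<le> exp (c * (L - x))" using x c by simp
      then have "ennreal (L / x) + ennreal (L / x * (exp (c * (L - x)) - 1)) = ennreal (L / x + L / x * (exp (c * (L - x)) - 1))"
        using x by (intro ennreal_plus[symmetric]) auto
      also have "L / x + L / x * (exp (c * (L - x)) - 1) = B x" using x by (simp add: B_def algebra_simps)
      finally show ?thesis .
    qed
    finally show ?thesis .
  qed
  have SB: "S n x \<le> ennreal (B x)" for n x
  proof (induction n arbitrary: x)
    case (Suc n)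
    have "S (Suc n) x \<le> ennreal (W (x / L)) + T (\<lambda>s. ennreal (B s)) x"
      unfolding SS by (intro add_left_mono T_mono Suc)
    then show ?case using super order_trans by blast
  qed (simp add: S0)
  have Sinc: "S n x \<le> S (Suc n) x" for n x
  proof (induction n arbitrary: x)
    case (Suc n)
    show ?case unfolding SS[of "Suc n"] SS[of n] by (intro add_left_mono T_mono) (use Suc SS in auto)
  qed (simp add: S0)
  define \<Phi> where "\<Phi> x = (SUP n. S n x)" for x
  have [measurable]: "\<Phi> \<in> borel_measurable borel" unfolding \<Phi>_def[abs_def] by measurable
  have \<Phi>B: "\<Phi> x \<le> ennreal (B x)" for x unfolding \<Phi>_def by (intro SUP_least SB)
  have TSUP: "T \<Phi> x = (SUP n. T (S n) x)" for x
  proof -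
    have "(NN s. ennreal (s powr (\<gamma> + 1) * W (x / s)) * \<Phi> s)
      = (NN s. (SUP n. ennreal (s powr (\<gamma> + 1) * W (x / s)) * S n s))"
      unfolding \<Phi>_def by (simp add: SUP_mult_left_ennreal)
    also have "\<dots> = (SUP n. NN s. ennreal (s powr (\<gamma> + 1) * W (x / s)) * S n s)"
      by (rule nn_integral_monotone_convergence_SUP)
        (auto simp: incseq_Suc_iff le_fun_def intro!: mult_left_mono Sinc)
    finally show ?thesis unfolding T_def by (simp add: SUP_mult_left_ennreal)
  qed
  have fixp: "\<Phi> x = ennreal (W (x / L)) + T \<Phi> x" for x
  proof -
    have "\<Phi> x = (SUP n. S (Suc n) x)" unfolding \<Phi>_def
      by (rule antisym) (auto intro!: SUP_least intro: SUP_upper2 Sinc)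
    also have "\<dots> = ennreal (W (x / L)) + (SUP n. T (S n) x)"
      unfolding SS by (rule ennreal_SUP_add_right[symmetric]) simp
    finally show ?thesis using TSUP by simp
  qed
  define \<phi> where "\<phi> x = enn2real (\<Phi> x)" for x
  have e\<phi>: "ennreal (\<phi> x) = \<Phi> x" for x
    unfolding \<phi>_def using \<Phi>B[of x] by (intro ennreal_enn2real) (auto simp: less_top[symmetric] top_unique)
  have \<phi>0: "0 \<le> \<phi> x" for x by (simp add: \<phi>_def)
  have \<phi>B: "\<phi> x \<le> B x" for x
    using \<Phi>B[of x] B0[of x] by (simp add: e\<phi>[symmetric] ennreal_le_iff)
  show ?thesis
  proof (rule that[of \<phi> "L * exp (c * L)"])
    show "\<phi> \<in> borel_measurable borel" unfolding \<phi>_def[abs_def] by measurable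
    show "\<And>x. 0 \<le> \<phi> x" by fact
    show "\<phi> x = 0" if "x \<notin> {0<..<L}" for x
      using \<phi>B[of x] \<phi>0[of x] that by (simp add: B_def)
    show "ennreal (\<phi> x) = ennreal (W (x / L)) + T (\<lambda>s. ennreal (\<phi> s)) x" for x
      unfolding e\<phi> by (rule fixp)
    show "\<phi> x \<le> L * exp (c * L) / x" if "0 < x" for x
    proof -
      have "B x \<le> L * exp (c * L) / x"
        using that c L by (auto simp: B_def divide_simps split: split_indicator)
      then show ?thesis using \<phi>B[of x] by simp
    qed
  qed
qed

end

text \<open>Two boundary cases are covered: Z = top is excluded because k > 0, and a negative b is
  truncated to 0 by \<open>ennreal\<close>.\<close>

lemma ennreal_le_divide:
  assumes "ennreal k * Z \<le> ennreal b" "0 < k"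
  shows "Z \<le> ennreal (b / k)"
proof (cases "0 \<le> b")
  case True
  have "Z = ennreal (1 / k) * (ennreal k * Z)"
    using assms(2) by (simp add: mult.assoc[symmetric] ennreal_mult'[symmetric])
  also have "\<dots> \<le> ennreal (1 / k) * ennreal b" by (intro mult_left_mono assms) auto
  also have "\<dots> = ennreal (b / k)" using assms(2) True by (simp add: ennreal_mult'[symmetric])
  finally show ?thesis .
next
  case False
  then have "ennreal k * Z = 0" using assms(1) by (simp add: ennreal_neg)
  then show ?thesis using assms(2) by auto
qed

section \<open>A priori bounds that are uniform in the source\<close>

context fragmentation
begin

text \<open>One predicate serves both the approximations and the limit: c > 0 is mass input at size
  L, and c = 0 is the fixed-point equation itself. All bounds below are independent of c and L,
  hence hold for both.\<close>

definition src_sol :: "real \<Rightarrow> real \<Rightarrow> (real \<Rightarrow> real) \<Rightarrow> bool" where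
  "src_sol c L \<phi> \<longleftrightarrow> \<phi> \<in> borel_measurable borel \<and> (\<forall>x. 0 \<le> \<phi> x) \<and> (\<forall>x\<le>0. \<phi> x = 0) \<and> 0 \<le> c \<and> 1 \<le> L \<and>
     (\<forall>x. ennreal (\<phi> x) = ennreal c * ennreal (W (x / L)) + T (\<lambda>s. ennreal (\<phi> s)) x) \<and>
     Mo 2 (\<lambda>x. ennreal (\<phi> x)) = 1"

lemma src_solD:
  assumes "src_sol c L \<phi>"
  shows "\<phi> \<in> borel_measurable borel" "\<And>x. 0 \<le> \<phi> x" "\<And>x. x \<le> 0 \<Longrightarrow> \<phi> x = 0" "0 \<le> c" "1 \<le> L"
    "Mo 2 (\<lambda>x. ennreal (\<phi> x)) = 1"
  using assms unfolding src_sol_def by blast+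

lemma src_sol_eq:
  assumes "src_sol c L \<phi>"
  shows "ennreal (\<phi> x) = ennreal c * ennreal (W (x / L)) + T (\<lambda>s. ennreal (\<phi> s)) x"
  using assms unfolding src_sol_def by blast

lemma src_sol_ge:
  assumes "src_sol c L \<phi>"
  shows "T (\<lambda>s. ennreal (\<phi> s)) x \<le> ennreal (\<phi> x)" "ennreal c * ennreal (W (x / L)) \<le> ennreal (\<phi> x)"
  by (subst (2) src_sol_eq[OF assms], simp add: add_increasing)
    (subst src_sol_eq[OF assms], simp add: add_increasing2)

lemma Mo_W:
  assumes "0 < L"
  shows "Mo m (\<lambda>x. ennreal (W (x / L))) = ennreal (L powr (m + 1)) * What m"
proof -
  have "Mo m (\<lambda>x. ennreal (W (x / L))) = ennreal L * (NN t. ennreal ((L * t) powr m) * ennreal (W (L * t / L)))"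
    unfolding Mo_def by (rule nn_integral_scale) (use assms in auto)
  also have "(NN t. ennreal ((L * t) powr m) * ennreal (W (L * t / L)))
    = (NN t. ennreal (L powr m) * ennreal (t powr m * W t))"
  proof (rule nn_integral_cong)
    fix t :: real
    show "ennreal ((L * t) powr m) * ennreal (W (L * t / L)) = ennreal (L powr m) * ennreal (t powr m * W t)"
      using assms W_out[of t] W_ge0[of t]
      by (cases "0 < t") (auto simp: powr_mult ennreal_mult' mult.assoc)
  qed
  also have "\<dots> = ennreal (L powr m) * What m" unfolding What_def by (rule nn_integral_cmult) measurable
  finally show ?thesis using assms by (simp add: powr_add ennreal_mult' mult_ac)
qed

text \<open>Both the source and the operator see x only through \<open>W\<close>, which is antitone
  on positive arguments.\<close>

lemma src_sol_antimono:
  assumes "src_sol c L \<phi>" "0 < x" "x \<le> y"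
  shows "\<phi> y \<le> \<phi> x"
proof -
  note S = src_solD[OF assms(1)]
  have "W (y / L) \<le> W (x / L)" using S(5) assms by (intro W_antimono divide_right_mono divide_pos_pos) auto
  moreover have "T (\<lambda>s. ennreal (\<phi> s)) y \<le> T (\<lambda>s. ennreal (\<phi> s)) x"
    unfolding T_def
  proof (intro mult_left_mono nn_integral_mono)
    fix s
    show "ennreal (s powr (\<gamma> + 1) * W (y / s)) * ennreal (\<phi> s) \<le> ennreal (s powr (\<gamma> + 1) * W (x / s)) * ennreal (\<phi> s)"
    proof (cases "0 < s")
      case True
      then have "W (y / s) \<le> W (x / s)" using assms by (intro W_antimono divide_right_mono divide_pos_pos) auto
      then show ?thesis by (intro mult_right_mono ennreal_leI mult_left_mono) auto
    qed (use S(3)[of s] in auto)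
  qed auto
  ultimately have "ennreal (\<phi> y) \<le> ennreal (\<phi> x)"
    unfolding src_sol_eq[OF assms(1), of y] src_sol_eq[OF assms(1), of x]
    by (intro add_mono mult_left_mono ennreal_leI) auto
  then show ?thesis using S(2) by (simp add: ennreal_le_iff)
qed

text \<open>The source is nonnegative, so T \<phi> \<le> \<phi>; taking moments of order m and
  inserting \<open>Mo_T\<close> bounds the moment of order m + \<gamma> + 2.\<close>

lemma src_sol_moment_step:
  assumes "src_sol c L \<phi>" "0 < m" "Mo m (\<lambda>x. ennreal (\<phi> x)) \<le> ennreal b"
  shows "Mo (m + \<gamma> + 2) (\<lambda>x. ennreal (\<phi> x)) \<le> ennreal (b / (A * Wm m))"
proof (rule ennreal_le_divide)
  note S = src_solD[OF assms(1)]
  have [measurable]: "\<phi> \<in> borel_measurable borel" by (fact S(1))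
  have "ennreal (A * Wm m) * Mo (m + \<gamma> + 2) (\<lambda>x. ennreal (\<phi> x)) = Mo m (T (\<lambda>x. ennreal (\<phi> x)))"
    using S(3) A_pos by (subst Mo_T) (auto simp: ennreal_mult' ennreal_Wm[OF assms(2)])
  also have "\<dots> \<le> Mo m (\<lambda>x. ennreal (\<phi> x))"
    unfolding Mo_def by (intro nn_integral_mono mult_left_mono src_sol_ge[OF assms(1)]) auto
  finally show "ennreal (A * Wm m) * Mo (m + \<gamma> + 2) (\<lambda>x. ennreal (\<phi> x)) \<le> ennreal b" using assms(3) by simp
  show "0 < A * Wm m" using A_pos Wm_pos assms by simp
qed

text \<open>Iterates the moment step from order 2, where the normalisation supplies the value
  1.\<close>

fun mom_bd :: "nat \<Rightarrow> real" where
  "mom_bd 0 = 1"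
| "mom_bd (Suc j) = mom_bd j / (A * Wm (2 + (\<gamma> + 2) * j))"

lemma mom_bd_pos: "0 < mom_bd j"
  by (induction j) (use A_pos \<gamma>_ge0 in \<open>auto intro!: divide_pos_pos mult_pos_pos Wm_pos add_pos_nonneg\<close>)

lemma src_sol_moments:
  assumes "src_sol c L \<phi>"
  shows "Mo (2 + (\<gamma> + 2) * real j) (\<lambda>x. ennreal (\<phi> x)) \<le> ennreal (mom_bd j)"
proof (induction j)
  case 0
  then show ?case using src_solD(6)[OF assms] by simp
next
  case (Suc j)
  have "0 < 2 + (\<gamma> + 2) * real j" using \<gamma>_ge0 by (auto intro: add_pos_nonneg)
  from src_sol_moment_step[OF assms this Suc] show ?case by (simp add: algebra_simps)
qed

text \<open>A Chebyshev-type bound: by monotonicity, \<phi>(x) times the integral of y^m over (0,x)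
  is at most the moment of order m.\<close>

lemma antimono_moment_bound:
  assumes [measurable]: "\<phi> \<in> borel_measurable borel"
    and anti: "\<And>y. 0 < y \<Longrightarrow> y \<le> x \<Longrightarrow> \<phi> x \<le> \<phi> y" and "0 \<le> \<phi> x"
    and b: "Mo m (\<lambda>x. ennreal (\<phi> x)) \<le> ennreal b" "0 \<le> b" and "0 < x" "0 < m"
  shows "\<phi> x \<le> (m + 1) * b * x powr - (m + 1)"
proof -
  have "ennreal (\<phi> x) * ennreal (x powr (m + 1) / (m + 1)) = ennreal (\<phi> x) * (NN y. indicator {0..x} y * ennreal (y powr m))"
    using assms by (subst nn_integral_powr_from_0) auto
  also have "\<dots> = (NN y. ennreal (\<phi> x) * (indicator {0..x} y * ennreal (y powr m)))"
    by (subst nn_integral_cmult) auto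
  also have "\<dots> \<le> Mo m (\<lambda>x. ennreal (\<phi> x))" unfolding Mo_def
  proof (rule nn_integral_mono)
    fix y
    show "ennreal (\<phi> x) * (indicator {0..x} y * ennreal (y powr m)) \<le> ennreal (y powr m) * ennreal (\<phi> y)"
      using anti[of y] assms(7)
      by (cases "0 < y \<and> y \<le> x"; cases "y = 0")
        (auto simp: mult.commute[of "ennreal (\<phi> x)"] intro!: mult_left_mono ennreal_leI)
  qed
  also note b(1)
  finally have "\<phi> x * (x powr (m + 1) / (m + 1)) \<le> b"
    using assms by (simp add: ennreal_mult[symmetric] ennreal_le_iff)
  moreover define P where "P = x powr (m + 1)"
  moreover have "0 < P" using assms by (simp add: P_def)
  ultimately have "\<phi> x * P \<le> b * (m + 1)" using assms by (simp add: pos_divide_le_eq)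
  then have "\<phi> x \<le> b * (m + 1) / P" using \<open>0 < P\<close> by (simp add: pos_le_divide_eq)
  also have "\<dots> = (m + 1) * b * x powr - (m + 1)" unfolding powr_minus_divide[of x] P_def by simp
  finally show ?thesis .
qed

lemma T_le_moment:
  assumes [measurable]: "\<phi> \<in> borel_measurable borel" and "0 < x" and \<phi>: "\<And>s. s \<le> 0 \<Longrightarrow> \<phi> s = 0"
  shows "T \<phi> x \<le> ennreal (A / x) * Mo (\<gamma> + 2) \<phi>"
proof -
  have "(NN s. ennreal (s powr (\<gamma> + 1) * W (x / s)) * \<phi> s) \<le> (NN s. ennreal (1 / x) * (ennreal (s powr (\<gamma> + 2)) * \<phi> s))"
  proof (rule nn_integral_mono)
    fix s
    show "ennreal (s powr (\<gamma> + 1) * W (x / s)) * \<phi> s \<le> ennreal (1 / x) * (ennreal (s powr (\<gamma> + 2)) * \<phi> s)"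
    proof (cases "0 < s")
      case True
      have "s powr (\<gamma> + 1) * W (x / s) \<le> s powr (\<gamma> + 1) * (s / x)"
        using W_le[of "x / s"] True assms by (intro mult_left_mono) auto
      also have "\<dots> = 1 / x * s powr (\<gamma> + 2)"
        using True powr_add[of s "\<gamma> + 1" 1] by (simp add: add.assoc)
      finally have "ennreal (s powr (\<gamma> + 1) * W (x / s)) \<le> ennreal (1 / x * s powr (\<gamma> + 2))" by (rule ennreal_leI)
      also have "\<dots> = ennreal (1 / x) * ennreal (s powr (\<gamma> + 2))" using assms by (subst ennreal_mult) auto
      finally show ?thesis unfolding mult.assoc[symmetric] by (rule mult_right_mono) auto
    qed (simp add: \<phi>)
  qed
  also have "\<dots> = ennreal (1 / x) * Mo (\<gamma> + 2) \<phi>" unfolding Mo_def by (rule nn_integral_cmult) measurable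
  finally have "T \<phi> x \<le> ennreal A * (ennreal (1 / x) * Mo (\<gamma> + 2) \<phi>)"
    unfolding T_def by (intro mult_left_mono) auto
  also have "\<dots> = ennreal (A / x) * Mo (\<gamma> + 2) \<phi>"
    using assms A_pos ennreal_mult[of A "1 / x"] by (simp add: mult.assoc[symmetric])
  finally show ?thesis .
qed

lemma Mo_interpolate:
  assumes [measurable]: "\<phi> \<in> borel_measurable borel" and "p \<le> q" "q \<le> r"
    and \<phi>: "\<And>s. s \<le> 0 \<Longrightarrow> \<phi> s = 0"
  shows "Mo q \<phi> \<le> Mo p \<phi> + Mo r \<phi>"
proof -
  have "Mo q \<phi> \<le> (NN x. ennreal (x powr p) * \<phi> x + ennreal (x powr r) * \<phi> x)"
    unfolding Mo_def
  proof (rule nn_integral_mono)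
    fix x :: real
    have "x powr q \<le> x powr p + x powr r" if "0 < x"
    proof (cases "1 \<le> x")
      case True
      then have "x powr q \<le> x powr r"
        using assms by (intro powr_mono) auto
      then show ?thesis by (simp add: add_increasing)
    next
      case False
      have "x powr q \<le> x powr p"
        using assms False that by (intro powr_mono') auto
      then show ?thesis by (simp add: add_increasing2)
    qed
    then have "ennreal (x powr q) \<le> ennreal (x powr p) + ennreal (x powr r)" if "0 < x"
      using that by (simp add: ennreal_plus[symmetric] ennreal_leI del: ennreal_plus)
    then show "ennreal (x powr q) * \<phi> x \<le> ennreal (x powr p) * \<phi> x + ennreal (x powr r) * \<phi> x"
      unfolding distrib_right[symmetric] by (cases "0 < x") (auto intro!: mult_right_mono simp: \<phi>)
  qed
  also have "\<dots> = Mo p \<phi> + Mo r \<phi>" unfolding Mo_def by (rule nn_integral_add) measurable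
  finally show ?thesis .
qed

text \<open>The source part of \<phi> has second moment c L^3 \<open>What 2\<close>, and it cannot
  exceed the normalised total 1. So c decays like L^(-3), which makes the source vanish as L
  grows.\<close>

lemma src_sol_source_bound:
  assumes "src_sol c L \<phi>"
  shows "c * L powr 3 \<le> 1 / Wm 2"
proof -
  note S = src_solD[OF assms]
  have "ennreal (c * L powr 3 * Wm 2) = ennreal c * Mo 2 (\<lambda>x. ennreal (W (x / L)))"
    using S(4,5) Wm_pos[of 2] by (subst Mo_W) (auto simp: ennreal_mult ennreal_Wm mult.assoc)
  also have "\<dots> = (NN x. ennreal (x powr 2) * (ennreal c * ennreal (W (x / L))))"
    unfolding Mo_def by (subst nn_integral_cmult[symmetric]) (auto simp: mult_ac)
  also have "\<dots> \<le> Mo 2 (\<lambda>x. ennreal (\<phi> x))"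
    unfolding Mo_def by (intro nn_integral_mono mult_left_mono src_sol_ge[OF assms]) auto
  also have "\<dots> = ennreal 1" using S by simp
  finally have "c * L powr 3 * Wm 2 \<le> 1" by (simp add: ennreal_le_iff)
  then show ?thesis using Wm_pos[of 2] by (simp add: field_simps)
qed

text \<open>\<open>D0\<close> adds the source contribution, bounded by (1 / Wm 2)/x since c L \<le>
  c L^3, and the operator contribution (A/x) \<open>Mo (\<gamma> + 2)\<close>, interpolated between
  the orders 2 and \<gamma> + 4. \<open>D1\<close> comes from \<open>antimono_moment_bound\<close>
  at order \<gamma> + 4, whence the factor \<gamma> + 5.\<close>

definition D0 :: real where "D0 = 1 / Wm 2 + A * (1 + mom_bd 1)"
definition D1 :: real where "D1 = (\<gamma> + 5) * mom_bd 1"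

lemma D0_pos: "0 < D0" and D1_pos: "0 < D1"
  unfolding D0_def D1_def using Wm_pos[of 2] A_pos mom_bd_pos[of 1] \<gamma>_ge0
  by (auto intro!: add_pos_pos mult_pos_pos divide_pos_pos simp del: mom_bd.simps One_nat_def)

lemma src_sol_le_D0:
  assumes "src_sol c L \<phi>" "0 < x"
  shows "\<phi> x \<le> D0 / x"
proof -
  note S = src_solD[OF assms(1)]
  have [measurable]: "\<phi> \<in> borel_measurable borel" by (fact S(1))
  have "c * W (x / L) \<le> c * (L / x)" using W_le[of "x / L"] S assms by (intro mult_left_mono) auto
  also have "c * L \<le> c * L powr 3" using S powr_mono[of 1 3 L] by (intro mult_left_mono) auto
  then have "c * (L / x) \<le> (1 / Wm 2) / x"
    using divide_right_mono[of "c * L" "1 / Wm 2" x] src_sol_source_bound[OF assms(1)] assms(2) by simp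
  finally have 1: "ennreal c * ennreal (W (x / L)) \<le> ennreal ((1 / Wm 2) / x)"
    using S W_ge0 by (simp add: ennreal_mult[symmetric] ennreal_leI)
  have "Mo (\<gamma> + 2) (\<lambda>x. ennreal (\<phi> x)) \<le> Mo 2 (\<lambda>x. ennreal (\<phi> x)) + Mo (2 + (\<gamma> + 2) * real 1) (\<lambda>x. ennreal (\<phi> x))"
    using \<gamma>_ge0 S(3) by (intro Mo_interpolate) auto
  also have "\<dots> \<le> 1 + ennreal (mom_bd 1)" using S(6) src_sol_moments[OF assms(1), of 1] by (intro add_mono) auto
  also have "\<dots> = ennreal (1 + mom_bd 1)" using mom_bd_pos[of 1] by (subst ennreal_plus) auto
  finally have Mo: "Mo (\<gamma> + 2) (\<lambda>x. ennreal (\<phi> x)) \<le> ennreal (1 + mom_bd 1)" .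
  have "T (\<lambda>s. ennreal (\<phi> s)) x \<le> ennreal (A / x) * Mo (\<gamma> + 2) (\<lambda>x. ennreal (\<phi> x))"
    by (rule T_le_moment) (use assms S(3) in auto)
  also have "\<dots> \<le> ennreal (A / x) * ennreal (1 + mom_bd 1)"
    by (intro mult_left_mono Mo) simp
  finally have "T (\<lambda>s. ennreal (\<phi> s)) x \<le> ennreal (A / x) * ennreal (1 + mom_bd 1)" .
  then have "ennreal (\<phi> x) \<le> ennreal ((1 / Wm 2) / x) + ennreal (A / x) * ennreal (1 + mom_bd 1)"
    unfolding src_sol_eq[OF assms(1), of x] by (intro add_mono 1)
  also have "\<dots> = ennreal (1 / Wm 2 / x + A / x * (1 + mom_bd 1))"
    using A_pos assms mom_bd_pos[of 1] Wm_pos[of 2]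
    by (subst ennreal_mult[symmetric]) (auto simp del: mom_bd.simps One_nat_def)
  also have "1 / Wm 2 / x + A / x * (1 + mom_bd 1) = D0 / x"
    unfolding D0_def by (simp add: add_divide_distrib del: mom_bd.simps One_nat_def)
  finally show ?thesis using D0_pos assms by (simp add: ennreal_le_iff)
qed

lemma src_sol_le_D1:
  assumes "src_sol c L \<phi>" "0 < x"
  shows "\<phi> x \<le> D1 * x powr - (\<gamma> + 5)"
proof -
  note S = src_solD[OF assms(1)]
  have "\<phi> x \<le> ((\<gamma> + 4) + 1) * mom_bd 1 * x powr - ((\<gamma> + 4) + 1)"
  proof (rule antimono_moment_bound)
    show "Mo (\<gamma> + 4) (\<lambda>x. ennreal (\<phi> x)) \<le> ennreal (mom_bd 1)"
      using src_sol_moments[OF assms(1), of 1] by (simp add: add_ac del: mom_bd.simps One_nat_def)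
  qed (use S src_sol_antimono[OF assms(1)] assms \<gamma>_ge0 mom_bd_pos[of 1] in \<open>auto simp del: mom_bd.simps One_nat_def\<close>)
  then show ?thesis unfolding D1_def by (simp add: add.assoc del: mom_bd.simps One_nat_def)
qed

text \<open>A common majorant of s^2 \<phi>(s) and s^(\<gamma>+2) \<phi>(s): on (0,1] the bound D0/s
  is compensated by the power of s, and beyond 1 the decay s^(-(\<gamma>+5)) leaves at most s^(-3).
  The factor \<open>s powr 0\<close> keeps the shape of the available power integrals.\<close>

definition Bd :: "real \<Rightarrow> real" where
  "Bd s = D0 * (indicator {0..1} s * s powr 0) + D1 * (indicator {1..} s * s powr - 3)"

lemma Bd_integrable: "integrable lborel Bd"
  unfolding Bd_def[abs_def]
proof (intro Bochner_Integration.integrable_add integrable_mult_right)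
  show "integrable lborel (\<lambda>s::real. indicator {0..1} s * s powr 0)"
  proof -
    have "(NN s. indicator {0..1::real} s * ennreal (s powr 0)) < top"
      by (subst nn_integral_powr_from_0) auto
    then show ?thesis
      by (intro integrableI_nonneg) (auto simp: ennreal_mult' ennreal_indicator simp del: powr_zero_eq_one)
  qed
  have "(NN s. indicator {1..} s * ennreal (s powr - 3)) < top"
    by (subst nn_integral_powr_to_inf) (auto simp del: ennreal_half)
  then show "integrable lborel (\<lambda>s::real. indicator {1..} s * s powr - 3)"
    by (intro integrableI_nonneg) (auto simp: ennreal_mult' ennreal_indicator)
qed

lemma Bd_bound:
  assumes \<phi>: "\<phi> s \<le> D0 / s" "\<phi> s \<le> D1 * s powr - (\<gamma> + 5)" and "0 < s" "p = 2 \<or> p = \<gamma> + 2"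
  shows "s powr p * \<phi> s \<le> Bd s"
proof (cases "s \<le> 1")
  case True
  have "s powr p * \<phi> s \<le> s powr p * (D0 / s)" using \<phi> by (intro mult_left_mono) auto
  also have "\<dots> = D0 * s powr (p - 1)" using assms by (simp add: powr_diff)
  also have "s powr (p - 1) \<le> 1" using assms True \<gamma>_ge0 powr_mono'[of 0 "p - 1" s] by auto
  then have "D0 * s powr (p - 1) \<le> D0" using D0_pos by simp
  also have "D0 \<le> Bd s" unfolding Bd_def using True assms D1_pos by (simp add: indicator_def)
  finally show ?thesis .
next
  case False
  have "s powr p * \<phi> s \<le> s powr p * (D1 * s powr - (\<gamma> + 5))" using \<phi> by (intro mult_left_mono) auto
  also have "\<dots> = D1 * s powr (p - (\<gamma> + 5))" using powr_add[of s p "- (\<gamma> + 5)"] by (simp add: diff_conv_add_uminus del: minus_add_distrib add_uminus_conv_diff)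
  also have "s powr (p - (\<gamma> + 5)) \<le> s powr - 3" using assms False \<gamma>_ge0 by (intro powr_mono) auto
  then have "D1 * s powr (p - (\<gamma> + 5)) \<le> D1 * s powr - 3" using D1_pos by simp
  also have "\<dots> = Bd s" unfolding Bd_def using False assms by (simp add: indicator_def)
  finally show ?thesis .
qed

lemma T_kernel_bound:
  assumes "0 < x" "0 < s" "0 \<le> p"
  shows "s powr (\<gamma> + 1) * W (x / s) * p \<le> 1 / x * (s powr (\<gamma> + 2) * p)"
proof -
  have "s powr (\<gamma> + 1) * W (x / s) * p \<le> s powr (\<gamma> + 1) * (s / x) * p"
    using W_le[of "x / s"] assms by (intro mult_left_mono mult_right_mono) auto
  also have "\<dots> = 1 / x * (s powr (\<gamma> + 2) * p)"
    using assms powr_add[of s "\<gamma> + 1" 1] by (simp add: add.assoc)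
  finally show ?thesis .
qed

text \<open>Passage from \<open>ennreal\<close> to real integrals: a majorant G of s^(\<gamma>+2)
  \<phi>(s) bounds the kernel term by |G|/x, locally uniformly in x > 0, which also gives
  continuity.\<close>

lemma T_real:
  assumes [measurable]: "\<phi> \<in> borel_measurable borel" and \<phi>: "\<And>s. 0 \<le> \<phi> s" "\<And>s. s \<le> 0 \<Longrightarrow> \<phi> s = 0"
    and G: "\<And>s. 0 < s \<Longrightarrow> s powr (\<gamma> + 2) * \<phi> s \<le> G s" "integrable lborel G" and x: "0 < x"
  shows "integrable lborel (\<lambda>s. s powr (\<gamma> + 1) * W (x / s) * \<phi> s)"
    and "T (\<lambda>s. ennreal (\<phi> s)) x = ennreal (A * (LBINT s. s powr (\<gamma> + 1) * W (x / s) * \<phi> s))"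
    and "isCont (\<lambda>x. LBINT s. s powr (\<gamma> + 1) * W (x / s) * \<phi> s) x"
proof -
  have bd: "\<bar>s powr (\<gamma> + 1) * W (y / s) * \<phi> s\<bar> \<le> 1 / y * \<bar>G s\<bar>" if "0 < y" for s y
  proof (cases "0 < s")
    case True
    have "\<bar>s powr (\<gamma> + 1) * W (y / s) * \<phi> s\<bar> = s powr (\<gamma> + 1) * W (y / s) * \<phi> s"
      using W_ge0 \<phi> by simp
    also have "\<dots> \<le> 1 / y * (s powr (\<gamma> + 2) * \<phi> s)" using that True \<phi> by (intro T_kernel_bound)
    also have "\<dots> \<le> 1 / y * \<bar>G s\<bar>" using G(1)[OF True] that by (intro mult_left_mono) auto
    finally show ?thesis .
  qed (use \<phi> that in auto)
  show i: "integrable lborel (\<lambda>s. s powr (\<gamma> + 1) * W (x / s) * \<phi> s)"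
    by (rule Bochner_Integration.integrable_bound[OF integrable_mult_right[OF integrable_abs[OF G(2)], of "1 / x"]])
      (use bd[OF x] x in auto)
  have "(NN s. ennreal (s powr (\<gamma> + 1) * W (x / s)) * ennreal (\<phi> s)) = (NN s. ennreal (s powr (\<gamma> + 1) * W (x / s) * \<phi> s))"
    using W_ge0 \<phi> by (subst (2) ennreal_mult) auto
  also have "\<dots> = ennreal (LBINT s. s powr (\<gamma> + 1) * W (x / s) * \<phi> s)"
    by (rule nn_integral_eq_integral[OF i]) (use W_ge0 \<phi> in auto)
  finally show "T (\<lambda>s. ennreal (\<phi> s)) x = ennreal (A * (LBINT s. s powr (\<gamma> + 1) * W (x / s) * \<phi> s))"
    unfolding T_def using A_pos by (simp add: ennreal_mult')
  show "isCont (\<lambda>x. LBINT s. s powr (\<gamma> + 1) * W (x / s) * \<phi> s) x"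
  proof (rule isCont_integral_dominated[where d = "x/2" and B = "\<lambda>s. 2 / x * \<bar>G s\<bar>"])
    show "AE s in lborel. isCont (\<lambda>x. s powr (\<gamma> + 1) * W (x / s) * \<phi> s) x"
    proof (rule AE_I2)
      fix s
      show "isCont (\<lambda>x. s powr (\<gamma> + 1) * W (x / s) * \<phi> s) x"
      proof (cases "0 < s")
        case True
        have "isCont (\<lambda>x. W (x / s)) x"
          by (rule isCont_o2[OF _ isCont_W]) (use True x in \<open>auto intro!: continuous_intros\<close>)
        then show ?thesis by (intro continuous_intros)
      qed (use \<phi> in auto)
    qed
    show "AE s in lborel. \<bar>s powr (\<gamma> + 1) * W (y / s) * \<phi> s\<bar> \<le> 2 / x * \<bar>G s\<bar>" if "\<bar>y - x\<bar> < x / 2" for y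
    proof (rule AE_I2)
      fix s
      have y: "x / 2 < y" using that by (auto simp: abs_if split: if_splits)
      then have "1 / y \<le> 2 / x" using x by (simp add: divide_simps)
      then have "1 / y * \<bar>G s\<bar> \<le> 2 / x * \<bar>G s\<bar>" by (intro mult_right_mono) auto
      with bd[of y s] y x show "\<bar>s powr (\<gamma> + 1) * W (y / s) * \<phi> s\<bar> \<le> 2 / x * \<bar>G s\<bar>" by linarith
    qed
  qed (use x G in auto)
qed

lemma T_dct:
  fixes \<phi> :: "nat \<Rightarrow> real \<Rightarrow> real"
  assumes [measurable]: "\<And>n. \<phi> n \<in> borel_measurable borel" "\<Phi> \<in> borel_measurable borel"
    and \<phi>: "\<And>n s. 0 \<le> \<phi> n s" "\<And>n s. s \<le> 0 \<Longrightarrow> \<phi> n s = 0"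
    and G: "\<And>n s. 0 < s \<Longrightarrow> s powr (\<gamma> + 2) * \<phi> n s \<le> G s" "integrable lborel G" and x: "0 < x"
    and lim: "AE s in lborel. (\<lambda>n. \<phi> n s) \<longlonglongrightarrow> \<Phi> s"
  shows "(\<lambda>n. LBINT s. s powr (\<gamma> + 1) * W (x / s) * \<phi> n s) \<longlonglongrightarrow> (LBINT s. s powr (\<gamma> + 1) * W (x / s) * \<Phi> s)"
proof (rule integral_dominated_convergence[where w = "\<lambda>s. 1 / x * \<bar>G s\<bar>"])
  show "AE s in lborel. (\<lambda>n. s powr (\<gamma> + 1) * W (x / s) * \<phi> n s) \<longlonglongrightarrow> s powr (\<gamma> + 1) * W (x / s) * \<Phi> s"
    using lim by eventually_elim (intro tendsto_intros)
  show "AE s in lborel. norm (s powr (\<gamma> + 1) * W (x / s) * \<phi> n s) \<le> 1 / x * \<bar>G s\<bar>" for n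
  proof (rule AE_I2)
    fix s
    show "norm (s powr (\<gamma> + 1) * W (x / s) * \<phi> n s) \<le> 1 / x * \<bar>G s\<bar>"
    proof (cases "0 < s")
      case True
      have "norm (s powr (\<gamma> + 1) * W (x / s) * \<phi> n s) = s powr (\<gamma> + 1) * W (x / s) * \<phi> n s"
        using W_ge0 \<phi> by simp
      also have "\<dots> \<le> 1 / x * (s powr (\<gamma> + 2) * \<phi> n s)" using x True \<phi> by (intro T_kernel_bound)
      also have "\<dots> \<le> 1 / x * \<bar>G s\<bar>" using G(1)[OF True, of n] x by (intro mult_left_mono) auto
      finally show ?thesis .
    qed (use \<phi> x in auto)
  qed
qed (use G in auto)

end

section \<open>Existence of a normalised fixed point\<close>

context fragmentation
begin

lemma Mo_mono: "(\<And>x. \<phi> x \<le> \<psi> x) \<Longrightarrow> Mo m \<phi> \<le> Mo m \<psi>"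
  unfolding Mo_def by (intro nn_integral_mono mult_left_mono) auto

lemma Mo_cmult:
  assumes [measurable]: "\<phi> \<in> borel_measurable borel"
  shows "Mo m (\<lambda>x. c * \<phi> x) = c * Mo m \<phi>"
  unfolding Mo_def by (subst nn_integral_cmult[symmetric]) (auto simp: mult.left_commute)

lemma T_cmult:
  assumes [measurable]: "\<phi> \<in> borel_measurable borel"
  shows "T (\<lambda>x. c * \<phi> x) x = c * T \<phi> x"
proof -
  have "(NN s. ennreal (s powr (\<gamma> + 1) * W (x / s)) * (c * \<phi> s)) =
     (NN s. c * (ennreal (s powr (\<gamma> + 1) * W (x / s)) * \<phi> s))"
    by (simp only: mult.left_commute)
  also have "\<dots> = c * (NN s. ennreal (s powr (\<gamma> + 1) * W (x / s)) * \<phi> s)"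
    by (rule nn_integral_cmult) measurable
  finally show ?thesis unfolding T_def by (simp only: mult.left_commute)
qed

text \<open>The Picard solution with unit source is divided by its second moment N, so c = 1/N. N is
  finite by the bound C/x and the support in (0,L), and positive because the source alone has
  positive moment.\<close>

lemma src_sol_exists:
  assumes "1 \<le> L"
  shows "\<exists>c \<phi>. src_sol c L \<phi>"
proof -
  have L: "0 < L" using assms by simp
  from picard_solution[OF L] obtain \<psi> :: "real \<Rightarrow> real" and C :: real where
    [measurable]: "\<psi> \<in> borel_measurable borel" and \<psi>0: "\<And>x. 0 \<le> \<psi> x"
    and \<psi>out: "\<And>x. x \<notin> {0<..<L} \<Longrightarrow> \<psi> x = 0"
    and \<psi>eq: "\<And>x. ennreal (\<psi> x) = ennreal (W (x / L)) + T (\<lambda>s. ennreal (\<psi> s)) x"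
    and \<psi>C: "\<And>x. 0 < x \<Longrightarrow> \<psi> x \<le> C / x" by blast
  let ?M = "Mo 2 (\<lambda>x. ennreal (\<psi> x))"
  have "0 \<le> C" using \<psi>C[of 1] \<psi>0[of 1] by simp
  have "?M \<le> (NN x. ennreal C * (indicator {0..L} x * ennreal (x powr 1)))"
    unfolding Mo_def
  proof (rule nn_integral_mono)
    fix x
    show "ennreal (x powr 2) * ennreal (\<psi> x) \<le> ennreal C * (indicator {0..L} x * ennreal (x powr 1))"
    proof (cases "0 < x \<and> x < L")
      case True
      have "x powr 2 * \<psi> x \<le> x powr 2 * (C / x)" using \<psi>C True by (intro mult_left_mono) auto
      also have "\<dots> = C * x powr 1" using True by (simp add: powr_numeral power2_eq_square)
      finally have "ennreal (x powr 2 * \<psi> x) \<le> ennreal (C * x powr 1)" by (rule ennreal_leI)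
      then show ?thesis using True \<psi>0 \<open>0 \<le> C\<close> by (simp add: ennreal_mult)
    qed (use \<psi>out[of x] in auto)
  qed
  also have "\<dots> = ennreal C * ennreal (L powr (1 + 1) / (1 + 1))"
    using L by (subst nn_integral_cmult) (auto simp only: nn_integral_powr_from_0, auto simp: nn_integral_powr_from_0)
  also have "\<dots> < top" by (simp add: ennreal_mult_less_top)
  finally have fin: "?M < top" .
  have "0 < ennreal (L powr (2 + 1)) * What 2" using L What_pos[of 2] by (simp add: ennreal_zero_less_mult_iff)
  also have "\<dots> = Mo 2 (\<lambda>x. ennreal (W (x / L)))" by (rule Mo_W[OF L, symmetric])
  also have "\<dots> \<le> ?M" by (rule Mo_mono) (subst \<psi>eq, simp add: add_increasing2)
  finally have pos: "0 < ?M" .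
  define N where "N = enn2real ?M"
  have N: "0 < N" "ennreal N = ?M" using fin pos by (auto simp: N_def enn2real_positive_iff)
  define \<phi> where "\<phi> x = 1 / N * \<psi> x" for x
  have [measurable]: "\<phi> \<in> borel_measurable borel" unfolding \<phi>_def[abs_def] by measurable
  have e\<phi>: "ennreal (\<phi> x) = ennreal (1 / N) * ennreal (\<psi> x)" for x
    unfolding \<phi>_def using N(1) by (intro ennreal_mult') auto
  have "src_sol (1 / N) L \<phi>"
    unfolding src_sol_def
  proof (intro conjI allI impI)
    show "0 \<le> \<phi> x" for x using \<psi>0 N(1) by (simp add: \<phi>_def)
    show "\<phi> x = 0" if "x \<le> 0" for x using \<psi>out[of x] that by (simp add: \<phi>_def)
    show "ennreal (\<phi> x) = ennreal (1 / N) * ennreal (W (x / L)) + T (\<lambda>s. ennreal (\<phi> s)) x" for x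
      unfolding e\<phi> by (subst T_cmult) (simp_all add: \<psi>eq[of x] distrib_left)
    have "Mo 2 (\<lambda>x. ennreal (\<phi> x)) = ennreal (1 / N) * ennreal N"
      unfolding e\<phi> by (subst Mo_cmult) (simp_all add: N(2))
    also have "\<dots> = 1" using N(1) by (subst ennreal_mult'[symmetric]) auto
    finally show "Mo 2 (\<lambda>x. ennreal (\<phi> x)) = 1" .
  qed (use N(1) assms in auto)
  then show ?thesis by blast
qed

lemma src_sol_real:
  assumes "src_sol c L \<phi>" "0 < x"
  shows "\<phi> x = c * W (x / L) + A * (LBINT s. s powr (\<gamma> + 1) * W (x / s) * \<phi> s)"
    and "isCont \<phi> x"
proof -
  note S = src_solD[OF assms(1)]
  have B: "s powr (\<gamma> + 2) * \<phi> s \<le> Bd s" if "0 < s" for s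
    by (rule Bd_bound) (use src_sol_le_D0[OF assms(1) that] src_sol_le_D1[OF assms(1) that] that in auto)
  have T: "T (\<lambda>s. ennreal (\<phi> s)) y = ennreal (A * (LBINT s. s powr (\<gamma> + 1) * W (y / s) * \<phi> s))"
    "isCont (\<lambda>x. LBINT s. s powr (\<gamma> + 1) * W (x / s) * \<phi> s) y" if "0 < y" for y
    by (rule T_real[where G = Bd]; use S B Bd_integrable that in auto)+
  have int0: "0 \<le> (LBINT s. s powr (\<gamma> + 1) * W (y / s) * \<phi> s)" for y
    using S W_ge0 by (intro integral_nonneg_AE) auto
  have eq: "\<phi> y = c * W (y / L) + A * (LBINT s. s powr (\<gamma> + 1) * W (y / s) * \<phi> s)" if "0 < y" for y
  proof -
    have "ennreal (\<phi> y) = ennreal c * ennreal (W (y / L)) + ennreal (A * (LBINT s. s powr (\<gamma> + 1) * W (y / s) * \<phi> s))"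
      unfolding src_sol_eq[OF assms(1), of y] by (subst T(1)[OF that]) simp_all
    also have "\<dots> = ennreal (c * W (y / L) + A * (LBINT s. s powr (\<gamma> + 1) * W (y / s) * \<phi> s))"
      using S(4) W_ge0 A_pos int0[of y] by (subst ennreal_mult[symmetric]) auto
    finally show ?thesis using S(2,4) W_ge0 A_pos int0[of y] by (subst (asm) ennreal_inj) auto
  qed
  then show "\<phi> x = c * W (x / L) + A * (LBINT s. s powr (\<gamma> + 1) * W (x / s) * \<phi> s)" using assms(2) by simp
  have "isCont (\<lambda>x. W (x / L)) x"
    by (rule isCont_o2[OF _ isCont_W]) (use S(5) assms(2) in \<open>auto intro!: continuous_intros\<close>)
  then have "isCont (\<lambda>y. c * W (y / L) + A * (LBINT s. s powr (\<gamma> + 1) * W (y / s) * \<phi> s)) x"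
    by (intro continuous_intros T(2) assms(2)) auto
  moreover have "eventually (\<lambda>y. \<phi> y = c * W (y / L) + A * (LBINT s. s powr (\<gamma> + 1) * W (y / s) * \<phi> s)) (nhds x)"
    using order_tendstoD(1)[OF filterlim_ident assms(2)] by eventually_elim (rule eq)
  ultimately show "isCont \<phi> x" by (subst isCont_cong)
qed

theorem fixed_point_exists: "\<exists>\<phi>. src_sol 0 1 \<phi>"
proof -
  have "\<exists>c \<phi>. src_sol c (real n + 1) \<phi>" for n by (rule src_sol_exists) simp
  then obtain c \<phi> where \<phi>: "\<And>n. src_sol (c n) (real n + 1) (\<phi> n)" by metis
  note S = src_solD[OF \<phi>]
  \<comment> \<open>Bounded, monotone and continuous on the whole line, as Helly's theorem requires.\<close>
  define F where "F n t = 1 / (1 + \<phi> n (exp t))" for n t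
  have F_cont: "isCont (F n) t" for n t
  proof -
    have "isCont (\<lambda>t. \<phi> n (exp t)) t"
      by (rule isCont_o2[OF _ src_sol_real(2)[OF \<phi>]]) (auto intro!: continuous_intros)
    then show ?thesis unfolding F_def[abs_def] using S(2)[of n "exp t"] by (intro continuous_intros) auto
  qed
  have F_mono: "mono (F n)" for n
    unfolding F_def mono_def using S(2) src_sol_antimono[OF \<phi>]
    by (auto intro!: divide_left_mono mult_pos_pos add_pos_nonneg)
  have F_bd: "\<bar>F n t\<bar> \<le> 1" for n t
    unfolding F_def using S(2)[of n "exp t"] by (auto simp: divide_simps)
  obtain r F' where r: "strict_mono (r :: nat \<Rightarrow> nat)" and F': "mono F'"
    "\<And>x. isCont F' x \<Longrightarrow> (\<lambda>n. F (r n) x) \<longlonglongrightarrow> F' x"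
    using Helly_selection[of F 1] F_cont F_mono F_bd continuous_at_imp_continuous_at_within by metis
  have [measurable]: "F' \<in> borel_measurable borel" by (rule borel_measurable_mono[OF F'(1)])
  define \<Phi> where "\<Phi> x = (if 0 < x then 1 / F' (ln x) - 1 else 0)" for x :: real
  have [measurable]: "\<Phi> \<in> borel_measurable borel" unfolding \<Phi>_def[abs_def] by measurable
  have [measurable]: "\<phi> n \<in> borel_measurable borel" for n by (rule S(1))
  have conv: "(\<lambda>n. \<phi> (r n) x) \<longlonglongrightarrow> \<Phi> x" if "0 < x \<Longrightarrow> isCont F' (ln x)" for x
  proof (cases "0 < x")
    case True
    have lim: "(\<lambda>n. F (r n) (ln x)) \<longlonglongrightarrow> F' (ln x)" using F'(2) that True by simp
    \<comment> \<open>The uniform bound D0/x keeps the limit \<open>F'\<close> away from 0, so the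
      transformation 1/(1 + \<phi>) can be inverted in the limit.\<close>
    have "1 / (1 + D0 / x) \<le> F (r n) (ln x)" for n
      unfolding F_def using True S(2) src_sol_le_D0[OF \<phi>[of "r n"] True] D0_pos
      by (auto intro!: divide_left_mono mult_pos_pos add_pos_nonneg)
    then have "1 / (1 + D0 / x) \<le> F' (ln x)" using lim by (intro LIMSEQ_le_const[OF lim]) auto
    moreover have "0 < 1 / (1 + D0 / x)" using True D0_pos by (auto intro!: divide_pos_pos add_pos_pos)
    ultimately have "F' (ln x) \<noteq> 0" by linarith
    then have "(\<lambda>n. 1 / F (r n) (ln x) - 1) \<longlonglongrightarrow> 1 / F' (ln x) - 1"
      by (intro tendsto_intros lim)
    then show ?thesis using True by (simp add: F_def \<Phi>_def)
  qed (use S(3) in \<open>auto simp: \<Phi>_def\<close>)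
  \<comment> \<open>A monotone limit has countably many discontinuities, so pointwise convergence
    fails at most on a null set.\<close>
  have "countable (exp ` {t. \<not> isCont F' t})" by (intro countable_image mono_ctble_discont F')
  then have "AE x in lborel. x \<notin> exp ` {t. \<not> isCont F' t}"
    by (rule AE_not_in[OF countable_imp_null_set_lborel])
  then have AEconv: "AE x in lborel. (\<lambda>n. \<phi> (r n) x) \<longlonglongrightarrow> \<Phi> x"
  proof eventually_elim
    case (elim x)
    then show ?case by (intro conv) (metis (mono_tags, lifting) exp_ln image_eqI mem_Collect_eq)
  qed
  have Bdn: "s powr p * \<phi> n s \<le> Bd s" if "0 < s" "p = 2 \<or> p = \<gamma> + 2" for s n p
    by (rule Bd_bound) (use src_sol_le_D0[OF \<phi> that(1)] src_sol_le_D1[OF \<phi> that(1)] that in auto)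
  \<comment> \<open>With L = n + 1, \<open>W_le\<close> gives c W(x/L) \<le> c L/x = (c L^2 / x)
    (1/L), and c L^2 \<le> c L^3 is bounded by \<open>src_sol_source_bound\<close>.\<close>
  have source: "(\<lambda>n. c (r n) * W (x / (real (r n) + 1))) \<longlonglongrightarrow> 0" if x: "0 < x" for x
  proof (rule tendsto_sandwich[OF _ _ tendsto_const])
    have "c n * W (x / (real n + 1)) \<le> 1 / Wm 2 / x * (1 / (real n + 1))" for n
    proof -
      have L: "1 \<le> real n + 1" by simp
      have "c n * W (x / (real n + 1)) \<le> c n * ((real n + 1) / x)"
        using W_le[of "x / (real n + 1)"] x S(4)[of n] by (intro mult_left_mono) auto
      also have "\<dots> = c n * (real n + 1) powr 2 / x * (1 / (real n + 1))"
        by (simp add: powr_numeral power2_eq_square)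
      also have "c n * (real n + 1) powr 2 \<le> c n * (real n + 1) powr 3"
        using S(4)[of n] by (intro mult_left_mono powr_mono) auto
      then have "c n * (real n + 1) powr 2 / x * (1 / (real n + 1)) \<le> 1 / Wm 2 / x * (1 / (real n + 1))"
        using src_sol_source_bound[OF \<phi>[of n]] x by (intro mult_right_mono divide_right_mono) auto
      finally show ?thesis .
    qed
    then show "\<forall>\<^sub>F n in sequentially. c (r n) * W (x / (real (r n) + 1)) \<le> 1 / Wm 2 / x * (1 / (real (r n) + 1))"
      by simp
    show "\<forall>\<^sub>F n in sequentially. 0 \<le> c (r n) * W (x / (real (r n) + 1))"
      using S(4) W_ge0 by simp
    have "(\<lambda>n. 1 / (real n + 1)) \<longlonglongrightarrow> 0" by real_asymp
    then have "(\<lambda>n. 1 / Wm 2 / x * (1 / (real n + 1))) \<longlonglongrightarrow> 0" by (rule tendsto_mult_right_zero)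
    from LIMSEQ_subseq_LIMSEQ[OF this r]
    show "(\<lambda>n. 1 / Wm 2 / x * (1 / (real (r n) + 1))) \<longlonglongrightarrow> 0" by (simp add: comp_def)
  qed
  \<comment> \<open>The Helly limit is known almost everywhere only. Inserting it in the Volterra
    integral yields a representative to which the sequence converges at every point.\<close>
  define \<phi>' where "\<phi>' x = (if 0 < x then A * (LBINT s. s powr (\<gamma> + 1) * W (x / s) * \<Phi> s) else 0)" for x
  have lim: "(\<lambda>n. \<phi> (r n) x) \<longlonglongrightarrow> \<phi>' x" for x
  proof (cases "0 < x")
    case True
    have "(\<lambda>n. LBINT s. s powr (\<gamma> + 1) * W (x / s) * \<phi> (r n) s) \<longlonglongrightarrow> (LBINT s. s powr (\<gamma> + 1) * W (x / s) * \<Phi> s)"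
      by (rule T_dct[where G = Bd]) (use S Bdn AEconv True Bd_integrable in auto)
    then have "(\<lambda>n. c (r n) * W (x / (real (r n) + 1)) + A * (LBINT s. s powr (\<gamma> + 1) * W (x / s) * \<phi> (r n) s))
        \<longlonglongrightarrow> 0 + A * (LBINT s. s powr (\<gamma> + 1) * W (x / s) * \<Phi> s)"
      by (intro tendsto_intros source True)
    then show ?thesis using True by (simp add: \<phi>'_def src_sol_real(1)[OF \<phi> True, symmetric])
  qed (use S(3) in \<open>auto simp: \<phi>'_def\<close>)
  have [measurable]: "\<phi>' \<in> borel_measurable borel" by (rule borel_measurable_LIMSEQ_real[OF lim]) simp
  have \<phi>'0: "0 \<le> \<phi>' x" for x using S(2) by (intro LIMSEQ_le_const[OF lim]) auto
  have \<phi>'B: "s powr p * \<phi>' s \<le> Bd s" if "0 < s" "p = 2 \<or> p = \<gamma> + 2" for s p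
  proof (rule LIMSEQ_le_const2)
    show "(\<lambda>n. s powr p * \<phi> (r n) s) \<longlonglongrightarrow> s powr p * \<phi>' s" by (intro tendsto_intros lim)
  qed (use Bdn that in auto)
  have fixp: "\<phi>' x = A * (LBINT s. s powr (\<gamma> + 1) * W (x / s) * \<phi>' s)" if x: "0 < x" for x
  proof -
    have "(\<lambda>n. LBINT s. s powr (\<gamma> + 1) * W (x / s) * \<phi> (r n) s) \<longlonglongrightarrow> (LBINT s. s powr (\<gamma> + 1) * W (x / s) * \<phi>' s)"
      by (rule T_dct[where G = Bd]) (use S Bdn lim x Bd_integrable in auto)
    then have "(\<lambda>n. c (r n) * W (x / (real (r n) + 1)) + A * (LBINT s. s powr (\<gamma> + 1) * W (x / s) * \<phi> (r n) s))
        \<longlonglongrightarrow> 0 + A * (LBINT s. s powr (\<gamma> + 1) * W (x / s) * \<phi>' s)"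
      by (intro tendsto_intros source x)
    then have "(\<lambda>n. \<phi> (r n) x) \<longlonglongrightarrow> A * (LBINT s. s powr (\<gamma> + 1) * W (x / s) * \<phi>' s)"
      by (simp add: src_sol_real(1)[OF \<phi> x, symmetric])
    then show ?thesis using lim LIMSEQ_unique by blast
  qed
  have out: "\<phi>' x = 0" if "x \<le> 0" for x using that unfolding \<phi>'_def by simp
  have nn: "ennreal (s powr 2) * ennreal p = ennreal (s powr 2 * p)" if "0 \<le> p" for p s :: real
    using that by (simp add: ennreal_mult)
  have dom: "AE s in lborel. norm (s powr 2 * \<phi> n s) \<le> \<bar>Bd s\<bar>" for n
  proof (rule AE_I2)
    fix s show "norm (s powr 2 * \<phi> n s) \<le> \<bar>Bd s\<bar>"
      using Bdn[of s 2 n] S(2)[of n s] S(3)[of s n] by (cases "0 < s") auto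
  qed
  \<comment> \<open>The majorant keeps mass from escaping to zero or infinity, so the normalisation
    passes to the limit and the limit is not trivial.\<close>
  have "(\<lambda>n. LBINT s. s powr 2 * \<phi> (r n) s) \<longlonglongrightarrow> (LBINT s. s powr 2 * \<phi>' s)"
    by (rule integral_dominated_convergence[where w = "\<lambda>s. \<bar>Bd s\<bar>"])
      (use dom Bd_integrable lim in \<open>auto intro!: tendsto_intros\<close>)
  moreover have "(LBINT s. s powr 2 * \<phi> n s) = 1" for n
    using S(6)[of n] S(2) unfolding Mo_def
    by (subst integral_eq_nn_integral) (auto simp: nn)
  ultimately have int1: "(LBINT s. s powr 2 * \<phi>' s) = 1"
    by (simp add: LIMSEQ_const_iff)
  have int': "integrable lborel (\<lambda>s. s powr 2 * \<phi>' s)"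
  proof (rule Bochner_Integration.integrable_bound[OF Bd_integrable _ AE_I2])
    fix s show "norm (s powr 2 * \<phi>' s) \<le> norm (Bd s)"
      using \<phi>'B[of s 2] \<phi>'0[of s] out[of s] by (cases "0 < s") auto
  qed simp
  have "src_sol 0 1 \<phi>'"
    unfolding src_sol_def
  proof (intro conjI allI impI)
    show "ennreal (\<phi>' x) = ennreal 0 * ennreal (W (x / 1)) + T (\<lambda>s. ennreal (\<phi>' s)) x" for x
    proof (cases "0 < x")
      case True
      then show ?thesis
        using T_real(2)[of \<phi>' Bd x] \<phi>'0 out \<phi>'B Bd_integrable fixp[OF True] by simp
    next
      case False
      then show ?thesis using T_out[of x "\<lambda>s. ennreal (\<phi>' s)"] out by simp
    qed
    have "Mo 2 (\<lambda>x. ennreal (\<phi>' x)) = ennreal (LBINT s. s powr 2 * \<phi>' s)"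
      unfolding Mo_def nn[OF \<phi>'0] by (rule nn_integral_eq_integral[OF int']) (use \<phi>'0 in auto)
    then show "Mo 2 (\<lambda>x. ennreal (\<phi>' x)) = 1" using int1 by simp
  qed (use \<phi>'0 out in auto)
  then show ?thesis by blast
qed

end

section \<open>Smooth rapidly decaying functions\<close>

text \<open>The mean value inequality on the ball bounds every difference quotient by
  \<open>B\<close>, so dominated convergence applies to the quotients.\<close>

lemma has_real_derivative_integral_dominated:
  fixes F F' :: "real \<Rightarrow> 'a \<Rightarrow> real"
  assumes d: "d > 0"
    and int: "\<And>x. \<bar>x - x0\<bar> < d \<Longrightarrow> integrable M (F x)"
    and deriv: "\<And>x s. \<bar>x - x0\<bar> < d \<Longrightarrow> s \<in> space M \<Longrightarrow> ((\<lambda>x. F x s) has_real_derivative F' x s) (at x)"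
    and bound: "\<And>x s. \<bar>x - x0\<bar> < d \<Longrightarrow> s \<in> space M \<Longrightarrow> \<bar>F' x s\<bar> \<le> B s"
    and meas: "F' x0 \<in> borel_measurable M" and B: "integrable M B"
  shows "((\<lambda>x. \<integral>s. F x s \<partial>M) has_real_derivative (\<integral>s. F' x0 s \<partial>M)) (at x0)"
  unfolding has_field_derivative_iff tendsto_at_iff_sequentially
proof (intro allI impI)
  fix X :: "nat \<Rightarrow> real" assume X0: "\<forall>i. X i \<in> UNIV - {x0}" and X: "X \<longlonglongrightarrow> x0"
  then have "eventually (\<lambda>n. \<bar>X n - x0\<bar> < d) sequentially"
    using d by (auto simp: tendsto_iff dist_real_def)
  then obtain N where N: "\<And>n. n \<ge> N \<Longrightarrow> \<bar>X n - x0\<bar> < d"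
    by (auto simp: eventually_sequentially)
  have X': "(\<lambda>n. X (n + N)) \<longlonglongrightarrow> x0" using X by (rule LIMSEQ_ignore_initial_segment)
  have "(\<lambda>n. \<integral>s. (F (X (n + N)) s - F x0 s) / (X (n + N) - x0) \<partial>M) \<longlonglongrightarrow> (\<integral>s. F' x0 s \<partial>M)"
  proof (rule integral_dominated_convergence[where w = B])
    show "(\<lambda>s. (F (X (i + N)) s - F x0 s) / (X (i + N) - x0)) \<in> borel_measurable M" for i
      using int[of x0] int[OF N, of "i + N"] d by (auto intro!: borel_measurable_divide borel_measurable_diff)
    show "AE s in M. (\<lambda>i. (F (X (i + N)) s - F x0 s) / (X (i + N) - x0)) \<longlonglongrightarrow> F' x0 s"
    proof (rule AE_I2)
      fix s assume "s \<in> space M"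
      then have "((\<lambda>x. F x s) has_real_derivative F' x0 s) (at x0)" using deriv d by simp
      then have "((\<lambda>x. (F x s - F x0 s) / (x - x0)) \<longlongrightarrow> F' x0 s) (at x0)" by (simp add: has_field_derivative_iff)
      then show "(\<lambda>i. (F (X (i + N)) s - F x0 s) / (X (i + N) - x0)) \<longlonglongrightarrow> F' x0 s"
        using X0 X' by (auto simp: tendsto_at_iff_sequentially comp_def)
    qed
    show "AE s in M. norm ((F (X (i + N)) s - F x0 s) / (X (i + N) - x0)) \<le> B s" for i
    proof (rule AE_I2)
      fix s assume s: "s \<in> space M"
      have "norm (F (X (i + N)) s - F x0 s) \<le> B s * norm (X (i + N) - x0)"
      proof (rule field_differentiable_bound[of "ball x0 d" "\<lambda>x. F x s" "\<lambda>x. F' x s"])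
        fix z assume "z \<in> ball x0 d"
        then have z: "\<bar>z - x0\<bar> < d" by (auto simp: dist_real_def)
        show "((\<lambda>x. F x s) has_real_derivative F' z s) (at z within ball x0 d)"
          by (rule has_field_derivative_at_within[OF deriv[OF z s]])
        show "norm (F' z s) \<le> B s" using bound[OF z s] by simp
      qed (use d N[of "i + N"] in \<open>auto simp: dist_real_def\<close>)
      moreover have "X (i + N) - x0 \<noteq> 0" using X0 by auto
      ultimately show "norm ((F (X (i + N)) s - F x0 s) / (X (i + N) - x0)) \<le> B s"
        by (simp add: norm_divide pos_divide_le_eq)
    qed
  qed (use meas B in auto)
  also have "(\<lambda>n. \<integral>s. (F (X (n + N)) s - F x0 s) / (X (n + N) - x0) \<partial>M)
     = (\<lambda>n. ((\<integral>s. F (X (n + N)) s \<partial>M) - (\<integral>s. F x0 s \<partial>M)) / (X (n + N) - x0))"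
    using int N d by (auto simp: fun_eq_iff)
  finally show "((\<lambda>x. ((\<integral>s. F x s \<partial>M) - (\<integral>s. F x0 s \<partial>M)) / (x - x0)) \<circ> X) \<longlonglongrightarrow> (\<integral>s. F' x0 s \<partial>M)"
    unfolding comp_def by (rule LIMSEQ_offset)
qed

text \<open>Decay faster than any power on each half-line away from 0, with a constant depending on
  \<delta>; nothing is required at 0, where \<phi> may blow up.\<close>

definition rapid0 :: "(real \<Rightarrow> real) \<Rightarrow> bool" where
  "rapid0 u \<longleftrightarrow> continuous_on {0<..} u \<and> (\<forall>N \<delta>. 0 < \<delta> \<longrightarrow> (\<exists>C. \<forall>x\<ge>\<delta>. x powr N * \<bar>u x\<bar> \<le> C))"

text \<open>The derivative is an existential witness on (0,\<infinity>) rather than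
  \<open>deriv\<close>, so that closure properties follow by exhibiting a formula.\<close>

primrec rapid :: "nat \<Rightarrow> (real \<Rightarrow> real) \<Rightarrow> bool" where
  "rapid 0 u \<longleftrightarrow> rapid0 u"
| "rapid (Suc n) u \<longleftrightarrow> rapid0 u \<and> (\<exists>u'. (\<forall>x>0. (u has_real_derivative u' x) (at x)) \<and> rapid n u')"

lemma rapid_imp_0: "rapid n u \<Longrightarrow> rapid0 u"
  by (cases n) auto

lemma rapid_SucD: "rapid (Suc n) u \<Longrightarrow> rapid n u"
proof (induction n arbitrary: u)
  case (Suc n)
  then obtain u' where u': "\<forall>x>0. (u has_real_derivative u' x) (at x)" "rapid (Suc n) u'" "rapid0 u"
    unfolding rapid.simps(2)[of "Suc n"] by blast
  from u'(1,3) Suc.IH[OF u'(2)] show ?case unfolding rapid.simps(2)[of n] by blast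
qed simp

lemma rapid_SucE:
  assumes "rapid (Suc n) u"
  obtains u' where "\<And>x. 0 < x \<Longrightarrow> (u has_real_derivative u' x) (at x)" "rapid n u'"
  using assms by auto

lemma rapid_SucI:
  assumes "rapid0 u" "\<And>x. 0 < x \<Longrightarrow> (u has_real_derivative u' x) (at x)" "rapid n u'"
  shows "rapid (Suc n) u"
  unfolding rapid.simps using assms by blast

lemma rapid0I:
  assumes "\<And>x. 0 < x \<Longrightarrow> isCont u x" "\<And>N \<delta>. 0 < \<delta> \<Longrightarrow> \<exists>C. \<forall>x\<ge>\<delta>. x powr N * \<bar>u x\<bar> \<le> C"
  shows "rapid0 u"
  unfolding rapid0_def using assms by (blast intro: continuous_at_imp_continuous_on)

lemma rapid0_bound: "rapid0 u \<Longrightarrow> 0 < \<delta> \<Longrightarrow> \<exists>C. \<forall>x\<ge>\<delta>. x powr N * \<bar>u x\<bar> \<le> C"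
  unfolding rapid0_def by blast

lemma rapid0_bound':
  assumes "rapid0 u" "0 < \<delta>"
  shows "\<exists>C\<ge>0. \<forall>x\<ge>\<delta>. \<bar>u x\<bar> \<le> C * x powr - N"
proof -
  obtain C where C: "\<And>x. x \<ge> \<delta> \<Longrightarrow> x powr N * \<bar>u x\<bar> \<le> C" using rapid0_bound[OF assms] by blast
  have "0 \<le> \<delta> powr N * \<bar>u \<delta>\<bar>" by simp
  also have "\<dots> \<le> C" by (rule C) simp
  finally have "0 \<le> C" .
  have "\<bar>u x\<bar> \<le> C * x powr - N" if "x \<ge> \<delta>" for x
  proof -
    have "x powr - N * (x powr N * \<bar>u x\<bar>) \<le> x powr - N * C" using C[OF that] by (intro mult_left_mono) auto
    moreover have "x powr - N * x powr N = 1" using that assms(2) powr_add[of x "- N" N] by simp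
    ultimately have "1 * \<bar>u x\<bar> \<le> x powr - N * C" by (simp only: mult.assoc[symmetric])
    then show ?thesis by (simp only: mult_1_left mult.commute)
  qed
  with \<open>0 \<le> C\<close> show ?thesis by blast
qed

lemma rapid0_isCont: "rapid0 u \<Longrightarrow> 0 < x \<Longrightarrow> isCont u x"
  unfolding rapid0_def using continuous_on_interior[of "{0<..}" u x] by (simp add: interior_open)

lemma rapid0_continuous: "rapid0 u \<Longrightarrow> S \<subseteq> {0<..} \<Longrightarrow> continuous_on S u"
  unfolding rapid0_def by (blast intro: continuous_on_subset)

lemma rapid0_cong:
  assumes "\<And>x. 0 < x \<Longrightarrow> u x = v x" "rapid0 u"
  shows "rapid0 v"
proof -
  have "continuous_on {0<..} v"
    using assms continuous_on_cong[of "{0<..}" "{0<..}" u v] by (simp add: rapid0_def)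
  moreover have "\<exists>C. \<forall>x\<ge>\<delta>. x powr N * \<bar>v x\<bar> \<le> C" if \<delta>: "0 < \<delta>" for N \<delta>
  proof -
    obtain C where "\<And>x. x \<ge> \<delta> \<Longrightarrow> x powr N * \<bar>u x\<bar> \<le> C" using rapid0_bound[OF assms(2) \<delta>] by blast
    then have "x powr N * \<bar>v x\<bar> \<le> C" if "x \<ge> \<delta>" for x using that \<delta> assms(1)[of x] by (metis order_less_le_trans)
    then show ?thesis by blast
  qed
  ultimately show ?thesis unfolding rapid0_def by blast
qed

lemma rapid_cong:
  assumes "\<And>x. 0 < x \<Longrightarrow> u x = v x" "rapid n u"
  shows "rapid n v"
proof -
  have 0: "rapid0 v" by (rule rapid0_cong[OF assms(1) rapid_imp_0[OF assms(2)]])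
  show ?thesis
  proof (cases n)
    case (Suc m)
    then obtain u' where u': "\<And>x. 0 < x \<Longrightarrow> (u has_real_derivative u' x) (at x)" "rapid m u'"
      using assms(2) rapid_SucE by blast
    have "(v has_real_derivative u' x) (at x)" if "0 < x" for x
      by (rule has_field_derivative_transform_within_open[of u _ _ "{0<..}"]) (use u' that assms in auto)
    then show ?thesis unfolding Suc using 0 u'(2) by (blast intro: rapid_SucI)
  qed (use 0 in simp)
qed

lemma rapid0_cmult:
  assumes "rapid0 u" shows "rapid0 (\<lambda>x. c * u x)"
proof (rule rapid0I)
  show "isCont (\<lambda>x. c * u x) x" if "0 < x" for x using rapid0_isCont[OF assms that] by (intro continuous_intros)
  fix N \<delta> :: real assume "0 < \<delta>"
  then obtain C where C: "\<And>x. x \<ge> \<delta> \<Longrightarrow> x powr N * \<bar>u x\<bar> \<le> C" using rapid0_bound[OF assms] by blast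
  have "x powr N * \<bar>c * u x\<bar> \<le> \<bar>c\<bar> * C" if "x \<ge> \<delta>" for x
    using mult_left_mono[OF C[OF that], of "\<bar>c\<bar>"] by (simp add: abs_mult mult_ac)
  then show "\<exists>C. \<forall>x\<ge>\<delta>. x powr N * \<bar>c * u x\<bar> \<le> C" by blast
qed

lemma rapid0_add:
  assumes "rapid0 u" "rapid0 v" shows "rapid0 (\<lambda>x. u x + v x)"
proof (rule rapid0I)
  show "isCont (\<lambda>x. u x + v x) x" if "0 < x" for x
    using rapid0_isCont[OF assms(1) that] rapid0_isCont[OF assms(2) that] by (intro continuous_intros)
  fix N \<delta> :: real assume \<delta>: "0 < \<delta>"
  obtain C D where C: "\<And>x. x \<ge> \<delta> \<Longrightarrow> x powr N * \<bar>u x\<bar> \<le> C" "\<And>x. x \<ge> \<delta> \<Longrightarrow> x powr N * \<bar>v x\<bar> \<le> D"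
    using rapid0_bound[OF assms(1) \<delta>] rapid0_bound[OF assms(2) \<delta>] by blast
  have "x powr N * \<bar>u x + v x\<bar> \<le> C + D" if "x \<ge> \<delta>" for x
  proof -
    have "x powr N * \<bar>u x + v x\<bar> \<le> x powr N * (\<bar>u x\<bar> + \<bar>v x\<bar>)" by (intro mult_left_mono) auto
    also have "\<dots> = x powr N * \<bar>u x\<bar> + x powr N * \<bar>v x\<bar>" by (rule distrib_left)
    finally show ?thesis using C(1)[OF that] C(2)[OF that] by linarith
  qed
  then show "\<exists>C. \<forall>x\<ge>\<delta>. x powr N * \<bar>u x + v x\<bar> \<le> C" by blast
qed

lemma rapid0_powr:
  assumes "rapid0 u" shows "rapid0 (\<lambda>x. x powr p * u x)"
proof (rule rapid0I)
  show "isCont (\<lambda>x. x powr p * u x) x" if "0 < x" for x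
    using rapid0_isCont[OF assms that] that by (intro continuous_intros) auto
  fix N \<delta> :: real assume "0 < \<delta>"
  then obtain C where C: "\<And>x. x \<ge> \<delta> \<Longrightarrow> x powr (N + p) * \<bar>u x\<bar> \<le> C" using rapid0_bound[OF assms] by blast
  have "x powr N * \<bar>x powr p * u x\<bar> \<le> C" if "x \<ge> \<delta>" for x
    using C[OF that] by (simp add: abs_mult powr_add mult.assoc)
  then show "\<exists>C. \<forall>x\<ge>\<delta>. x powr N * \<bar>x powr p * u x\<bar> \<le> C" by blast
qed

lemma rapid_cmult: "rapid n u \<Longrightarrow> rapid n (\<lambda>x. c * u x)"
proof (induction n arbitrary: u)
  case (Suc n)
  then obtain u' where u': "\<And>x. 0 < x \<Longrightarrow> (u has_real_derivative u' x) (at x)" "rapid n u'" using rapid_SucE by blast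
  show ?case
    by (rule rapid_SucI[where u' = "\<lambda>x. c * u' x"])
      (use u' in \<open>auto intro!: derivative_eq_intros rapid0_cmult rapid_imp_0[OF Suc.prems] Suc.IH\<close>)
qed (simp add: rapid0_cmult)

lemma rapid_add: "rapid n u \<Longrightarrow> rapid n v \<Longrightarrow> rapid n (\<lambda>x. u x + v x)"
proof (induction n arbitrary: u v)
  case (Suc n)
  obtain u' where u': "\<And>x. 0 < x \<Longrightarrow> (u has_real_derivative u' x) (at x)" "rapid n u'" using Suc.prems(1) rapid_SucE by blast
  obtain v' where v': "\<And>x. 0 < x \<Longrightarrow> (v has_real_derivative v' x) (at x)" "rapid n v'" using Suc.prems(2) rapid_SucE by blast
  show ?case
    by (rule rapid_SucI[where u' = "\<lambda>x. u' x + v' x"])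
      (use u' v' in \<open>auto intro!: derivative_eq_intros rapid0_add rapid_imp_0[OF Suc.prems(1)] rapid_imp_0[OF Suc.prems(2)] Suc.IH\<close>)
qed (simp add: rapid0_add)

lemma rapid_diff: "rapid n u \<Longrightarrow> rapid n v \<Longrightarrow> rapid n (\<lambda>x. u x - v x)"
  using rapid_add[of n u "\<lambda>x. (- 1) * v x"] rapid_cmult[of n v "- 1"] by simp

text \<open>The exponent p has to vary in the induction, as the product rule also produces the
  exponent p - 1.\<close>

lemma rapid_powr: "rapid n u \<Longrightarrow> rapid n (\<lambda>x. x powr p * u x)"
proof (induction n arbitrary: u p)
  case (Suc n)
  obtain u' where u': "\<And>x. 0 < x \<Longrightarrow> (u has_real_derivative u' x) (at x)" "rapid n u'" using Suc.prems(1) rapid_SucE by blast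
  show ?case
  proof (rule rapid_SucI[where u' = "\<lambda>x. x powr p * u' x + p * (x powr (p - 1) * u x)"])
    show "rapid0 (\<lambda>x. x powr p * u x)" by (rule rapid0_powr[OF rapid_imp_0[OF Suc.prems]])
    show "rapid n (\<lambda>x. x powr p * u' x + p * (x powr (p - 1) * u x))"
      by (rule rapid_add[OF Suc.IH[OF u'(2)] rapid_cmult[OF Suc.IH[OF rapid_SucD[OF Suc.prems]]]])
    show "((\<lambda>x. x powr p * u x) has_real_derivative x powr p * u' x + p * (x powr (p - 1) * u x)) (at x)" if "0 < x" for x
      using that by (auto intro!: derivative_eq_intros u'(1))
  qed
qed (simp add: rapid0_powr)

lemma rapid_integrable:
  assumes "rapid0 v" "0 < x"
  shows "set_integrable lborel {x<..} v"
proof -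
  obtain C where C: "0 \<le> C" "\<And>y. y \<ge> x \<Longrightarrow> \<bar>v y\<bar> \<le> C * y powr - 2"
    using rapid0_bound'[OF assms] by blast
  have "(NN s. indicator {x..} s * ennreal (s powr - 2)) < top"
    using assms(2) by (subst nn_integral_powr_to_inf) auto
  then have "integrable lborel (\<lambda>s::real. indicator {x..} s * s powr - 2)"
    by (intro integrableI_nonneg) (auto simp: ennreal_mult' ennreal_indicator)
  then have "integrable lborel (\<lambda>s::real. C * (indicator {x..} s * s powr - 2))" by simp
  then show ?thesis unfolding set_integrable_def
  proof (rule Bochner_Integration.integrable_bound)
    show "(\<lambda>s. indicator {x<..} s *\<^sub>R v s) \<in> borel_measurable lborel"
      using borel_measurable_continuous_on_indicator[of "{x<..}" v] rapid0_continuous[OF assms(1), of "{x<..}"] assms(2)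
      by auto
  qed (use C in \<open>auto split: split_indicator\<close>)
qed

definition tail :: "(real \<Rightarrow> real) \<Rightarrow> real \<Rightarrow> real" where
  "tail v x = (LINT y:{x<..}|lborel. v y)"

text \<open>On [x/2, 2x] the tail is a constant minus an ordinary indefinite integral of a
  continuous function.\<close>

lemma tail_deriv:
  assumes "rapid0 v" "0 < x"
  shows "(tail v has_real_derivative - v x) (at x)"
proof -
  define a b where "a = x / 2" and "b = 2 * x"
  have ab: "0 < a" "a < x" "x < b" using assms by (auto simp: a_def b_def)
  have c: "continuous_on {a..b} v" using ab by (intro rapid0_continuous[OF assms(1)]) auto
  have eq: "tail v y = tail v a - integral {a..y} v" if "y \<in> {a<..<b}" for y
  proof -
    have "tail v a = (LINT z:{a<..y} \<union> {y<..}|lborel. v z)"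
      unfolding tail_def using that by (intro arg_cong[where f = "\<lambda>S. LINT z:S|lborel. v z"]) auto
    also have "\<dots> = (LINT z:{a<..y}|lborel. v z) + tail v y"
      unfolding tail_def
      by (rule set_integral_Un) (use that ab in \<open>auto intro: set_integrable_subset[OF rapid_integrable[OF assms(1) ab(1)]]\<close>)
    also have "(LINT z:{a<..y}|lborel. v z) = integral {a<..y} v"
      by (intro set_borel_integral_eq_integral set_integrable_subset[OF rapid_integrable[OF assms(1) ab(1)]]) (use that in auto)
    also have "\<dots> = integral {a..y} v"
      by (rule integral_subset_negligible) (auto intro: negligible_subset[of "{a}"])
    finally show ?thesis by simp
  qed
  have "((\<lambda>y. integral {a..y} v) has_real_derivative v x) (at x within {a..b})"
    by (rule integral_has_real_derivative[OF c]) (use ab in auto)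
  then have "((\<lambda>y. integral {a..y} v) has_real_derivative v x) (at x)"
    using ab by (simp add: at_within_Icc_at)
  then have "((\<lambda>y. tail v a - integral {a..y} v) has_real_derivative - v x) (at x)"
    by (auto intro!: derivative_eq_intros)
  then show ?thesis
    by (rule has_field_derivative_transform_within_open[of _ _ _ "{a<..<b}"]) (use ab eq in auto)
qed

lemma rapid_tail: "rapid n v \<Longrightarrow> rapid (Suc n) (tail v)"
proof (rule rapid_SucI[where u' = "\<lambda>x. - v x"])
  assume n: "rapid n v"
  note v = rapid_imp_0[OF n]
  show "(tail v has_real_derivative - v x) (at x)" if "0 < x" for x using tail_deriv[OF v that] .
  show "rapid n (\<lambda>x. - v x)" using rapid_cmult[OF n, of "- 1"] by simp
  show "rapid0 (tail v)"
  proof (rule rapid0I)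
    show "isCont (tail v) x" if "0 < x" for x using tail_deriv[OF v that] by (rule DERIV_isCont)
    fix N \<delta> :: real assume \<delta>: "0 < \<delta>"
    \<comment> \<open>With M = max N 0 the function y^(-M) is antitone, so y^(-M) \<le> x^(-M) for y
      > x, and y^(-2) remains to be integrated.\<close>
    define M where "M = max N 0"
    obtain C where C: "0 \<le> C" "\<And>y. y \<ge> \<delta> \<Longrightarrow> \<bar>v y\<bar> \<le> C * y powr - (M + 2)"
      using rapid0_bound'[OF v \<delta>] by blast
    have I: "(NN s. indicator {\<delta>..} s * ennreal (s powr - 2)) < top"
      using \<delta> by (subst nn_integral_powr_to_inf) auto
    have i: "integrable lborel (\<lambda>s::real. indicator {\<delta>..} s * s powr - 2)"
      using I by (intro integrableI_nonneg) (auto simp: ennreal_mult' ennreal_indicator)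
    define D where "D = (LBINT s. indicator {\<delta>..} s * s powr - 2)"
    have D: "0 \<le> D" unfolding D_def by (intro integral_nonneg_AE) auto
    have "x powr N * \<bar>tail v x\<bar> \<le> \<delta> powr (N - M) * (C * D)" if x: "x \<ge> \<delta>" for x
    proof -
      have "\<bar>tail v x\<bar> \<le> (LBINT y. x powr - M * C * (indicator {\<delta>..} y * y powr - 2))"
        unfolding tail_def set_lebesgue_integral_def real_norm_def[symmetric]
      proof (rule Bochner_Integration.integral_norm_bound_integral)
        show "integrable lborel (\<lambda>y. indicator {x<..} y *\<^sub>R v y)"
          using rapid_integrable[OF v, of x] x \<delta> by (simp add: set_integrable_def)
        fix y
        show "norm (indicat_real {x<..} y *\<^sub>R v y) \<le> x powr - M * C * (indicator {\<delta>..} y * y powr - 2)"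
        proof (cases "x < y")
          case True
          have "\<bar>v y\<bar> \<le> C * y powr - (M + 2)" using C(2)[of y] True x by simp
          also have "y powr - (M + 2) = y powr - M * y powr - 2"
            using powr_add[of y "- M" "- 2"] by simp
          also have "C * (y powr - M * y powr - 2) \<le> C * (x powr - M * y powr - 2)"
            using True x \<delta> C(1) by (intro mult_left_mono mult_right_mono powr_mono2') (auto simp: M_def)
          finally show ?thesis using True x by (simp add: mult_ac)
        qed (use C(1) in auto)
      qed (use i in auto)
      also have "\<dots> = x powr - M * (C * D)" by (simp add: D_def)
      finally have "x powr N * \<bar>tail v x\<bar> \<le> x powr N * (x powr - M * (C * D))" by (intro mult_left_mono) auto
      also have "\<dots> = x powr (N - M) * (C * D)" using powr_add[of x N "- M"] by simp
      also have "\<dots> \<le> \<delta> powr (N - M) * (C * D)"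
        using x \<delta> C D by (intro mult_right_mono powr_mono2') (auto simp: M_def)
      finally show ?thesis .
    qed
    then show "\<exists>C. \<forall>x\<ge>\<delta>. x powr N * \<bar>tail v x\<bar> \<le> C" by blast
  qed
qed

text \<open>The iterated \<open>deriv\<close> is matched to the witnesses of \<open>rapid\<close> on
  (0,\<infinity>) only. A derivative is unique there, so the witnesses obtained for different n
  coincide and one v serves all n.\<close>

lemma rapid_higher_deriv:
  assumes "\<And>n. rapid n u"
  shows "\<exists>v. (\<forall>n. rapid n v) \<and> (\<forall>x>0. (deriv ^^ k) u x = v x)"
proof (induction k)
  case 0
  then show ?case using assms by auto
next
  case (Suc k)
  then obtain v where v: "\<And>n. rapid n v" "\<And>x. 0 < x \<Longrightarrow> (deriv ^^ k) u x = v x" by blast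
  have "\<exists>w. (\<forall>x>0. (v has_real_derivative w x) (at x)) \<and> rapid n w" for n
    using v(1)[of "Suc n"] by auto
  then obtain w where w: "\<And>n x. 0 < x \<Longrightarrow> (v has_real_derivative w n x) (at x)" "\<And>n. rapid n (w n)" by metis
  have d: "deriv v x = w n x" if "0 < x" for x n using w(1)[OF that] by (rule DERIV_imp_deriv)
  have "rapid n (deriv v)" for n
    by (rule rapid_cong[OF _ w(2)[of n]]) (rule d[symmetric])
  moreover have "(deriv ^^ Suc k) u x = deriv v x" if "0 < x" for x
  proof -
    have "eventually (\<lambda>y. (deriv ^^ k) u y = v y) (nhds x)"
      using order_tendstoD(1)[OF filterlim_ident that] by eventually_elim (rule v(2))
    then show ?thesis by (simp add: deriv_cong_ev)
  qed
  ultimately show ?case by blast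
qed

lemma rapid_smooth:
  assumes "\<And>n. rapid n u"
  shows "smooth_on_pos u"
  unfolding smooth_on_pos_def
proof (intro allI impI)
  fix k and x :: real assume x: "0 < x"
  obtain v where v: "\<And>n. rapid n v" "\<And>x. 0 < x \<Longrightarrow> (deriv ^^ k) u x = v x"
    using rapid_higher_deriv[OF assms] by blast
  from v(1)[of 1] obtain w where "\<forall>x>0. (v has_real_derivative w x) (at x)" by auto
  then have "(v has_real_derivative w x) (at x)" using x by blast
  then have "((deriv ^^ k) u has_real_derivative w x) (at x)"
    by (rule has_field_derivative_transform_within_open[of v _ _ "{0<..}"]) (auto simp: v(2) x)
  then show "(deriv ^^ k) u field_differentiable at x" by (auto simp: field_differentiable_def)
qed

section \<open>The gain operator and the mass flux\<close>

context daughter_kernel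
begin

text \<open>The substitution s = x t in the gain integral of h(x/s)/s u(s) produces this kernel. It
  is free of x, so x occurs only inside u and the gain can be differentiated under the integral
  without any regularity of \<open>h\<close>.\<close>

definition k :: "real \<Rightarrow> real" where "k t = h (1 / t) / t"

definition gain :: "(real \<Rightarrow> real) \<Rightarrow> real \<Rightarrow> real" where
  "gain u x = (LBINT t. k t * u (x * t))"

text \<open>If u is the rate at which particles break, this is the rate at which mass passes from
  sizes above x to sizes below x.\<close>

definition flux :: "(real \<Rightarrow> real) \<Rightarrow> real \<Rightarrow> real" where
  "flux u x = (LBINT s. indicator {x<..} s * (s * H (x / s) * u s))"

lemma k_meas[measurable]: "k \<in> borel_measurable borel"
  unfolding k_def[abs_def] by measurable

lemma k_eq0: "t \<le> 1 \<Longrightarrow> k t = 0"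
  unfolding k_def by (cases "0 < t") (auto intro!: h_out simp: divide_simps)

lemma k_ge0: "0 \<le> k t"
  using k_eq0[of t] h_ge0[of "1 / t"] by (cases "t \<le> 1") (auto simp: k_def)

lemma H_tail: "(NN t. indicator {r<..} t * ennreal (t * h t)) = ennreal (1 - H r)"
proof -
  have "1 = (NN t. indicator {r<..} t * ennreal (t * h t) + indicator {..<r} t * ennreal (t * h t))"
    unfolding h_mass[symmetric]
  proof (rule nn_integral_cong_AE)
    show "AE t in lborel. ennreal (t * h t) = indicator {r<..} t * ennreal (t * h t) + indicator {..<r} t * ennreal (t * h t)"
      using AE_lborel_singleton[of r] by eventually_elim (auto split: split_indicator)
  qed
  also have "\<dots> = (NN t. indicator {r<..} t * ennreal (t * h t)) + ennreal (H r)"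
    unfolding ennreal_H by (rule nn_integral_add) measurable
  finally have "ennreal 1 = (NN t. indicator {r<..} t * ennreal (t * h t)) + ennreal (H r)" by simp
  then have "ennreal 1 - ennreal (H r) = (NN t. indicator {r<..} t * ennreal (t * h t)) + ennreal (H r) - ennreal (H r)"
    by (simp only:)
  also have "\<dots> = (NN t. indicator {r<..} t * ennreal (t * h t))" by (rule ennreal_add_diff_cancel_right) simp
  finally show ?thesis using H_ge0[of r] by (simp add: ennreal_minus del: ennreal_1)
qed

lemma nn_gain_scale:
  assumes [measurable]: "u \<in> borel_measurable borel" and "0 < y"
  shows "(NN s. ennreal (h (y / s) / s * u s)) = (NN t. ennreal (k t * u (y * t)))"
proof -
  have "(NN s. ennreal (h (y / s) / s * u s))
    = ennreal y * (NN t. ennreal (h (y / (y * t)) / (y * t) * u (y * t)))"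
    by (rule nn_integral_scale) (use assms in auto)
  also have "\<dots> = (NN t. ennreal y * ennreal (h (y / (y * t)) / (y * t) * u (y * t)))"
    by (subst nn_integral_cmult) auto
  also have "\<dots> = (NN t. ennreal (k t * u (y * t)))"
    using assms by (intro nn_integral_cong) (simp add: ennreal_mult'[symmetric] k_def)
  finally show ?thesis .
qed

text \<open>Of the mass s u(s) leaving size s > x, the share 1 - H(x/s) goes to fragments larger
  than x (\<open>H_tail\<close>) and the share H(x/s) to smaller ones. Fubini and the scaling y = s
  t give this in \<open>ennreal\<close>, before any finiteness.\<close>

lemma nn_flux:
  assumes [measurable]: "u \<in> borel_measurable borel" and u: "\<And>s. 0 \<le> u s" "\<And>s. s \<le> 0 \<Longrightarrow> u s = 0" and x: "0 \<le> x"
  shows "(NN y. indicator {x<..} y * (ennreal y * (NN t. ennreal (k t * u (y * t)))))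
      + (NN s. indicator {x<..} s * ennreal (s * H (x / s) * u s))
      = (NN s. indicator {x<..} s * ennreal (s * u s))"
proof -
  have "(NN y. indicator {x<..} y * (ennreal y * (NN t. ennreal (k t * u (y * t)))))
      = (NN y. NN s. indicator {x<..} y * (ennreal y * ennreal (h (y / s) / s * u s)))"
  proof (rule nn_integral_cong)
    fix y
    show "indicator {x<..} y * (ennreal y * (NN t. ennreal (k t * u (y * t))))
      = (NN s. indicator {x<..} y * (ennreal y * ennreal (h (y / s) / s * u s)))"
    proof (cases "x < y")
      case True
      then have "0 < y" using x by simp
      then show ?thesis using True by (simp add: nn_gain_scale[symmetric] nn_integral_cmult)
    qed simp
  qed
  also have "\<dots> = (NN s. NN y. indicator {x<..} y * (ennreal y * ennreal (h (y / s) / s * u s)))"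
    by (rule lborel_pair.Fubini') measurable
  also have "\<dots> = (NN s. indicator {x<..} s * ennreal (s * (1 - H (x / s)) * u s))"
  proof (rule nn_integral_cong)
    fix s
    show "(NN y. indicator {x<..} y * (ennreal y * ennreal (h (y / s) / s * u s)))
      = indicator {x<..} s * ennreal (s * (1 - H (x / s)) * u s)"
    proof (cases "0 < s")
      case True
      have "(NN y. indicator {x<..} y * (ennreal y * ennreal (h (y / s) / s * u s)))
        = ennreal s * (NN t. indicator {x<..} (s * t) * (ennreal (s * t) * ennreal (h (s * t / s) / s * u s)))"
        by (rule nn_integral_scale) (use True in auto)
      also have "(NN t. indicator {x<..} (s * t) * (ennreal (s * t) * ennreal (h (s * t / s) / s * u s)))
        = (NN t. ennreal (u s) * (indicator {x / s<..} t * ennreal (t * h t)))"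
      proof (rule nn_integral_cong)
        fix t
        have i: "indicator {x<..} (s * t) = (indicator {x / s<..} t :: ennreal)"
          using True by (auto simp: indicator_def divide_simps mult.commute)
        show "indicator {x<..} (s * t) * (ennreal (s * t) * ennreal (h (s * t / s) / s * u s))
          = ennreal (u s) * (indicator {x / s<..} t * ennreal (t * h t))"
        proof (cases "x / s < t")
          case t: True
          have "0 \<le> x / s" using x True by simp
          then have "0 < t" using t by linarith
          then have "ennreal (s * t) * ennreal (h (s * t / s) / s * u s) = ennreal (u s) * ennreal (t * h t)"
            using True u(1)[of s] h_ge0[of t] by (subst (1 2) ennreal_mult'[symmetric]) (auto simp: mult_ac)
          then show ?thesis unfolding i using t by simp
        qed (simp add: i)
      qed
      also have "\<dots> = ennreal (u s) * ennreal (1 - H (x / s))"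
        by (subst nn_integral_cmult) (auto simp: H_tail)
      also have "ennreal s * (ennreal (u s) * ennreal (1 - H (x / s))) = ennreal (s * (1 - H (x / s)) * u s)"
        using True u(1)[of s] H_le1[of "x / s"] by (simp add: ennreal_mult'[symmetric] mult_ac)
      also have "\<dots> = indicator {x<..} s * ennreal (s * (1 - H (x / s)) * u s)"
        using True H_eq1[of "x / s"] by (cases "x < s") (auto simp: divide_simps)
      finally show ?thesis .
    qed (use u x in auto)
  qed
  finally have 1: "(NN y. indicator {x<..} y * (ennreal y * (NN t. ennreal (k t * u (y * t)))))
    = (NN s. indicator {x<..} s * ennreal (s * (1 - H (x / s)) * u s))" .
  have "(NN s. indicator {x<..} s * ennreal (s * (1 - H (x / s)) * u s)) + (NN s. indicator {x<..} s * ennreal (s * H (x / s) * u s))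
     = (NN s. indicator {x<..} s * ennreal (s * (1 - H (x / s)) * u s) + indicator {x<..} s * ennreal (s * H (x / s) * u s))"
    by (rule nn_integral_add[symmetric]) measurable
  also have "\<dots> = (NN s. indicator {x<..} s * ennreal (s * u s))"
  proof (rule nn_integral_cong)
    fix s
    show "indicator {x<..} s * ennreal (s * (1 - H (x / s)) * u s) + indicator {x<..} s * ennreal (s * H (x / s) * u s)
       = indicator {x<..} s * ennreal (s * u s)"
    proof (cases "x < s")
      case True
      have "ennreal (s * (1 - H (x / s)) * u s) + ennreal (s * H (x / s) * u s) = ennreal (s * (1 - H (x / s)) * u s + s * H (x / s) * u s)"
        using True x u(1)[of s] H_le1[of "x / s"] H_ge0[of "x / s"] by (intro ennreal_plus[symmetric]) auto
      then show ?thesis using True by (simp add: algebra_simps)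
    qed simp
  qed
  finally show ?thesis unfolding 1 .
qed

text \<open>Under t = 1/z this is the integral of z^3 h(z). The exponent 4 suits the test function
  s^(-4) on s > 1, whose mass integrand s^(-3) is integrable; the result is the common majorant of
  the gain integrands.\<close>

lemma k_moment_integrable: "integrable lborel (\<lambda>t. k t * t powr - 4)"
proof -
  \<comment> \<open>\<open>k\<close> is \<open>h\<close> under \<open>t \<mapsto> 1 / t\<close>; testing the flux identity with \<open>u\<close> avoids that change of variables.\<close>
  define u :: "real \<Rightarrow> real" where "u s = indicator {1<..} s * s powr - 4" for s
  have [measurable]: "u \<in> borel_measurable borel" unfolding u_def[abs_def] by measurable
  define \<kappa> where "\<kappa> = (NN t. ennreal (k t * t powr - 4))"
  have P: "(NN y. indicator {1<..} y * ennreal (y powr - 3)) = ennreal (1 / 2)"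
  proof -
    have "(NN y. indicator {1<..} y * ennreal (y powr - 3)) = (NN y. indicator {1..} y * ennreal (y powr - 3))"
    proof (rule nn_integral_cong_AE)
      show "AE y in lborel. indicator {1<..} y * ennreal (y powr - 3) = indicator {1..} y * ennreal (y powr - 3)"
        using AE_lborel_singleton[of "1::real"] by eventually_elim (auto split: split_indicator)
    qed
    also have "\<dots> = ennreal (1 / 2)" by (subst nn_integral_powr_to_inf) auto
    finally show ?thesis .
  qed
  \<comment> \<open>For y > 1 and t > 1 the test function factors as y^(-4) t^(-4), so the gain term
    of the flux identity is exactly \<kappa>/2 and is bounded by the total mass integral.\<close>
  have "ennreal (1 / 2) * \<kappa> = (NN y. indicator {1<..} y * ennreal (y powr - 3) * \<kappa>)"
    unfolding P[symmetric] by (rule nn_integral_multc[symmetric]) measurable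
  also have "\<dots> = (NN y. indicator {1<..} y * (ennreal y * (NN t. ennreal (k t * u (y * t)))))"
  proof (rule nn_integral_cong)
    fix y :: real
    show "indicator {1<..} y * ennreal (y powr - 3) * \<kappa> = indicator {1<..} y * (ennreal y * (NN t. ennreal (k t * u (y * t))))"
    proof (cases "1 < y")
      case True
      have "(NN t. ennreal (k t * u (y * t))) = (NN t. ennreal (y powr - 4) * ennreal (k t * t powr - 4))"
      proof (rule nn_integral_cong)
        fix t
        show "ennreal (k t * u (y * t)) = ennreal (y powr - 4) * ennreal (k t * t powr - 4)"
        proof (cases "t \<le> 1")
          case False
          then have "1 < y * t" using True by (simp add: less_1_mult)
          then show ?thesis using False True by (simp add: u_def powr_mult ennreal_mult'[symmetric] mult_ac)
        qed (simp add: k_eq0)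
      qed
      also have "\<dots> = ennreal (y powr - 4) * \<kappa>" unfolding \<kappa>_def by (rule nn_integral_cmult) measurable
      finally have "ennreal y * (NN t. ennreal (k t * u (y * t))) = ennreal (y * y powr - 4) * \<kappa>"
        using True by (simp add: ennreal_mult' mult.assoc)
      also have "y * y powr - 4 = y powr - 3" using True powr_add[of y 1 "- 4"] by simp
      finally show ?thesis using True by simp
    qed simp
  qed
  also have "\<dots> \<le> (NN s. indicator {1<..} s * ennreal (s * u s))"
    by (subst nn_flux[symmetric]) (auto simp: u_def)
  also have "\<dots> = (NN s. indicator {1<..} s * ennreal (s powr - 3))"
  proof (rule nn_integral_cong)
    fix s :: real
    have "s * s powr - 4 = s powr - 3" if "1 < s" using that powr_add[of s 1 "- 4"] by simp
    then show "indicator {1<..} s * ennreal (s * u s) = indicator {1<..} s * ennreal (s powr - 3)"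
      by (auto simp: u_def split: split_indicator)
  qed
  also have "\<dots> < top" unfolding P by (rule ennreal_less_top)
  finally have "\<kappa> < top" by (auto simp: ennreal_mult_less_top)
  then show ?thesis unfolding \<kappa>_def by (intro integrableI_nonneg) (auto simp: k_ge0)
qed

lemma gain_integrand_meas:
  assumes "rapid0 u" "0 < x"
  shows "(\<lambda>t. k t * u (x * t)) \<in> borel_measurable borel"
proof -
  have [measurable]: "(\<lambda>y. if 0 < y then u y else 0) \<in> borel_measurable borel"
    using assms by (intro borel_measurable_zero_ext) (simp add: rapid0_def)
  have "(\<lambda>t. k t * (if 0 < x * t then u (x * t) else 0)) \<in> borel_measurable borel"
    by measurable
  also have "(\<lambda>t. k t * (if 0 < x * t then u (x * t) else 0)) = (\<lambda>t. k t * u (x * t))"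
  proof
    fix t show "k t * (if 0 < x * t then u (x * t) else 0) = k t * u (x * t)"
      using k_eq0[of t] assms(2) by (cases "0 < t") (auto simp: zero_less_mult_iff)
  qed
  finally show ?thesis .
qed

text \<open>The kernel \<open>k\<close> lives on t > 1, so x t \<ge> x \<ge> \<delta> and only the
  decay of u away from 0 is used.\<close>

lemma gain_integrand_bound:
  assumes "rapid0 u" "0 < \<delta>" "4 \<le> N"
  shows "\<exists>C\<ge>0. \<forall>x\<ge>\<delta>. \<forall>t. \<bar>k t * u (x * t)\<bar> \<le> C * x powr - N * (k t * t powr - 4)"
proof -
  obtain C where C: "0 \<le> C" "\<And>x. x \<ge> \<delta> \<Longrightarrow> \<bar>u x\<bar> \<le> C * x powr - N"
    using rapid0_bound'[OF assms(1,2)] by blast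
  have "\<bar>k t * u (x * t)\<bar> \<le> C * x powr - N * (k t * t powr - 4)" if x: "x \<ge> \<delta>" for x t
  proof (cases "t \<le> 1")
    case False
    then have t: "1 < t" by simp
    have "\<delta> * 1 \<le> x * t" using x t assms(2) by (intro mult_mono) auto
    then have "\<bar>u (x * t)\<bar> \<le> C * (x * t) powr - N" using C(2) by simp
    also have "(x * t) powr - N = x powr - N * t powr - N" using x t assms(2) by (simp add: powr_mult)
    also have "x powr - N * t powr - N \<le> x powr - N * t powr - 4"
      using t assms(3) by (intro mult_left_mono powr_mono) auto
    then have "C * (x powr - N * t powr - N) \<le> C * (x powr - N * t powr - 4)" using C(1) by (rule mult_left_mono)
    finally have "k t * \<bar>u (x * t)\<bar> \<le> k t * (C * (x powr - N * t powr - 4))" by (intro mult_left_mono k_ge0)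
    then show ?thesis using k_ge0[of t] by (simp add: abs_mult mult_ac)
  qed (simp add: k_eq0)
  then show ?thesis using C(1) by blast
qed

lemma gain_integrable:
  assumes "rapid0 u" "0 < x"
  shows "integrable lborel (\<lambda>t. k t * u (x * t))"
proof -
  obtain C where C: "\<And>y t. y \<ge> x \<Longrightarrow> \<bar>k t * u (y * t)\<bar> \<le> C * y powr - 4 * (k t * t powr - 4)"
    using gain_integrand_bound[OF assms, of 4] by auto
  have "integrable lborel (\<lambda>t. C * x powr - 4 * (k t * t powr - 4))"
    by (intro integrable_mult_right k_moment_integrable)
  then show ?thesis
  proof (rule Bochner_Integration.integrable_bound[OF _ _ AE_I2])
    fix t
    have "norm (k t * u (x * t)) \<le> C * x powr - 4 * (k t * t powr - 4)" using C[of x t] by simp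
    then show "norm (k t * u (x * t)) \<le> norm (C * x powr - 4 * (k t * t powr - 4))" by (rule order_trans) simp
  qed (use gain_integrand_meas[OF assms] in auto)
qed

lemma rapid0_gain:
  assumes "rapid0 u" shows "rapid0 (gain u)"
proof (rule rapid0I)
  fix x :: real assume x: "0 < x"
  obtain C where C: "0 \<le> C" "\<And>y t. y \<ge> x / 2 \<Longrightarrow> \<bar>k t * u (y * t)\<bar> \<le> C * y powr - 4 * (k t * t powr - 4)"
    using gain_integrand_bound[OF assms, of "x / 2" 4] x by auto
  show "isCont (gain u) x"
    unfolding gain_def[abs_def]
  proof (rule isCont_integral_dominated[where d = "x/2" and B = "\<lambda>t. C * (x / 2) powr - 4 * (k t * t powr - 4)"])
    show "(\<lambda>t. k t * u (y * t)) \<in> borel_measurable lborel" if "\<bar>y - x\<bar> < x / 2" for y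
    proof -
      have "0 < y" using that x by (auto simp: abs_if split: if_splits)
      then show ?thesis using gain_integrand_meas[OF assms, of y] by simp
    qed
    show "AE t in lborel. isCont (\<lambda>x. k t * u (x * t)) x"
    proof (rule AE_I2)
      fix t
      show "isCont (\<lambda>x. k t * u (x * t)) x"
      proof (cases "t \<le> 1")
        case False
        then have "isCont u (x * t)" using x by (intro rapid0_isCont[OF assms]) auto
        then have "isCont (\<lambda>x. u (x * t)) x"
          by (rule isCont_o2[where f = "\<lambda>x. x * t" and g = u, rotated]) (intro continuous_intros)
        then show ?thesis by (intro continuous_intros)
      qed (simp add: k_eq0)
    qed
    show "AE t in lborel. \<bar>k t * u (y * t)\<bar> \<le> C * (x / 2) powr - 4 * (k t * t powr - 4)" if "\<bar>y - x\<bar> < x / 2" for y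
    proof (rule AE_I2)
      fix t
      have y: "x / 2 \<le> y" using that by (auto simp: abs_if split: if_splits)
      have "C * y powr - 4 * (k t * t powr - 4) \<le> C * (x / 2) powr - 4 * (k t * t powr - 4)"
        using y x C(1) k_ge0[of t] by (intro mult_right_mono mult_left_mono powr_mono2') auto
      with C(2)[OF y, of t] show "\<bar>k t * u (y * t)\<bar> \<le> C * (x / 2) powr - 4 * (k t * t powr - 4)" by linarith
    qed
  qed (use x in \<open>auto intro!: integrable_mult_right k_moment_integrable\<close>)
next
  fix N \<delta> :: real assume \<delta>: "0 < \<delta>"
  define M where "M = max N 4"
  obtain C where C: "0 \<le> C" "\<And>y t. y \<ge> \<delta> \<Longrightarrow> \<bar>k t * u (y * t)\<bar> \<le> C * y powr - M * (k t * t powr - 4)"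
    using gain_integrand_bound[OF assms \<delta>, of M] by (auto simp: M_def)
  define D where "D = (LBINT t. k t * t powr - 4)"
  have D: "0 \<le> D" unfolding D_def using k_ge0 by (intro integral_nonneg_AE) auto
  have "x powr N * \<bar>gain u x\<bar> \<le> \<delta> powr (N - M) * (C * D)" if x: "x \<ge> \<delta>" for x
  proof -
    have "\<bar>gain u x\<bar> \<le> (LBINT t. C * x powr - M * (k t * t powr - 4))"
      unfolding gain_def real_norm_def[symmetric]
      by (rule Bochner_Integration.integral_norm_bound_integral)
        (use gain_integrable[OF assms, of x] x \<delta> C(2)[OF x] in \<open>auto intro!: integrable_mult_right k_moment_integrable\<close>)
    also have "\<dots> = x powr - M * (C * D)" by (simp add: D_def)
    finally have "x powr N * \<bar>gain u x\<bar> \<le> x powr N * (x powr - M * (C * D))" by (intro mult_left_mono) auto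
    also have "\<dots> = x powr (N - M) * (C * D)" using powr_add[of x N "- M"] by simp
    also have "\<dots> \<le> \<delta> powr (N - M) * (C * D)"
      using x \<delta> C(1) D by (intro mult_right_mono powr_mono2') (auto simp: M_def)
    finally show ?thesis .
  qed
  then show "\<exists>C. \<forall>x\<ge>\<delta>. x powr N * \<bar>gain u x\<bar> \<le> C" by blast
qed

text \<open>The x-derivative of u(x t) is t u'(x t) = (1/x) (x t) u'(x t), so the derivative is
  again a gain, of y u'(y), divided by x. This makes \<open>rapid_gain\<close> an induction.\<close>

lemma gain_deriv:
  assumes u: "rapid0 u" and u': "\<And>x. 0 < x \<Longrightarrow> (u has_real_derivative u' x) (at x)" "rapid0 u'" and x: "0 < x"
  shows "(gain u has_real_derivative x powr - 1 * gain (\<lambda>y. y powr 1 * u' y) x) (at x)"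
proof -
  define v where "v y = y powr 1 * u' y" for y
  have v: "rapid0 v" unfolding v_def by (rule rapid0_powr[OF u'(2)])
  obtain C where C: "0 \<le> C" "\<And>y t. y \<ge> x / 2 \<Longrightarrow> \<bar>k t * v (y * t)\<bar> \<le> C * y powr - 4 * (k t * t powr - 4)"
    using gain_integrand_bound[OF v, of "x / 2" 4] x by auto
  have near: "x / 2 \<le> y" if "\<bar>y - x\<bar> < x / 2" for y using that by (auto simp: abs_if split: if_splits)
  have "(gain u has_real_derivative (LBINT t. 1 / x * (k t * v (x * t)))) (at x)"
    unfolding gain_def[abs_def]
  proof (rule has_real_derivative_integral_dominated[where d = "x/2" and F' = "\<lambda>y t. 1 / y * (k t * v (y * t))"
        and B = "\<lambda>t. 2 / x * (C * (x / 2) powr - 4 * (k t * t powr - 4))"])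
    show "integrable lborel (\<lambda>t. k t * u (y * t))" if "\<bar>y - x\<bar> < x / 2" for y
      using gain_integrable[OF u, of y] near[OF that] x by auto
    show "((\<lambda>x. k t * u (x * t)) has_real_derivative 1 / y * (k t * v (y * t))) (at y)" if "\<bar>y - x\<bar> < x / 2" for y t
    proof (cases "t \<le> 1")
      case False
      have y: "0 < y" using near[OF that] x by simp
      have "((\<lambda>x. u (x * t)) has_real_derivative u' (y * t) * t) (at y)"
        by (rule DERIV_chain2[OF u'(1)]) (use y False in \<open>auto intro!: derivative_eq_intros\<close>)
      then have "((\<lambda>x. k t * u (x * t)) has_real_derivative k t * (u' (y * t) * t)) (at y)"
        by (rule DERIV_cmult)
      also have "k t * (u' (y * t) * t) = 1 / y * (k t * v (y * t))"
        using y False by (simp add: v_def)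
      finally show ?thesis .
    qed (simp add: k_eq0)
    show "\<bar>1 / y * (k t * v (y * t))\<bar> \<le> 2 / x * (C * (x / 2) powr - 4 * (k t * t powr - 4))" if "\<bar>y - x\<bar> < x / 2" for y t
    proof -
      note y = near[OF that]
      have "C * y powr - 4 * (k t * t powr - 4) \<le> C * (x / 2) powr - 4 * (k t * t powr - 4)"
        using y x C(1) k_ge0[of t] by (intro mult_right_mono mult_left_mono powr_mono2') auto
      then have "\<bar>k t * v (y * t)\<bar> \<le> C * (x / 2) powr - 4 * (k t * t powr - 4)"
        using C(2)[OF y, of t] by linarith
      moreover have "\<bar>1 / y\<bar> \<le> 2 / x" using y x by (simp add: divide_simps)
      ultimately show ?thesis unfolding abs_mult[of "1 / y"] using x by (intro mult_mono) auto
    qed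
    show "(\<lambda>t. 1 / x * (k t * v (x * t))) \<in> borel_measurable lborel"
      using gain_integrand_meas[OF v x] by auto
  qed (use x in \<open>auto intro!: integrable_mult_right k_moment_integrable\<close>)
  also have "(LBINT t. 1 / x * (k t * v (x * t))) = x powr - 1 * gain v x"
    using x by (simp add: gain_def powr_minus_divide)
  finally show ?thesis unfolding v_def .
qed

lemma rapid_gain: "rapid n u \<Longrightarrow> rapid n (gain u)"
proof (induction n arbitrary: u)
  case (Suc n)
  obtain u' where u': "\<And>x. 0 < x \<Longrightarrow> (u has_real_derivative u' x) (at x)" "rapid n u'" using Suc.prems(1) rapid_SucE by blast
  show ?case
  proof (rule rapid_SucI)
    show "rapid0 (gain u)" by (rule rapid0_gain[OF rapid_imp_0[OF Suc.prems]])
    show "(gain u has_real_derivative x powr - 1 * gain (\<lambda>y. y powr 1 * u' y) x) (at x)" if "0 < x" for x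
      by (rule gain_deriv[OF rapid_imp_0[OF Suc.prems] u'(1) rapid_imp_0[OF u'(2)] that])
    show "rapid n (\<lambda>x. x powr - 1 * gain (\<lambda>y. y powr 1 * u' y) x)"
      by (rule rapid_powr[OF Suc.IH[OF rapid_powr[OF u'(2)]]])
  qed
qed (simp add: rapid0_gain)

text \<open>The finite mass integral over s > x bounds both terms of \<open>nn_flux\<close>, which
  can then be read as an identity of real numbers.\<close>

lemma flux_balance:
  assumes [measurable]: "u \<in> borel_measurable borel" and u: "\<And>s. 0 \<le> u s" "\<And>s. s \<le> 0 \<Longrightarrow> u s = 0" and x: "0 \<le> x"
    and int: "set_integrable lborel {x<..} (\<lambda>s. s * u s)"
    and gint: "\<And>y. 0 < y \<Longrightarrow> integrable lborel (\<lambda>t. k t * u (y * t))"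
  shows "set_integrable lborel {x<..} (\<lambda>y. y * gain u y)"
    and "integrable lborel (\<lambda>s. indicator {x<..} s * (s * H (x / s) * u s))"
    and "flux u x = (LINT s:{x<..}|lborel. s * u s) - (LINT y:{x<..}|lborel. y * gain u y)"
proof -
  have g: "(NN t. ennreal (k t * u (y * t))) = ennreal (gain u y)" "0 \<le> gain u y" if "0 < y" for y
  proof -
    show "0 \<le> gain u y" unfolding gain_def using k_ge0 u by (intro integral_nonneg_AE) auto
    show "(NN t. ennreal (k t * u (y * t))) = ennreal (gain u y)"
      unfolding gain_def by (rule nn_integral_eq_integral[OF gint[OF that]]) (use k_ge0 u in auto)
  qed
  have [measurable]: "gain u \<in> borel_measurable borel" unfolding gain_def[abs_def] by measurable
  have m: "indicator {x<..} y * ennreal r = ennreal (indicator {x<..} y * r)" for r y :: real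
    by (simp add: ennreal_mult' ennreal_indicator)
  have 1: "(NN y. indicator {x<..} y * (ennreal y * (NN t. ennreal (k t * u (y * t)))))
    = (NN y. ennreal (indicator {x<..} y * (y * gain u y)))"
  proof (rule nn_integral_cong)
    fix y show "indicator {x<..} y * (ennreal y * (NN t. ennreal (k t * u (y * t)))) = ennreal (indicator {x<..} y * (y * gain u y))"
      using x g[of y] by (cases "x < y") (auto simp: ennreal_mult')
  qed
  have eq: "(NN y. ennreal (indicator {x<..} y * (y * gain u y))) + (NN s. ennreal (indicator {x<..} s * (s * H (x / s) * u s)))
     = (NN s. ennreal (indicator {x<..} s * (s * u s)))"
    by (rule nn_flux[of u x, OF assms(1) u(1) _ x, unfolded 1 m]) (rule u(2))
  have int': "integrable lborel (\<lambda>s. indicator {x<..} s * (s * u s))"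
    using int by (simp add: set_integrable_def)
  have R: "(NN s. ennreal (indicator {x<..} s * (s * u s))) = ennreal (LINT s:{x<..}|lborel. s * u s)"
    unfolding set_lebesgue_integral_def
    using nn_integral_eq_integral[OF int'] u x by (auto split: split_indicator)
  have p1: "0 \<le> indicator {x<..} y * (y * gain u y)" for y
    using x g(2)[of y] by (auto split: split_indicator)
  have p2: "0 \<le> indicator {x<..} s * (s * H (x / s) * u s)" for s
    using x u(1)[of s] H_ge0[of "x / s"] by (auto split: split_indicator)
  have fin: "(NN y. ennreal (indicator {x<..} y * (y * gain u y))) < top"
    "(NN s. ennreal (indicator {x<..} s * (s * H (x / s) * u s))) < top"
  proof -
    have "(NN y. ennreal (indicator {x<..} y * (y * gain u y))) + (NN s. ennreal (indicator {x<..} s * (s * H (x / s) * u s))) < top"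
      unfolding eq R by (rule ennreal_less_top)
    then show "(NN y. ennreal (indicator {x<..} y * (y * gain u y))) < top"
      "(NN s. ennreal (indicator {x<..} s * (s * H (x / s) * u s))) < top"
      by (auto simp: ennreal_add_less_top)
  qed
  have i1: "integrable lborel (\<lambda>y. indicator {x<..} y * (y * gain u y))"
    by (rule integrableI_nonneg) (use p1 fin(1) in auto)
  show i2: "integrable lborel (\<lambda>s. indicator {x<..} s * (s * H (x / s) * u s))"
    by (rule integrableI_nonneg) (use p2 fin(2) in auto)
  show "set_integrable lborel {x<..} (\<lambda>y. y * gain u y)" using i1 by (simp add: set_integrable_def)
  have "ennreal (LBINT y. indicator {x<..} y * (y * gain u y)) + ennreal (flux u x) = ennreal (LINT s:{x<..}|lborel. s * u s)"
    using eq unfolding R flux_def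
    by (subst (asm) (1 2) nn_integral_eq_integral) (use i1 i2 p1 p2 in auto)
  moreover have "0 \<le> (LBINT y. indicator {x<..} y * (y * gain u y))" "0 \<le> flux u x" "0 \<le> (LINT s:{x<..}|lborel. s * u s)"
    unfolding flux_def set_lebesgue_integral_def using p1 p2 u x by (auto intro!: integral_nonneg_AE split: split_indicator)
  ultimately have "(LBINT y. indicator {x<..} y * (y * gain u y)) + flux u x = (LINT s:{x<..}|lborel. s * u s)"
    by (subst (asm) ennreal_plus[symmetric]) (auto simp del: ennreal_plus)
  then show "flux u x = (LINT s:{x<..}|lborel. s * u s) - (LINT y:{x<..}|lborel. y * gain u y)"
    by (simp add: set_lebesgue_integral_def)
qed

end

section \<open>Regularity of fixed points\<close>

lemma ennreal_mult3:
  "0 \<le> a \<Longrightarrow> 0 \<le> b \<Longrightarrow> ennreal a * (ennreal b * ennreal c) = ennreal (a * (b * c))"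
  by (simp add: ennreal_mult')

lemma (in daughter_kernel) flux_meas:
  assumes [measurable]: "u \<in> borel_measurable borel"
  shows "flux u \<in> borel_measurable borel"
proof -
  have "(\<lambda>x. LBINT s. (if x < s then 1 else 0) * (s * H (x / s) * u s)) \<in> borel_measurable borel"
    by measurable
  also have "(\<lambda>x. LBINT s. (if x < s then 1 else 0) * (s * H (x / s) * u s)) = flux u"
    unfolding flux_def[abs_def] by (intro ext Bochner_Integration.integral_cong) auto
  finally show ?thesis .
qed

context fragmentation
begin

text \<open>The rate a f written in terms of \<phi> = f/x.\<close>

definition loss :: "(real \<Rightarrow> real) \<Rightarrow> real \<Rightarrow> real" where
  "loss \<phi> s = A * (s powr (\<gamma> + 1) * \<phi> s)"

abbreviation fixed_point :: "(real \<Rightarrow> real) \<Rightarrow> bool" where "fixed_point \<equiv> src_sol 0 1"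

lemma fp_rapid0:
  assumes "fixed_point \<phi>" shows "rapid0 \<phi>"
proof (rule rapid0I)
  note S = src_solD[OF assms]
  show "isCont \<phi> x" if "0 < x" for x by (rule src_sol_real(2)[OF assms that])
  fix N \<delta> :: real assume \<delta>: "0 < \<delta>"
  \<comment> \<open>The available moments have orders 2 + (\<gamma> + 2) j; since \<gamma> + 2 \<ge>
    1, j \<ge> |N| reaches an order m with N \<le> m + 1, which is what the pointwise bound
    needs.\<close>
  define j where "j = nat \<lceil>\<bar>N\<bar>\<rceil>"
  define m where "m = 2 + (\<gamma> + 2) * real j"
  have "\<bar>N\<bar> \<le> real j" unfolding j_def by linarith
  moreover have "real j \<le> (\<gamma> + 2) * real j" using \<gamma>_ge0 mult_right_mono[of 1 "\<gamma> + 2" "real j"] by simp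
  ultimately have m: "N \<le> m + 1" "0 < m" by (auto simp: m_def)
  have "x powr N * \<bar>\<phi> x\<bar> \<le> (m + 1) * mom_bd j * \<delta> powr (N + - (m + 1))" if x: "x \<ge> \<delta>" for x
  proof -
    have "\<phi> x \<le> (m + 1) * mom_bd j * x powr - (m + 1)"
      by (rule antimono_moment_bound)
        (use S src_sol_antimono[OF assms] src_sol_moments[OF assms, of j] mom_bd_pos[of j] x \<delta> m in \<open>auto simp: m_def\<close>)
    then have "x powr N * \<bar>\<phi> x\<bar> \<le> x powr N * ((m + 1) * mom_bd j * x powr - (m + 1))"
      using S(2) by (intro mult_left_mono) auto
    also have "\<dots> = (m + 1) * mom_bd j * x powr (N + - (m + 1))"
      unfolding powr_add by (simp only: mult_ac)
    also have "\<dots> \<le> (m + 1) * mom_bd j * \<delta> powr (N + - (m + 1))"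
      using x \<delta> m mom_bd_pos[of j] by (intro mult_left_mono powr_mono2') auto
    finally show ?thesis by simp
  qed
  then show "\<exists>C. \<forall>x\<ge>\<delta>. x powr N * \<bar>\<phi> x\<bar> \<le> C" by blast
qed

lemma rapid_loss: "rapid n \<phi> \<Longrightarrow> rapid n (loss \<phi>)"
  unfolding loss_def[abs_def] by (intro rapid_cmult rapid_powr)

lemma rapid0_loss: "rapid0 \<phi> \<Longrightarrow> rapid0 (loss \<phi>)"
  using rapid_loss[of 0 \<phi>] by simp

lemma fp_loss:
  assumes "fixed_point \<phi>"
  shows "loss \<phi> \<in> borel_measurable borel" "0 \<le> loss \<phi> s" "s \<le> 0 \<Longrightarrow> loss \<phi> s = 0" "rapid0 (loss \<phi>)"
proof -
  note S = src_solD[OF assms]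
  have [measurable]: "\<phi> \<in> borel_measurable borel" by (rule S(1))
  show "loss \<phi> \<in> borel_measurable borel" unfolding loss_def[abs_def] by measurable
  show "0 \<le> loss \<phi> s" using A_pos S(2) by (simp add: loss_def)
  show "loss \<phi> s = 0" if "s \<le> 0" using S(3)[OF that] by (simp add: loss_def)
  show "rapid0 (loss \<phi>)" by (intro rapid0_loss fp_rapid0 assms)
qed

lemma fp_loss_mass_integrable:
  assumes "fixed_point \<phi>" shows "integrable lborel (\<lambda>s. s * loss \<phi> s)"
proof (rule Bochner_Integration.integrable_bound[OF integrable_mult_right[OF Bd_integrable, of A] _ AE_I2])
  note S = src_solD[OF assms] and L = fp_loss[OF assms]
  show "(\<lambda>s. s * loss \<phi> s) \<in> borel_measurable lborel" using L(1) by measurable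
  fix s
  show "norm (s * loss \<phi> s) \<le> norm (A * Bd s)"
  proof (cases "0 < s")
    case True
    have "s powr (\<gamma> + 2) * \<phi> s \<le> Bd s"
      by (rule Bd_bound) (use src_sol_le_D0[OF assms True] src_sol_le_D1[OF assms True] True in auto)
    moreover have "s * loss \<phi> s = A * (s powr (\<gamma> + 2) * \<phi> s)"
      using True powr_add[of s "\<gamma> + 1" 1] by (simp add: loss_def add.assoc)
    moreover have "0 \<le> s * loss \<phi> s" using True L(2) by simp
    ultimately have "norm (s * loss \<phi> s) \<le> A * Bd s" using A_pos by simp
    then show ?thesis by simp
  qed (use L(3)[of s] in auto)
qed

lemma fp_flux:
  assumes "fixed_point \<phi>" "0 \<le> x"
  shows "set_integrable lborel {x<..} (\<lambda>y. y * gain (loss \<phi>) y)"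
    and "integrable lborel (\<lambda>s. indicator {x<..} s * (s * H (x / s) * loss \<phi> s))"
    and "flux (loss \<phi>) x = (LINT s:{x<..}|lborel. s * loss \<phi> s) - (LINT y:{x<..}|lborel. y * gain (loss \<phi>) y)"
proof -
  note L = fp_loss[OF assms(1)]
  have "set_integrable lborel {x<..} (\<lambda>s. s * loss \<phi> s)"
    using integrable_mult_indicator[OF _ fp_loss_mass_integrable[OF assms(1)], of "{x<..}"]
    by (simp add: set_integrable_def)
  note F = flux_balance[OF L(1) L(2) L(3) assms(2) this gain_integrable[OF L(4)]]
  show "set_integrable lborel {x<..} (\<lambda>y. y * gain (loss \<phi>) y)" by (rule F(1)) 
  show "integrable lborel (\<lambda>s. indicator {x<..} s * (s * H (x / s) * loss \<phi> s))" by (rule F(2))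
  show "flux (loss \<phi>) x = (LINT s:{x<..}|lborel. s * loss \<phi> s) - (LINT y:{x<..}|lborel. y * gain (loss \<phi>) y)" by (rule F(3))
qed

text \<open>This is y f''(y) once the equation is known.\<close>

definition imbalance :: "(real \<Rightarrow> real) \<Rightarrow> real \<Rightarrow> real" where
  "imbalance \<phi> y = y powr 1 * (loss \<phi> y - gain (loss \<phi>) y)"

lemma rapid_imbalance: "rapid n \<phi> \<Longrightarrow> rapid n (imbalance \<phi>)"
  unfolding imbalance_def[abs_def] by (intro rapid_powr rapid_diff rapid_gain rapid_loss)

lemma fp_flux_tail:
  assumes "fixed_point \<phi>" "0 < x"
  shows "flux (loss \<phi>) x = tail (imbalance \<phi>) x"
proof -
  note L = fp_loss[OF assms(1)]
  have i1: "set_integrable lborel {x<..} (\<lambda>s. s * loss \<phi> s)"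
    using integrable_mult_indicator[OF _ fp_loss_mass_integrable[OF assms(1)], of "{x<..}"]
    by (simp add: set_integrable_def)
  have "flux (loss \<phi>) x = (LINT s:{x<..}|lborel. s * loss \<phi> s - s * gain (loss \<phi>) s)"
    using fp_flux(1,3)[OF assms(1), of x] i1 assms(2) by (subst set_integral_diff) auto
  also have "\<dots> = tail (imbalance \<phi>) x"
    unfolding tail_def imbalance_def using assms(2)
    by (intro set_lebesgue_integral_cong) (auto simp: algebra_simps)
  finally show ?thesis .
qed

lemma fp_T_nn:
  assumes "fixed_point \<phi>"
  shows "ennreal (\<phi> x) = (NN s. ennreal (loss \<phi> s * W (x / s)))"
proof -
  note S = src_solD[OF assms]
  have [measurable]: "\<phi> \<in> borel_measurable borel" by (rule S(1))
  have "ennreal (\<phi> x) = T (\<lambda>s. ennreal (\<phi> s)) x"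
    by (subst src_sol_eq[OF assms]) simp
  also have "\<dots> = (NN s. ennreal A * (ennreal (s powr (\<gamma> + 1) * W (x / s)) * ennreal (\<phi> s)))"
    unfolding T_def by (rule nn_integral_cmult[symmetric]) measurable
  also have "\<dots> = (NN s. ennreal (loss \<phi> s * W (x / s)))"
  proof (rule nn_integral_cong)
    fix s
    have "ennreal A * (ennreal (s powr (\<gamma> + 1) * W (x / s)) * ennreal (\<phi> s)) = ennreal (A * (s powr (\<gamma> + 1) * W (x / s) * \<phi> s))"
      using A_pos W_ge0[of "x / s"] by (subst ennreal_mult3) (auto simp: mult.assoc)
    then show "ennreal A * (ennreal (s powr (\<gamma> + 1) * W (x / s)) * ennreal (\<phi> s)) = ennreal (loss \<phi> s * W (x / s))"
      by (simp add: loss_def mult_ac)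
  qed
  finally show ?thesis .
qed

lemma fp_T_real:
  assumes "fixed_point \<phi>"
  shows "integrable lborel (\<lambda>s. loss \<phi> s * W (x / s))" and "\<phi> x = (LBINT s. loss \<phi> s * W (x / s))"
proof -
  note S = src_solD[OF assms] and L = fp_loss[OF assms]
  have [measurable]: "loss \<phi> \<in> borel_measurable borel" by (rule L(1))
  have n: "0 \<le> loss \<phi> s * W (x / s)" for s using L(2) W_ge0 by simp
  show i: "integrable lborel (\<lambda>s. loss \<phi> s * W (x / s))"
    by (rule integrableI_nonneg) (auto simp: n fp_T_nn[OF assms, symmetric])
  have "ennreal (\<phi> x) = ennreal (LBINT s. loss \<phi> s * W (x / s))"
    unfolding fp_T_nn[OF assms] by (rule nn_integral_eq_integral[OF i]) (auto simp: n)
  then show "\<phi> x = (LBINT s. loss \<phi> s * W (x / s))"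
    using S(2) by (subst (asm) ennreal_inj) (auto intro!: integral_nonneg_AE n)
qed

lemma nn_integral_H_over_square:
  assumes "0 < x" "0 < s"
  shows "(NN y. indicator {x<..} y * (if y < s then 1 else 0) * ennreal (H (y / s) / y\<^sup>2)) = ennreal (W (x / s) / s)"
proof -
  have "(NN y. indicator {x<..} y * (if y < s then 1 else 0) * ennreal (H (y / s) / y\<^sup>2))
     = (NN y. indicator {x<..<s} y * ennreal (H (y / s) / y\<^sup>2))"
    by (intro nn_integral_cong) (auto split: split_indicator)
  also have "\<dots> = ennreal s * (NN t. indicator {x<..<s} (s * t) * ennreal (H (s * t / s) / (s * t)\<^sup>2))"
    by (rule nn_integral_scale) (use assms in auto)
  also have "(NN t. indicator {x<..<s} (s * t) * ennreal (H (s * t / s) / (s * t)\<^sup>2))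
     = (NN t. ennreal (1 / s\<^sup>2) * (indicator {x / s<..<1} t * ennreal (H t / t\<^sup>2)))"
  proof (rule nn_integral_cong)
    fix t
    have i: "indicator {x<..<s} (s * t) = (indicator {x / s<..<1} t :: ennreal)"
      using assms by (auto simp: indicator_def divide_simps mult.commute)
    have "ennreal (H (s * t / s) / (s * t)\<^sup>2) = ennreal (1 / s\<^sup>2) * ennreal (H t / t\<^sup>2)"
      using assms by (subst ennreal_mult'[symmetric]) (auto simp: power_mult_distrib)
    then show "indicator {x<..<s} (s * t) * ennreal (H (s * t / s) / (s * t)\<^sup>2)
      = ennreal (1 / s\<^sup>2) * (indicator {x / s<..<1} t * ennreal (H t / t\<^sup>2))"
      unfolding i by (simp only: mult.left_commute)
  qed
  also have "\<dots> = ennreal (1 / s\<^sup>2) * ennreal (W (x / s))"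
    using assms by (subst nn_integral_cmult) (auto simp: ennreal_W)
  also have "ennreal s * (ennreal (1 / s\<^sup>2) * ennreal (W (x / s))) = ennreal (s * (1 / s\<^sup>2 * W (x / s)))"
    using assms by (intro ennreal_mult3) auto
  also have "s * (1 / s\<^sup>2 * W (x / s)) = W (x / s) / s" using assms by (simp add: power2_eq_square)
  finally show ?thesis .
qed

text \<open>For fixed s, integrating s H(y/s)/y^2 over x < y < s returns W(x/s)
  (\<open>nn_integral_H_over_square\<close>), so Fubini undoes one integration of the Volterra
  equation and amounts to \<phi>' = - flux / x^2.\<close>

lemma fp_eq_tail_flux:
  assumes "fixed_point \<phi>" "0 < x"
  shows "\<phi> x = tail (\<lambda>y. y powr - 2 * flux (loss \<phi>) y) x"
proof -
  note S = src_solD[OF assms(1)] and L = fp_loss[OF assms(1)]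
  have [measurable]: "loss \<phi> \<in> borel_measurable borel" by (rule L(1))
  have [measurable]: "flux (loss \<phi>) \<in> borel_measurable borel" by (rule flux_meas) measurable
  have p: "0 \<le> indicator {y<..} s * (s * H (y / s) * loss \<phi> s)" if "0 < y" for y s
    using that L(2)[of s] H_ge0[of "y / s"] by (auto split: split_indicator)
  have fl0: "0 \<le> flux (loss \<phi>) y" if "0 < y" for y
    unfolding flux_def by (intro integral_nonneg_AE AE_I2 p that)
  have "(NN y. ennreal (indicator {x<..} y * (y powr - 2 * flux (loss \<phi>) y)))
    = (NN y. NN s. indicator {x<..} y * (if y < s then 1 else 0) * (ennreal (s * loss \<phi> s) * ennreal (H (y / s) / y\<^sup>2)))"
  proof (rule nn_integral_cong)
    fix y
    show "ennreal (indicator {x<..} y * (y powr - 2 * flux (loss \<phi>) y))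
     = (NN s. indicator {x<..} y * (if y < s then 1 else 0) * (ennreal (s * loss \<phi> s) * ennreal (H (y / s) / y\<^sup>2)))"
    proof (cases "x < y")
      case True
      then have y: "0 < y" using assms(2) by simp
      have "ennreal (y powr - 2 * flux (loss \<phi>) y) = ennreal (1 / y\<^sup>2) * ennreal (flux (loss \<phi>) y)"
        using y by (subst ennreal_mult'[symmetric]) (auto simp: powr_minus_divide powr_numeral)
      also have "ennreal (flux (loss \<phi>) y) = (NN s. ennreal (indicator {y<..} s * (s * H (y / s) * loss \<phi> s)))"
        unfolding flux_def by (rule nn_integral_eq_integral[symmetric, OF fp_flux(2)[OF assms(1)]]) (use y p in auto)
      also have "ennreal (1 / y\<^sup>2) * \<dots> = (NN s. ennreal (1 / y\<^sup>2) * ennreal (indicator {y<..} s * (s * H (y / s) * loss \<phi> s)))"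
        by (rule nn_integral_cmult[symmetric]) measurable
      also have "\<dots> = (NN s. indicator {x<..} y * (if y < s then 1 else 0) * (ennreal (s * loss \<phi> s) * ennreal (H (y / s) / y\<^sup>2)))"
      proof (rule nn_integral_cong)
        fix s
        show "ennreal (1 / y\<^sup>2) * ennreal (indicator {y<..} s * (s * H (y / s) * loss \<phi> s))
          = indicator {x<..} y * (if y < s then 1 else 0) * (ennreal (s * loss \<phi> s) * ennreal (H (y / s) / y\<^sup>2))"
        proof (cases "y < s")
          case ys: True
          have "ennreal (1 / y\<^sup>2) * ennreal (s * H (y / s) * loss \<phi> s) = ennreal (s * loss \<phi> s) * ennreal (H (y / s) / y\<^sup>2)"
            using ys y L(2)[of s] by (subst (1 2) ennreal_mult'[symmetric]) (auto simp: mult_ac)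
          then show ?thesis using ys True by simp
        qed simp
      qed
      finally show ?thesis using True by simp
    qed simp
  qed
  also have "\<dots> = (NN s. NN y. indicator {x<..} y * (if y < s then 1 else 0) * (ennreal (s * loss \<phi> s) * ennreal (H (y / s) / y\<^sup>2)))"
    by (rule lborel_pair.Fubini') measurable
  also have "\<dots> = (NN s. ennreal (loss \<phi> s * W (x / s)))"
  proof (rule nn_integral_cong)
    fix s
    show "(NN y. indicator {x<..} y * (if y < s then 1 else 0) * (ennreal (s * loss \<phi> s) * ennreal (H (y / s) / y\<^sup>2))) = ennreal (loss \<phi> s * W (x / s))"
    proof (cases "0 < s")
      case True
      have "(NN y. indicator {x<..} y * (if y < s then 1 else 0) * (ennreal (s * loss \<phi> s) * ennreal (H (y / s) / y\<^sup>2)))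
        = (NN y. ennreal (s * loss \<phi> s) * (indicator {x<..} y * (if y < s then 1 else 0) * ennreal (H (y / s) / y\<^sup>2)))"
        by (simp only: mult.left_commute)
      also have "\<dots> = ennreal (s * loss \<phi> s) * ennreal (W (x / s) / s)"
        using True assms(2) by (subst nn_integral_cmult) (auto simp: nn_integral_H_over_square)
      also have "\<dots> = ennreal (loss \<phi> s * W (x / s))"
        using True L(2)[of s] by (subst ennreal_mult'[symmetric]) auto
      finally show ?thesis .
    next
      case False
      then have "loss \<phi> s = 0" using L(3) by simp
      then show ?thesis by simp
    qed
  qed
  also have "\<dots> = ennreal (\<phi> x)" by (rule fp_T_nn[OF assms(1), symmetric])
  finally have eq: "(NN y. ennreal (indicator {x<..} y * (y powr - 2 * flux (loss \<phi>) y))) = ennreal (\<phi> x)" .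
  have "tail (\<lambda>y. y powr - 2 * flux (loss \<phi>) y) x = (LBINT y. indicator {x<..} y * (y powr - 2 * flux (loss \<phi>) y))"
    by (simp add: tail_def set_lebesgue_integral_def)
  also have "\<dots> = enn2real (NN y. ennreal (indicator {x<..} y * (y powr - 2 * flux (loss \<phi>) y)))"
  proof (rule integral_eq_nn_integral)
    show "AE y in lborel. 0 \<le> indicator {x<..} y * (y powr - 2 * flux (loss \<phi>) y)"
      using fl0 assms(2) by (intro AE_I2) (auto split: split_indicator)
  qed measurable
  finally show ?thesis using eq S(2) by simp
qed

lemma tail_cong: "(\<And>y. 0 < y \<Longrightarrow> u y = v y) \<Longrightarrow> 0 < x \<Longrightarrow> tail u x = tail v x"
  unfolding tail_def by (intro set_lebesgue_integral_cong) auto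

text \<open>The equation gains two derivatives: \<open>\<phi>\<close> is a double tail integral of \<open>imbalance \<phi>\<close>.\<close>

lemma fp_rapid:
  assumes "fixed_point \<phi>" shows "rapid n \<phi>"
proof (induction n)
  case 0
  then show ?case using fp_rapid0[OF assms] by simp
next
  case (Suc n)
  have "rapid n (tail (imbalance \<phi>))" by (rule rapid_SucD[OF rapid_tail[OF rapid_imbalance[OF Suc]]])
  then have "rapid n (\<lambda>y. y powr - 2 * flux (loss \<phi>) y)"
    by (intro rapid_powr) (rule rapid_cong[rotated], assumption, rule fp_flux_tail[OF assms, symmetric])
  then have "rapid (Suc n) (tail (\<lambda>y. y powr - 2 * flux (loss \<phi>) y))" by (rule rapid_tail)
  then show ?case by (rule rapid_cong[rotated]) (rule fp_eq_tail_flux[OF assms, symmetric])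
qed

text \<open>Write K for the tail, which equals the flux. Then \<phi>' = - K/x^2 gives the first
  derivative; in the second one the K terms cancel and K' = - \<open>imbalance \<phi>\<close> leaves
  loss minus gain.\<close>

lemma fp_derivs:
  assumes "fixed_point \<phi>" "0 < x"
  shows "((\<lambda>x. x * \<phi> x) has_real_derivative \<phi> x - tail (imbalance \<phi>) x / x) (at x)"
    and "((\<lambda>x. \<phi> x - tail (imbalance \<phi>) x / x) has_real_derivative loss \<phi> x - gain (loss \<phi>) x) (at x)"
proof -
  have i: "rapid0 (imbalance \<phi>)" using rapid_imbalance[OF fp_rapid[OF assms(1), of 0]] by simp
  have K: "(tail (imbalance \<phi>) has_real_derivative - imbalance \<phi> x) (at x)" by (rule tail_deriv[OF i assms(2)])
  have "rapid0 (tail (imbalance \<phi>))" using rapid_tail[of 0 "imbalance \<phi>"] i by simp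
  then have "rapid0 (\<lambda>y. y powr - 2 * tail (imbalance \<phi>) y)" by (rule rapid0_powr)
  from tail_deriv[OF this assms(2)]
  have "(\<phi> has_real_derivative - (x powr - 2 * tail (imbalance \<phi>) x)) (at x)"
  proof (rule has_field_derivative_transform_within_open[of _ _ _ "{0<..}"])
    fix y :: real assume "y \<in> {0<..}"
    then have y: "0 < y" by simp
    show "tail (\<lambda>y. y powr - 2 * tail (imbalance \<phi>) y) y = \<phi> y"
      unfolding fp_eq_tail_flux[OF assms(1) y]
      by (rule tail_cong) (use y fp_flux_tail[OF assms(1)] in auto)
  qed (use assms(2) in auto)
  moreover have "x powr - 2 = 1 / x\<^sup>2" using assms(2) by (simp add: powr_minus_divide powr_numeral)
  ultimately have P: "(\<phi> has_real_derivative - (tail (imbalance \<phi>) x / x\<^sup>2)) (at x)" by simp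
  show "((\<lambda>x. x * \<phi> x) has_real_derivative \<phi> x - tail (imbalance \<phi>) x / x) (at x)"
    by (rule derivative_eq_intros P refl)+ (use assms(2) in \<open>simp add: field_simps power2_eq_square\<close>)
  have "((\<lambda>x. \<phi> x - tail (imbalance \<phi>) x / x) has_real_derivative
     - (tail (imbalance \<phi>) x / x\<^sup>2) - ((- imbalance \<phi> x) * x - tail (imbalance \<phi>) x * 1) / (x * x)) (at x)"
    by (intro DERIV_diff P DERIV_divide K DERIV_ident) (use assms(2) in simp)
  also have "- (tail (imbalance \<phi>) x / x\<^sup>2) - ((- imbalance \<phi> x) * x - tail (imbalance \<phi>) x * 1) / (x * x) = loss \<phi> x - gain (loss \<phi>) x"
    using assms(2) by (simp add: imbalance_def field_simps power2_eq_square)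
  finally show "((\<lambda>x. \<phi> x - tail (imbalance \<phi>) x / x) has_real_derivative loss \<phi> x - gain (loss \<phi>) x) (at x)" .
qed

text \<open>One has x \<phi>(x) as the integral of (x/s) W(x/s) against s
  \<open>loss \<phi> s\<close>. The first factor is at most 1 and tends to 0 by
  \<open>tendsto_tW\<close>, and the weight is integrable, so dominated convergence applies.\<close>

lemma fp_tendsto_0:
  assumes "fixed_point \<phi>" shows "((\<lambda>x. x * \<phi> x) \<longlongrightarrow> 0) (at_right 0)"
  unfolding tendsto_at_iff_sequentially
proof (intro allI impI)
  note L = fp_loss[OF assms]
  have [measurable]: "loss \<phi> \<in> borel_measurable borel" by (rule L(1))
  fix X :: "nat \<Rightarrow> real" assume "\<forall>i. X i \<in> {0<..} - {0}" and X: "X \<longlonglongrightarrow> 0"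
  then have X0: "0 < X i" for i by auto
  have "(\<lambda>n. LBINT s. X n / s * W (X n / s) * (s * loss \<phi> s)) \<longlonglongrightarrow> (\<integral>s. 0 \<partial>(lborel :: real measure))"
  proof (rule integral_dominated_convergence[OF _ _ fp_loss_mass_integrable[OF assms]])
    show "AE s in lborel. (\<lambda>n. X n / s * W (X n / s) * (s * loss \<phi> s)) \<longlonglongrightarrow> 0"
    proof (rule AE_I2)
      fix s
      show "(\<lambda>n. X n / s * W (X n / s) * (s * loss \<phi> s)) \<longlonglongrightarrow> 0"
      proof (cases "0 < s")
        case True
        have "filterlim (\<lambda>n. X n / s) (at_right 0) sequentially"
          unfolding filterlim_at using True X0 X by (auto intro!: tendsto_eq_intros always_eventually simp: less_imp_neq[symmetric])
        then have "(\<lambda>n. X n / s * W (X n / s)) \<longlonglongrightarrow> 0" by (rule filterlim_compose[OF tendsto_tW])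
        then show ?thesis by (rule tendsto_mult_left_zero)
      qed (use L(3) in auto)
    qed
    show "AE s in lborel. norm (X n / s * W (X n / s) * (s * loss \<phi> s)) \<le> s * loss \<phi> s" for n
    proof (rule AE_I2)
      fix s
      show "norm (X n / s * W (X n / s) * (s * loss \<phi> s)) \<le> s * loss \<phi> s"
      proof (cases "0 < s")
        case True
        then have p: "0 < X n / s" using X0 by simp
        have "t * W t \<le> 1" "0 \<le> t * W t" if "0 < t" for t
          using mult_left_mono[OF W_le[OF that], of t] that W_ge0[of t] by auto
        note t = this[OF p]
        have "0 \<le> s * loss \<phi> s" using L(2)[of s] True by simp
        then have "\<bar>X n / s * W (X n / s)\<bar> * \<bar>s * loss \<phi> s\<bar> \<le> 1 * (s * loss \<phi> s)"
          using t by (intro mult_mono) (simp_all only: abs_of_nonneg zero_le_one order_refl)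
        then show ?thesis by (simp only: real_norm_def abs_mult[of "X n / s * W (X n / s)"] mult_1_left)
      qed (use L(3) in auto)
    qed
  qed measurable
  moreover have "(LBINT s. X n / s * W (X n / s) * (s * loss \<phi> s)) = X n * \<phi> (X n)" for n
  proof -
    have "(LBINT s. X n / s * W (X n / s) * (s * loss \<phi> s)) = (LBINT s. X n * (loss \<phi> s * W (X n / s)))"
      using L(3) by (intro Bochner_Integration.integral_cong) auto
    then show ?thesis unfolding fp_T_real(2)[OF assms, of "X n"] by simp
  qed
  ultimately show "((\<lambda>x. x * \<phi> x) \<circ> X) \<longlonglongrightarrow> 0" by (simp add: comp_def)
qed

end

section \<open>Uniqueness\<close>

text \<open>The function t / sqrt (t^2 + e^2) tends to the sign of t as e -> 0. The Kato argument
  uses that it is nondecreasing, bounded by 1, and that its product with t misses |t| by at most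
  e.\<close>

lemma smoothed_sign:
  fixes e t :: real
  assumes "0 < e"
  shows "((\<lambda>t. t / sqrt (t\<^sup>2 + e\<^sup>2)) has_real_derivative e\<^sup>2 / ((t\<^sup>2 + e\<^sup>2) * sqrt (t\<^sup>2 + e\<^sup>2))) (at t)"
    and "\<bar>t / sqrt (t\<^sup>2 + e\<^sup>2)\<bar> \<le> 1"
    and "\<bar>t\<bar> - e \<le> t / sqrt (t\<^sup>2 + e\<^sup>2) * t"
proof -
  have p: "0 < t\<^sup>2 + e\<^sup>2" using assms by (simp add: add_nonneg_pos)
  define r where "r = sqrt (t\<^sup>2 + e\<^sup>2)"
  have r: "0 < r" "r * r = t\<^sup>2 + e\<^sup>2" using p by (auto simp: r_def)
  have rt: "\<bar>t\<bar> \<le> r" unfolding r_def by (rule real_le_rsqrt) simp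
  have re: "r \<le> \<bar>t\<bar> + e"
    unfolding r_def using assms by (intro real_le_lsqrt) (auto simp: power2_sum)
  have "((\<lambda>t. t / sqrt (t\<^sup>2 + e\<^sup>2)) has_real_derivative (1 * r - t * (inverse r / 2 * (2 * t))) / (r * r)) (at t)"
    unfolding r_def using p by (auto intro!: derivative_eq_intros)
  also have "(1 * r - t * (inverse r / 2 * (2 * t))) / (r * r) = (r * r - t * t) / (r * r * r)"
    using r(1) by (simp add: field_simps)
  also have "\<dots> = e\<^sup>2 / ((t\<^sup>2 + e\<^sup>2) * r)" by (simp add: r(2) power2_eq_square)
  finally show "((\<lambda>t. t / sqrt (t\<^sup>2 + e\<^sup>2)) has_real_derivative e\<^sup>2 / ((t\<^sup>2 + e\<^sup>2) * sqrt (t\<^sup>2 + e\<^sup>2))) (at t)"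
    by (simp add: r_def)
  show "\<bar>t / sqrt (t\<^sup>2 + e\<^sup>2)\<bar> \<le> 1" using rt r(1) by (simp add: r_def[symmetric] divide_le_eq)
  have "(\<bar>t\<bar> - e) * r \<le> t * t"
  proof (cases "\<bar>t\<bar> \<le> e")
    case True
    then have "(\<bar>t\<bar> - e) * r \<le> 0" using r(1) by (simp add: mult_nonpos_nonneg)
    then show ?thesis using zero_le_square[of t] by linarith
  next
    case False
    then have "(\<bar>t\<bar> - e) * r \<le> (\<bar>t\<bar> - e) * (\<bar>t\<bar> + e)" using re by (intro mult_left_mono) auto
    also have "\<dots> = t * t - e * e" by (simp add: algebra_simps abs_mult_self_eq)
    also have "\<dots> \<le> t * t" by simp
    finally show ?thesis .
  qed
  then show "\<bar>t\<bar> - e \<le> t / sqrt (t\<^sup>2 + e\<^sup>2) * t" using r(1) by (simp add: r_def[symmetric] le_divide_eq)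
qed

lemma set_integrable_Ioi_iff_Ici:
  fixes f :: "real \<Rightarrow> real"
  assumes "set_integrable lborel {p<..} f"
  shows "set_integrable lborel {p..} f" and "(LINT x:{p..}|lborel. f x) = (LINT x:{p<..}|lborel. f x)"
proof -
  have "set_integrable lborel ({p} \<union> {p<..}) f"
  proof (rule set_integrable_Un[OF _ assms])
    have "(\<lambda>x. indicator {p} x *\<^sub>R f x) = (\<lambda>x. indicator {p} x * f p)" by (auto simp: fun_eq_iff indicator_def)
    moreover have "integrable lborel (\<lambda>x. indicator {p} x * f p :: real)" by (intro integrable_mult_left integrable_real_indicator) auto
    ultimately show "set_integrable lborel {p} f" by (simp add: set_integrable_def)
  qed auto
  also have "{p} \<union> {p<..} = {p..}" by auto
  finally show i: "set_integrable lborel {p..} f" .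
  have m: "(\<lambda>x. indicator {p..} x *\<^sub>R f x) \<in> borel_measurable lborel" "(\<lambda>x. indicator {p<..} x *\<^sub>R f x) \<in> borel_measurable lborel"
    using i assms by (auto simp: set_integrable_def)
  show "(LINT x:{p..}|lborel. f x) = (LINT x:{p<..}|lborel. f x)"
    unfolding set_lebesgue_integral_def
  proof (rule integral_cong_AE[OF m])
    show "AE x in lborel. indicator {p..} x *\<^sub>R f x = indicator {p<..} x *\<^sub>R f x"
      using AE_lborel_singleton[of p] by eventually_elim (auto split: split_indicator)
  qed
qed

section \<open>Kato's inequality and the comparison of two solutions\<close>

context fragmentation
begin

text \<open>The term a f; for f = x \<phi>(x) on x > 0 it is \<open>loss \<phi>\<close>.\<close>

definition absorb :: "(real \<Rightarrow> real) \<Rightarrow> real \<Rightarrow> real" where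
  "absorb f s = A * (s powr \<gamma> * f s)"

definition pos_fun :: "(real \<Rightarrow> real) \<Rightarrow> bool" where
  "pos_fun u \<longleftrightarrow> u \<in> borel_measurable borel \<and> (\<forall>x. 0 \<le> u x) \<and> (\<forall>x\<le>0. u x = 0)"

text \<open>The part of \<open>is_solution\<close> needed for uniqueness, with \<open>f'\<close> the derivative of \<open>f\<close>.\<close>

definition classical_sol :: "(real \<Rightarrow> real) \<Rightarrow> (real \<Rightarrow> real) \<Rightarrow> bool" where
  "classical_sol f f' \<longleftrightarrow> pos_fun f \<and>
     (\<forall>x>0. (f has_real_derivative f' x) (at x)) \<and>
     (\<forall>x>0. (f' has_real_derivative absorb f x - gain (absorb f) x) (at x)) \<and>
     (\<forall>y>0. integrable lborel (\<lambda>t. k t * absorb f (y * t))) \<and>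
     integrable lborel (\<lambda>s. s * absorb f s) \<and> integrable lborel (\<lambda>s. s * f s) \<and>
     (f \<longlongrightarrow> 0) at_top \<and> ((\<lambda>x. x * f' x) \<longlongrightarrow> 0) at_top"

lemma classical_solD:
  assumes "classical_sol f f'"
  shows "pos_fun f"
    "\<And>x. 0 < x \<Longrightarrow> (f has_real_derivative f' x) (at x)"
    "\<And>x. 0 < x \<Longrightarrow> (f' has_real_derivative absorb f x - gain (absorb f) x) (at x)"
    "\<forall>y>0. integrable lborel (\<lambda>t. k t * absorb f (y * t))"
    "integrable lborel (\<lambda>s. s * absorb f s)" "integrable lborel (\<lambda>s. s * f s)"
    "(f \<longlongrightarrow> 0) at_top" "((\<lambda>x. x * f' x) \<longlongrightarrow> 0) at_top"
  using assms unfolding classical_sol_def by blast+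

lemma pos_funD:
  assumes "pos_fun f"
  shows "f \<in> borel_measurable borel" "0 \<le> f x" "x \<le> 0 \<Longrightarrow> f x = 0"
  using assms unfolding pos_fun_def by blast+

lemma pos_fun_absorb:
  assumes "pos_fun f" shows "pos_fun (absorb f)"
proof -
  note [measurable] = pos_funD(1)[OF assms]
  have "absorb f \<in> borel_measurable borel" unfolding absorb_def[abs_def] by measurable
  then show ?thesis using pos_funD[OF assms] A_pos by (simp add: pos_fun_def absorb_def)
qed

lemma integrable_set_Ioi: "integrable lborel g \<Longrightarrow> set_integrable lborel {x<..} (g :: real \<Rightarrow> real)"
  using integrable_mult_indicator[of "{x<..}" lborel g] by (simp add: set_integrable_def)

lemma pos_fun_flux_balance:
  assumes u: "pos_fun u" and x: "0 \<le> x"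
    and gint: "\<forall>y>0. integrable lborel (\<lambda>t. k t * u (y * t))"
    and int: "integrable lborel (\<lambda>s. s * u s)"
  shows "set_integrable lborel {x<..} (\<lambda>y. y * gain u y)"
    and "flux u x = (LINT s:{x<..}|lborel. s * u s) - (LINT y:{x<..}|lborel. y * gain u y)"
  using flux_balance(1,3)[of u x] pos_funD[OF u] x gint integrable_set_Ioi[OF int, of x] by blast+

lemma flux_nonneg:
  assumes "pos_fun u" "0 < x" shows "0 \<le> flux u x"
  unfolding flux_def using pos_funD(2)[OF assms(1)] assms(2) H_ge0
  by (intro integral_nonneg_AE AE_I2) (auto split: split_indicator)

text \<open>Kato's inequality for the difference of two solutions, via a smoothed sign.\<close>

lemma difference_flux_sign:
  assumes f: "classical_sol f f'" and g: "classical_sol g g'" and p: "0 < p"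
  shows "0 \<le> (f p - g p) * ((f p - g p) - p * (f' p - g' p))"
proof -
  note F = classical_solD[OF f] and G = classical_solD[OF g]
  define w w' where "w x = f x - g x" and "w' x = f' x - g' x" for x
  \<comment> \<open>K is -x^2 times the derivative of w/x, and its own derivative is -x w''. The
    claim is that K never has the sign opposite to w.\<close>
  define K where "K x = w x - x * w' x" for x
  define v where "v = absorb (\<lambda>s. \<bar>w s\<bar>)"
  note [measurable] = pos_funD(1)[OF F(1)] pos_funD(1)[OF G(1)]
  have wp: "pos_fun (\<lambda>s. \<bar>w s\<bar>)"
    unfolding pos_fun_def w_def using pos_funD(3)[OF F(1)] pos_funD(3)[OF G(1)] by auto
  note vp = pos_fun_absorb[OF wp, folded v_def] and fp = pos_fun_absorb[OF F(1)] and gp = pos_fun_absorb[OF G(1)]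
  note [measurable] = pos_funD(1)[OF vp] pos_funD(1)[OF fp] pos_funD(1)[OF gp]
  have v_le: "v s \<le> absorb f s + absorb g s" and v0: "0 \<le> v s" and v_eq: "v s = \<bar>absorb f s - absorb g s\<bar>" for s
  proof -
    show "v s = \<bar>absorb f s - absorb g s\<bar>"
      using A_pos by (simp add: v_def absorb_def w_def abs_mult right_diff_distrib[symmetric])
    then show "v s \<le> absorb f s + absorb g s"
      using pos_funD(2)[OF fp, of s] pos_funD(2)[OF gp, of s] by linarith
    show "0 \<le> v s" using \<open>v s = \<bar>absorb f s - absorb g s\<bar>\<close> by simp
  qed
  have v_neg: "v s = 0" if "s \<le> 0" for s by (rule pos_funD(3)[OF vp that])
  have Fg: "integrable lborel (\<lambda>t. k t * absorb f (y * t))" and Gg: "integrable lborel (\<lambda>t. k t * absorb g (y * t))"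
    if "0 < y" for y using F(4) G(4) that by blast+
  have gint: "integrable lborel (\<lambda>t. k t * v (y * t))" if y: "0 < y" for y
  proof (rule Bochner_Integration.integrable_bound[OF Bochner_Integration.integrable_add[OF Fg[OF y] Gg[OF y]] _ AE_I2])
    fix t
    have "k t * v (y * t) \<le> k t * absorb f (y * t) + k t * absorb g (y * t)"
      using mult_left_mono[OF v_le k_ge0] by (simp add: distrib_left)
    moreover have "0 \<le> k t * v (y * t)" using v0 k_ge0 by simp
    ultimately show "norm (k t * v (y * t)) \<le> norm (k t * absorb f (y * t) + k t * absorb g (y * t))" by simp
  qed measurable
  have vint: "integrable lborel (\<lambda>s. s * v s)"
  proof (rule Bochner_Integration.integrable_bound[OF Bochner_Integration.integrable_add[OF F(5) G(5)] _ AE_I2])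
    fix s
    show "norm (s * v s) \<le> norm (s * absorb f s + s * absorb g s)"
    proof (cases "0 < s")
      case True
      then have "s * v s \<le> s * absorb f s + s * absorb g s"
        using mult_left_mono[OF v_le, of s] by (simp add: distrib_left)
      moreover have "0 \<le> s * v s" using v0 True by simp
      ultimately show ?thesis by simp
    qed (use v_neg in auto)
  qed measurable
  have "\<forall>y>0. integrable lborel (\<lambda>t. k t * v (y * t))" using gint by blast
  note V = pos_fun_flux_balance[OF vp less_imp_le[OF p] this vint]
  have gain_diff: "\<bar>gain (absorb f) y - gain (absorb g) y\<bar> \<le> gain v y" if y: "0 < y" for y
  proof -
    have eq: "gain (absorb f) y - gain (absorb g) y = (LBINT t. k t * absorb f (y * t) - k t * absorb g (y * t))"
      unfolding gain_def using Fg[OF y] Gg[OF y] by simp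
    have "\<bar>(LBINT t. k t * absorb f (y * t) - k t * absorb g (y * t))\<bar> \<le> gain v y"
      unfolding gain_def real_norm_def[symmetric]
    proof (rule Bochner_Integration.integral_norm_bound_integral)
      show "norm (k t * absorb f (y * t) - k t * absorb g (y * t)) \<le> k t * v (y * t)" for t
        using k_ge0[of t] by (simp add: v_eq right_diff_distrib[symmetric] abs_mult)
    qed (use Fg[OF y] Gg[OF y] gint[OF y] in auto)
    then show ?thesis unfolding eq .
  qed
  have K0: "(K \<longlongrightarrow> 0) at_top"
  proof -
    have "((\<lambda>x. (f x - g x) - (x * f' x - x * g' x)) \<longlongrightarrow> (0 - 0) - (0 - 0)) at_top"
      by (intro tendsto_diff F G)
    then show ?thesis by (simp add: K_def[abs_def] w_def w'_def algebra_simps)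
  qed
  define \<theta> where "\<theta> x = w x / x" for x
  define Ws where "Ws x = absorb f x - gain (absorb f) x - (absorb g x - gain (absorb g) x)" for x
  have Dw: "(w has_real_derivative w' x) (at x)" and Dw': "(w' has_real_derivative Ws x) (at x)" if "0 < x" for x
    unfolding w_def[abs_def] w'_def[abs_def] Ws_def
    by (intro DERIV_diff F(2,3) G(2,3) that)+
  have D\<theta>: "(\<theta> has_real_derivative - (K x / x\<^sup>2)) (at x)" if "0 < x" for x
    unfolding \<theta>_def[abs_def]
    by (rule derivative_eq_intros Dw that refl)+ (use that in \<open>auto simp: K_def field_simps power2_eq_square\<close>)
  have DK: "(K has_real_derivative - (x * Ws x)) (at x)" if "0 < x" for x
    unfolding K_def[abs_def]
    by (rule derivative_eq_intros Dw Dw' that refl)+ simp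
  \<comment> \<open>Obtained by integrating the derivative of \<beta>(\<theta> x) K x over [p,q];
    the last term on the left is the price of smoothing the sign.\<close>
  have ineq: "- \<bar>K q\<bar> - (LINT x:{p..q}|lborel. x * gain v x - x * v x) - e * (A * integral {p..q} (\<lambda>x. x powr (\<gamma> + 2)))
      \<le> \<theta> p / sqrt ((\<theta> p)\<^sup>2 + e\<^sup>2) * K p" if e: "0 < e" and q: "p \<le> q" for e q
  proof -
    define \<beta> where "\<beta> t = t / sqrt (t\<^sup>2 + e\<^sup>2)" for t
    define \<beta>' where "\<beta>' t = e\<^sup>2 / ((t\<^sup>2 + e\<^sup>2) * sqrt (t\<^sup>2 + e\<^sup>2))" for t
    have \<beta>: "(\<beta> has_real_derivative \<beta>' t) (at t)" "\<bar>\<beta> t\<bar> \<le> 1" "\<bar>t\<bar> - e \<le> \<beta> t * t" "0 \<le> \<beta>' t" for t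
      using smoothed_sign[OF e, of t] by (auto simp: \<beta>_def[abs_def] \<beta>'_def)
    define D where "D x = \<beta>' (\<theta> x) * - (K x / x\<^sup>2) * K x + \<beta> (\<theta> x) * - (x * Ws x)" for x
    have D: "((\<lambda>x. \<beta> (\<theta> x) * K x) has_real_derivative D x) (at x)" if "0 < x" for x
      unfolding D_def by (rule derivative_eq_intros DK[OF that] DERIV_chain2[OF \<beta>(1) D\<theta>[OF that]] refl)+ simp
    have D_le: "D x \<le> (x * gain v x - x * v x) + e * (A * x powr (\<gamma> + 2))" if x: "0 < x" for x
    proof -
      \<comment> \<open>The derivative falling on the smoothed sign helps: \<beta>' \<ge> 0 and
        \<theta>' K = - K^2/x^2.\<close>
      have 1: "\<beta>' (\<theta> x) * - (K x / x\<^sup>2) * K x \<le> 0"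
      proof -
        have "\<beta>' (\<theta> x) * - (K x / x\<^sup>2) * K x = - (\<beta>' (\<theta> x) * ((K x)\<^sup>2 / x\<^sup>2))" by (simp add: power2_eq_square)
        also have "\<dots> \<le> 0" using \<beta>(4) by simp
        finally show ?thesis .
      qed
      have "\<beta> (\<theta> x) * (gain (absorb f) x - gain (absorb g) x) \<le> \<bar>\<beta> (\<theta> x)\<bar> * \<bar>gain (absorb f) x - gain (absorb g) x\<bar>"
        by (simp only: abs_mult[symmetric] abs_ge_self)
      also have "\<dots> \<le> 1 * gain v x" using \<beta>(2) gain_diff[OF x] by (intro mult_mono) auto
      finally have 2: "\<beta> (\<theta> x) * (gain (absorb f) x - gain (absorb g) x) \<le> gain v x" by simp
      have "absorb f x - absorb g x = A * x powr (\<gamma> + 1) * \<theta> x"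
      proof -
        have "w x = x * \<theta> x" "x powr (\<gamma> + 1) = x powr \<gamma> * x" using x by (simp_all add: \<theta>_def powr_add)
        then show ?thesis by (simp add: absorb_def w_def right_diff_distrib[symmetric])
      qed
      then have "\<beta> (\<theta> x) * (absorb f x - absorb g x) = A * x powr (\<gamma> + 1) * (\<beta> (\<theta> x) * \<theta> x)" by simp
      moreover have "A * x powr (\<gamma> + 1) * (\<bar>\<theta> x\<bar> - e) \<le> A * x powr (\<gamma> + 1) * (\<beta> (\<theta> x) * \<theta> x)"
        using \<beta>(3) A_pos by (intro mult_left_mono) auto
      moreover have "A * x powr (\<gamma> + 1) * (\<bar>\<theta> x\<bar> - e) = v x - e * (A * x powr (\<gamma> + 1))"
        using x by (simp add: v_def absorb_def \<theta>_def powr_add algebra_simps)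
      ultimately have 3: "v x - e * (A * x powr (\<gamma> + 1)) \<le> \<beta> (\<theta> x) * (absorb f x - absorb g x)" by linarith
      have "D x \<le> \<beta> (\<theta> x) * - (x * Ws x)" using 1 by (simp add: D_def)
      also have "\<dots> = x * (\<beta> (\<theta> x) * (gain (absorb f) x - gain (absorb g) x) - \<beta> (\<theta> x) * (absorb f x - absorb g x))"
        by (simp add: Ws_def algebra_simps)
      also have "\<dots> \<le> x * (gain v x - (v x - e * (A * x powr (\<gamma> + 1))))"
        using 2 3 x by (intro mult_left_mono diff_mono) auto
      also have "\<dots> = (x * gain v x - x * v x) + e * (A * (x powr (\<gamma> + 1) * x))" by (simp add: algebra_simps)
      also have "x powr (\<gamma> + 1) * x = x powr (\<gamma> + 2)" using x powr_add[of x "\<gamma> + 1" 1] by (simp add: add.assoc)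
      finally show ?thesis .
    qed
    have I1: "(D has_integral (\<beta> (\<theta> q) * K q - \<beta> (\<theta> p) * K p)) {p..q}"
      using q p by (intro fundamental_theorem_of_calculus)
        (auto simp: has_real_derivative_iff_has_vector_derivative[symmetric] intro!: has_field_derivative_at_within D)
    have i: "set_integrable lborel {p..q} (\<lambda>x. x * gain v x - x * v x)"
    proof (rule set_integrable_subset)
      show "set_integrable lborel {p..} (\<lambda>x. x * gain v x - x * v x)"
        by (rule set_integrable_Ioi_iff_Ici(1)[OF set_integral_diff(1)[OF V(1) integrable_set_Ioi[OF vint]]])
    qed auto
    have I2: "((\<lambda>x. x * gain v x - x * v x) has_integral (LINT x:{p..q}|lborel. x * gain v x - x * v x)) {p..q}"
      using set_borel_integral_eq_integral[OF i] by (simp add: has_integral_integral)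
    have I3: "((\<lambda>x. x powr (\<gamma> + 2)) has_integral integral {p..q} (\<lambda>x. x powr (\<gamma> + 2))) {p..q}"
      by (intro integrable_integral integrable_continuous_real continuous_intros) (use p in auto)
    have "\<beta> (\<theta> q) * K q - \<beta> (\<theta> p) * K p \<le> (LINT x:{p..q}|lborel. x * gain v x - x * v x) + e * (A * integral {p..q} (\<lambda>x. x powr (\<gamma> + 2)))"
      by (rule has_integral_le[OF I1 has_integral_add[OF I2 has_integral_mult_right[OF has_integral_mult_right[OF I3]]]])
        (use D_le p in auto)
    moreover have "- \<bar>K q\<bar> \<le> \<beta> (\<theta> q) * K q"
    proof -
      have "\<bar>\<beta> (\<theta> q) * K q\<bar> \<le> 1 * \<bar>K q\<bar>" unfolding abs_mult using \<beta>(2) by (intro mult_right_mono) auto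
      then show ?thesis by linarith
    qed
    ultimately show ?thesis unfolding \<beta>_def[symmetric] by linarith
  qed
  show ?thesis
  proof (cases "w p = 0")
    case False
    then have \<theta>p: "\<theta> p \<noteq> 0" using p by (simp add: \<theta>_def)
    \<comment> \<open>The smoothing error carries the integral of x^(\<gamma>+2) over [p,q], which
      grows with q. So e tends to 0 first, for fixed q, and only then q tends to infinity.\<close>
    have "- \<bar>K q\<bar> - (LINT x:{p..q}|lborel. x * gain v x - x * v x) \<le> \<theta> p / sqrt ((\<theta> p)\<^sup>2) * K p" if q: "p \<le> q" for q
    proof (rule tendsto_le)
      show "((\<lambda>e. \<theta> p / sqrt ((\<theta> p)\<^sup>2 + e\<^sup>2) * K p) \<longlongrightarrow> \<theta> p / sqrt ((\<theta> p)\<^sup>2) * K p) (at_right 0)"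
        using \<theta>p by (auto intro!: tendsto_eq_intros)
      show "((\<lambda>e. - \<bar>K q\<bar> - (LINT x:{p..q}|lborel. x * gain v x - x * v x) - e * (A * integral {p..q} (\<lambda>x. x powr (\<gamma> + 2))))
         \<longlongrightarrow> - \<bar>K q\<bar> - (LINT x:{p..q}|lborel. x * gain v x - x * v x)) (at_right 0)"
        by (auto intro!: tendsto_eq_intros)
      show "\<forall>\<^sub>F e in at_right 0. - \<bar>K q\<bar> - (LINT x:{p..q}|lborel. x * gain v x - x * v x) - e * (A * integral {p..q} (\<lambda>x. x powr (\<gamma> + 2)))
          \<le> \<theta> p / sqrt ((\<theta> p)\<^sup>2 + e\<^sup>2) * K p"
        using eventually_at_right_less[of "0::real"] by eventually_elim (rule ineq[OF _ q])
    qed simp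
    then have ev: "\<forall>\<^sub>F q in at_top. - \<bar>K q\<bar> - (LINT x:{p..q}|lborel. x * gain v x - x * v x) \<le> \<theta> p / sqrt ((\<theta> p)\<^sup>2) * K p"
      by (auto simp: eventually_at_top_linorder)
    have iv: "set_integrable lborel {p<..} (\<lambda>x. x * gain v x - x * v x)"
      by (rule set_integral_diff(1)[OF V(1) integrable_set_Ioi[OF vint]])
    have "((\<lambda>q. LINT x:{p..q}|lborel. x * gain v x - x * v x) \<longlongrightarrow> (LINT x:{p..}|lborel. x * gain v x - x * v x)) at_top"
      by (rule tendsto_set_lebesgue_integral_at_top) (use set_integrable_Ioi_iff_Ici(1)[OF iv] in auto)
    \<comment> \<open>The mass balance identifies the limit with minus the flux of v, so the
      remaining inequality has the nonnegative flux on its smaller side.\<close>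
    also have "(LINT x:{p..}|lborel. x * gain v x - x * v x) = - flux v p"
      unfolding set_integrable_Ioi_iff_Ici(2)[OF iv] V(2)
      using set_integral_diff(2)[OF V(1) integrable_set_Ioi[OF vint]] by simp
    finally have "((\<lambda>q. - \<bar>K q\<bar> - (LINT x:{p..q}|lborel. x * gain v x - x * v x)) \<longlongrightarrow> - \<bar>0\<bar> - - flux v p) at_top"
      by (intro tendsto_intros K0)
    from tendsto_upperbound[OF this ev] have "flux v p \<le> \<theta> p / sqrt ((\<theta> p)\<^sup>2) * K p" by simp
    moreover have "0 \<le> flux v p" by (rule flux_nonneg[OF vp p])
    ultimately have "0 \<le> \<theta> p / sqrt ((\<theta> p)\<^sup>2) * K p" by (rule order_trans[rotated])
    then have nn: "0 \<le> \<theta> p / \<bar>\<theta> p\<bar> * K p" by (simp only: real_sqrt_abs)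
    have "0 \<le> (\<bar>\<theta> p\<bar> * p) * (\<theta> p / \<bar>\<theta> p\<bar> * K p)" by (rule mult_nonneg_nonneg[OF _ nn]) (use p in simp)
    also have "\<dots> = w p * K p" using \<theta>p p by (simp add: \<theta>_def)
    finally show ?thesis by (simp add: w_def w'_def K_def)
  qed (simp add: w_def)
qed

theorem classical_sol_unique:
  assumes f: "classical_sol f f'" and g: "classical_sol g g'"
    and mass: "(LBINT s. s * f s) = (LBINT s. s * g s)" and x: "0 < x"
  shows "f x = g x"
proof (rule ccontr)
  assume neq: "f x \<noteq> g x"
  note F = classical_solD[OF f] and G = classical_solD[OF g]
  define w where "w x = f x - g x" for x
  define \<theta> where "\<theta> x = w x / x" for x
  have D\<theta>: "(\<theta> has_real_derivative - ((w y - y * (f' y - g' y)) / y\<^sup>2)) (at y)" if "0 < y" for y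
    unfolding \<theta>_def[abs_def] w_def
    by (rule derivative_eq_intros F(2) G(2) that refl)+ (use that in \<open>auto simp: field_simps power2_eq_square\<close>)
  \<comment> \<open>The derivative of \<theta>^2 is -2 w (w - x w') / x^3, nonpositive by
    \<open>difference_flux_sign\<close>.\<close>
  have anti: "(\<theta> b)\<^sup>2 \<le> (\<theta> a)\<^sup>2" if "0 < a" "a \<le> b" for a b
  proof (rule DERIV_nonpos_imp_nonincreasing[OF that(2)])
    fix y assume "a \<le> y" "y \<le> b"
    then have y: "0 < y" using that by simp
    have "((\<lambda>y. (\<theta> y)\<^sup>2) has_real_derivative - (2 / y ^ 3 * (w y * (w y - y * (f' y - g' y))))) (at y)"
      by (rule derivative_eq_intros D\<theta>[OF y] refl)+ (use y in \<open>simp add: \<theta>_def power2_eq_square power3_eq_cube\<close>)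
    moreover have "0 \<le> 2 / y ^ 3 * (w y * (w y - y * (f' y - g' y)))"
      by (rule mult_nonneg_nonneg[OF _ difference_flux_sign[OF f g y, folded w_def]]) (use y in simp)
    ultimately show "\<exists>D. ((\<lambda>y. (\<theta> y)\<^sup>2) has_real_derivative D) (at y) \<and> D \<le> 0"
      by (intro exI[of _ "- (2 / y ^ 3 * (w y * (w y - y * (f' y - g' y))))"]) linarith
  qed
  have cont: "continuous_on {0<..} \<theta>"
    using D\<theta> by (auto intro!: continuous_at_imp_continuous_on DERIV_isCont)
  \<comment> \<open>A sign change would give a zero c of \<theta>, and since \<theta>^2 is
    nonincreasing, \<theta> would vanish from c on, in particular at b.\<close>
  have one_sign: "0 \<le> \<theta> a * \<theta> b" if "0 < a" "a \<le> b" for a b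
  proof (rule ccontr)
    assume neg: "\<not> 0 \<le> \<theta> a * \<theta> b"
    then have "\<theta> a \<le> 0 \<and> 0 \<le> \<theta> b \<or> \<theta> b \<le> 0 \<and> 0 \<le> \<theta> a" by (auto simp: not_le mult_less_0_iff)
    then obtain c where c: "a \<le> c" "c \<le> b" "\<theta> c = 0"
    proof
      have c': "continuous_on {a..b} \<theta>" using that by (intro continuous_on_subset[OF cont]) (use \<open>0 < a\<close> in auto)
      show thesis if "\<theta> a \<le> 0 \<and> 0 \<le> \<theta> b"
        using IVT'[of \<theta> a 0 b, OF _ _ \<open>a \<le> b\<close> c'] that \<open>\<And>c. a \<le> c \<Longrightarrow> c \<le> b \<Longrightarrow> \<theta> c = 0 \<Longrightarrow> thesis\<close> by blast
      show thesis if "\<theta> b \<le> 0 \<and> 0 \<le> \<theta> a"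
        using IVT2'[of \<theta> b 0 a, OF _ _ \<open>a \<le> b\<close> c'] that \<open>\<And>c. a \<le> c \<Longrightarrow> c \<le> b \<Longrightarrow> \<theta> c = 0 \<Longrightarrow> thesis\<close> by blast
    qed
    have "(\<theta> b)\<^sup>2 \<le> (\<theta> c)\<^sup>2" using c that by (intro anti) auto
    then have "\<theta> b = 0" using c by simp
    then show False using neg by simp
  qed
  have \<theta>x: "\<theta> x \<noteq> 0" using neq x by (simp add: \<theta>_def w_def)
  define \<sigma> where "\<sigma> = sgn (\<theta> x)"
  have \<sigma>: "0 \<le> \<sigma> * w y" if "0 < y" for y
  proof -
    have "0 \<le> \<theta> x * \<theta> y" using one_sign[of x y] one_sign[of y x] x that by (cases "x \<le> y") (auto simp: mult.commute)
    then have "0 \<le> \<sigma> * \<theta> y" using \<theta>x by (auto simp: \<sigma>_def sgn_if zero_le_mult_iff split: if_splits)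
    then have "0 \<le> \<sigma> * \<theta> y * y" by (rule mult_nonneg_nonneg) (use that in simp)
    then show ?thesis using that by (simp add: \<theta>_def)
  qed
  have int: "integrable lborel (\<lambda>s. \<sigma> * (s * f s - s * g s))" using F(6) G(6) by auto
  have "(LBINT s. \<sigma> * (s * f s - s * g s)) = 0" using F(6) G(6) mass by simp
  moreover have pos: "0 \<le> \<sigma> * (s * f s - s * g s)" for s
  proof (cases "0 < s")
    case True
    have "0 \<le> s * (\<sigma> * w s)" using \<sigma>[OF True] True by simp
    then show ?thesis by (simp add: w_def algebra_simps)
  qed (use pos_funD(3)[OF F(1)] pos_funD(3)[OF G(1)] in auto)
  ultimately have "AE s in lborel. \<sigma> * (s * f s - s * g s) = 0"
    using integral_nonneg_eq_0_iff_AE[OF int] by simp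
  \<comment> \<open>On (0,x) monotonicity gives \<theta>(s)^2 \<ge> \<theta>(x)^2 > 0, whereas the
    weighted difference vanishes almost everywhere; so this interval would be null.\<close>
  then have "AE s in lborel. s \<notin> {0<..<x}"
  proof eventually_elim
    case (elim s)
    show ?case
    proof
      assume s: "s \<in> {0<..<x}"
      then have "(\<theta> x)\<^sup>2 \<le> (\<theta> s)\<^sup>2" by (intro anti) auto
      then have "\<theta> s \<noteq> 0" using \<theta>x by auto
      then have "f s \<noteq> g s" using s by (auto simp: \<theta>_def w_def)
      moreover have "\<sigma> \<noteq> 0" using \<theta>x by (simp add: \<sigma>_def sgn_if)
      ultimately show False using elim s by (simp add: right_diff_distrib[symmetric])
    qed
  qed
  then have "emeasure lborel {0<..<x} = 0"
    by (subst (asm) AE_iff_measurable[OF _ refl]) (auto simp: greaterThanLessThan_def greaterThan_def lessThan_def Int_def)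
  then show False using x by simp
qed

end

section \<open>Behaviour at infinity\<close>

text \<open>A negative value yields a negative interior minimum m with \<rho>'(m) = 0. As
  \<rho>''(m) < 0, the derivative is negative just to the right of m and \<rho> drops below its
  minimum. Only pointwise second derivatives are used, not their continuity.\<close>

lemma minimum_principle:
  fixes \<rho> \<rho>' \<rho>'' :: "real \<Rightarrow> real"
  assumes D: "\<And>x. 1 \<le> x \<Longrightarrow> (\<rho> has_real_derivative \<rho>' x) (at x)"
    and D': "\<And>x. 1 \<le> x \<Longrightarrow> (\<rho>' has_real_derivative \<rho>'' x) (at x)"
    and neg: "\<And>x. 1 \<le> x \<Longrightarrow> \<rho> x < 0 \<Longrightarrow> \<rho>'' x < 0"
    and 1: "0 \<le> \<rho> 1" and lim: "(\<rho> \<longlongrightarrow> 0) at_top" and x: "1 \<le> x"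
  shows "0 \<le> \<rho> x"
proof (rule ccontr)
  assume "\<not> 0 \<le> \<rho> x"
  then have nx: "\<rho> x < 0" by simp
  have "\<forall>\<^sub>F y in at_top. \<rho> x < \<rho> y" by (rule order_tendstoD(1)[OF lim nx])
  \<comment> \<open>Beyond \<open>B0\<close> all values exceed \<rho> x < 0, so the minimum over
    [1,B] is attained neither at B nor, because \<rho> 1 \<ge> 0, at 1.\<close>
  then obtain B0 where B0: "\<And>y. y \<ge> B0 \<Longrightarrow> \<rho> x < \<rho> y" by (auto simp: eventually_at_top_linorder)
  define B where "B = max B0 (x + 1)"
  have B: "x < B" "\<rho> x < \<rho> B" using B0[of B] by (auto simp: B_def)
  have "continuous_on {1..B} \<rho>" using D by (auto intro!: continuous_at_imp_continuous_on DERIV_isCont)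
  then obtain m where m: "1 \<le> m" "m \<le> B" "\<And>y. 1 \<le> y \<Longrightarrow> y \<le> B \<Longrightarrow> \<rho> m \<le> \<rho> y"
    using continuous_attains_inf[of "{1..B}" \<rho>] x B by auto
  have mx: "\<rho> m \<le> \<rho> x" using m(3)[of x] x B by simp
  then have m': "1 < m" "m < B" using m 1 nx B by (auto simp: less_le)
  define d where "d = min (m - 1) (B - m)"
  have d: "0 < d" using m' by (simp add: d_def)
  have z: "\<rho>' m = 0"
    by (rule DERIV_local_min[OF D[OF m(1)] d]) (auto simp: d_def abs_if intro!: m(3) split: if_splits)
  obtain e where e: "0 < e" "\<And>h. 0 < h \<Longrightarrow> h < e \<Longrightarrow> \<rho>' (m + h) < \<rho>' m"
    using DERIV_neg_dec_right[OF D'[OF m(1)] neg[OF m(1)]] mx nx by auto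
  define h where "h = min e d / 2"
  have h: "0 < h" "h < e" "h < d" using e(1) d by (auto simp: h_def)
  have "\<rho> (m + h) < \<rho> m"
  proof (rule DERIV_neg_imp_decreasing_open[where f = \<rho>])
    show "\<exists>y. (\<rho> has_real_derivative y) (at t) \<and> y < 0" if "m < t" "t < m + h" for t
      using D[of t] e(2)[of "t - m"] that h m' z by (intro exI[of _ "\<rho>' t"]) auto
    show "continuous_on {m..m + h} \<rho>"
      by (intro continuous_at_imp_continuous_on ballI DERIV_isCont[OF D]) (use m' in auto)
  qed (use h in simp)
  moreover have "\<rho> m \<le> \<rho> (m + h)" using m(3)[of "m + h"] h m' by (simp add: d_def)
  ultimately show False by simp
qed

lemma nn_integral_powr_Ioo:
  assumes "-1 < m" "0 \<le> a" "a \<le> (b::real)"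
  shows "(NN t. indicator {a<..<b} t * ennreal (t powr m)) = ennreal (b powr (m + 1) / (m + 1) - a powr (m + 1) / (m + 1))"
proof -
  have "(NN t. indicator {0..a} t * ennreal (t powr m)) + (NN t. indicator {a<..<b} t * ennreal (t powr m))
    = (NN t. indicator {0..a} t * ennreal (t powr m) + indicator {a<..<b} t * ennreal (t powr m))"
    by (rule nn_integral_add[symmetric]) measurable
  also have "\<dots> = (NN t. indicator {0..b} t * ennreal (t powr m))"
  proof (rule nn_integral_cong_AE)
    show "AE t in lborel. indicator {0..a} t * ennreal (t powr m) + indicator {a<..<b} t * ennreal (t powr m) = indicator {0..b} t * ennreal (t powr m)"
      using AE_lborel_singleton[of b] by eventually_elim (use assms in \<open>auto split: split_indicator\<close>)
  qed
  finally have "ennreal (a powr (m + 1) / (m + 1)) + (NN t. indicator {a<..<b} t * ennreal (t powr m)) = ennreal (b powr (m + 1) / (m + 1))"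
    using assms by (simp only: nn_integral_powr_from_0[OF assms(1)] order_trans[OF assms(2,3)])
  then have "ennreal (b powr (m + 1) / (m + 1)) - ennreal (a powr (m + 1) / (m + 1)) = (NN t. indicator {a<..<b} t * ennreal (t powr m))"
    by (metis ennreal_add_diff_cancel_left ennreal_neq_top)
  then show ?thesis using assms by (simp add: ennreal_minus)
qed

section \<open>Exponential bounds: a barrier from below, moments from above\<close>

context fragmentation
begin

text \<open>The barrier v is the WKB approximation for -v'' + a v = 0 and satisfies v'' \<ge> a v.
  The gain is nonnegative, so f'' \<le> a f; wherever f < f(1) v, the difference has negative second
  derivative and \<open>minimum_principle\<close> applies.\<close>

lemma classical_sol_lower_bound:
  assumes "classical_sol f f'" "1 \<le> x" "\<alpha> = (\<gamma> + 2) / 2"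
  shows "f 1 * x powr (- \<gamma> / 4) * exp (- sqrt A * x powr \<alpha> / \<alpha>) \<le> f x"
proof -
  note S = classical_solD[OF assms(1)] and \<alpha> = assms(3)
  have \<alpha>1: "1 \<le> \<alpha>" and \<alpha>g: "\<alpha> - 1 = \<gamma> / 2" using \<gamma>_ge0 by (auto simp: \<alpha> field_simps)
  define v where "v x = x powr (- \<gamma> / 4) * exp (- sqrt A * x powr \<alpha> / \<alpha>)" for x
  define c where "c x = - \<gamma> / 4 * (1 / x) - sqrt A * x powr (\<gamma> / 2)" for x
  define c' where "c' x = \<gamma> / 4 * (1 / x\<^sup>2) - sqrt A * (\<gamma> / 2 * x powr (\<gamma> / 2 - 1))" for x
  have Dv: "(v has_real_derivative v x * c x) (at x)" if "0 < x" for x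
  proof -
    have "(v has_real_derivative (- \<gamma> / 4 * x powr (- \<gamma> / 4 - 1)) * exp (- sqrt A * x powr \<alpha> / \<alpha>)
        + x powr (- \<gamma> / 4) * (exp (- sqrt A * x powr \<alpha> / \<alpha>) * (- sqrt A * (\<alpha> * x powr (\<alpha> - 1)) / \<alpha>))) (at x)"
      unfolding v_def[abs_def] using that \<alpha>1 by (auto intro!: derivative_eq_intros)
    also have "x powr (- \<gamma> / 4 - 1) = x powr (- \<gamma> / 4) * (1 / x)" using that by (simp add: powr_diff)
    also have "(- \<gamma> / 4 * (x powr (- \<gamma> / 4) * (1 / x))) * exp (- sqrt A * x powr \<alpha> / \<alpha>)
        + x powr (- \<gamma> / 4) * (exp (- sqrt A * x powr \<alpha> / \<alpha>) * (- sqrt A * (\<alpha> * x powr (\<alpha> - 1)) / \<alpha>)) = v x * c x"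
      using \<alpha>1 by (simp add: v_def c_def \<alpha>g algebra_simps)
    finally show ?thesis .
  qed
  have Dc: "(c has_real_derivative c' x) (at x)" if "0 < x" for x
    unfolding c_def[abs_def] c'_def using that
    by (auto intro!: derivative_eq_intros simp: power2_eq_square)
  have Dvc: "((\<lambda>x. v x * c x) has_real_derivative v x * ((c x)\<^sup>2 + c' x)) (at x)" if "0 < x" for x
    by (rule derivative_eq_intros Dv[OF that] Dc[OF that] refl)+ (simp add: algebra_simps power2_eq_square)
  \<comment> \<open>With c = v'/v one has v''/v = c^2 + c'. The exponent -\<gamma>/4 makes the terms
    in x^(\<gamma>/2 - 1) cancel; what is left over a(x) is (\<gamma>^2/16 + \<gamma>/4)/x^2 \<ge>
    0.\<close>
  have cc: "A * x powr \<gamma> \<le> (c x)\<^sup>2 + c' x" if "0 < x" for x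
  proof -
    have e: "x powr (\<gamma> / 2 - 1) = x powr (\<gamma> / 2) * (1 / x)" "x powr \<gamma> = (x powr (\<gamma> / 2))\<^sup>2"
      using that by (simp_all add: powr_diff powr_powr[symmetric] powr_numeral[symmetric] powr_powr)
    have "(c x)\<^sup>2 + c' x = (sqrt A)\<^sup>2 * (x powr (\<gamma> / 2))\<^sup>2 + (\<gamma>\<^sup>2 / 16 + \<gamma> / 4) * (1 / x)\<^sup>2"
      unfolding c_def c'_def e by (simp add: power2_eq_square algebra_simps)
    then show ?thesis using A_pos \<gamma>_ge0 by (simp add: e)
  qed
  have v0: "0 \<le> v x" for x by (simp add: v_def)
  have f1: "0 \<le> f 1" using pos_funD(2)[OF S(1)] .
  have v_lim: "(v \<longlongrightarrow> 0) at_top"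
  proof (rule tendsto_sandwich[OF _ _ tendsto_const])
    show "\<forall>\<^sub>F x in at_top. 0 \<le> v x" using v0 by simp
    show "\<forall>\<^sub>F x in at_top. v x \<le> exp (- (sqrt A / \<alpha> * x))"
      using eventually_ge_at_top[of 1]
    proof eventually_elim
      case (elim x)
      have "x powr (- \<gamma> / 4) \<le> 1" using elim \<gamma>_ge0 powr_mono[of "- \<gamma> / 4" 0 x] by simp
      moreover have "x \<le> x powr \<alpha>" using elim \<alpha>1 powr_mono[of 1 \<alpha> x] by simp
      then have "sqrt A / \<alpha> * x \<le> sqrt A / \<alpha> * x powr \<alpha>" using A_pos \<alpha>1 by (intro mult_left_mono) auto
      then have "exp (- sqrt A * x powr \<alpha> / \<alpha>) \<le> exp (- (sqrt A / \<alpha> * x))" by simp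
      ultimately show ?case unfolding v_def using mult_mono[of "x powr (- \<gamma> / 4)" 1] by fastforce
    qed
    have exp0: "((\<lambda>x::real. exp (- (b * x))) \<longlongrightarrow> 0) at_top" if "0 < b" for b using that by real_asymp
    show "((\<lambda>x. exp (- (sqrt A / \<alpha> * x))) \<longlongrightarrow> 0) at_top"
      by (rule exp0) (use A_pos \<alpha>1 in simp)
  qed
  have "0 \<le> f x - f 1 * v x"
  proof (rule minimum_principle[of "\<lambda>x. f x - f 1 * v x" "\<lambda>x. f' x - f 1 * (v x * c x)"
        "\<lambda>x. absorb f x - gain (absorb f) x - f 1 * (v x * ((c x)\<^sup>2 + c' x))"])
    fix y :: real assume y1: "1 \<le> y"
    then have y: "0 < y" by simp
    show "((\<lambda>x. f x - f 1 * v x) has_real_derivative f' y - f 1 * (v y * c y)) (at y)"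
      by (intro DERIV_diff DERIV_cmult S(2) Dv y)
    show "((\<lambda>x. f' x - f 1 * (v x * c x)) has_real_derivative absorb f y - gain (absorb f) y - f 1 * (v y * ((c y)\<^sup>2 + c' y))) (at y)"
      by (intro DERIV_diff DERIV_cmult S(3) Dvc y)
    assume neg: "f y - f 1 * v y < 0"
    have "0 \<le> gain (absorb f) y"
      unfolding gain_def using k_ge0 pos_funD(2)[OF pos_fun_absorb[OF S(1)]] by (intro integral_nonneg_AE) auto
    moreover have "f 1 * (v y * (A * y powr \<gamma>)) \<le> f 1 * (v y * ((c y)\<^sup>2 + c' y))"
      using cc[OF y] v0 f1 by (intro mult_left_mono) auto
    moreover have "absorb f y - f 1 * (v y * (A * y powr \<gamma>)) = A * y powr \<gamma> * (f y - f 1 * v y)"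
      by (simp add: absorb_def algebra_simps)
    moreover have "A * y powr \<gamma> * (f y - f 1 * v y) < 0"
      using neg A_pos y by (intro mult_pos_neg) auto
    ultimately show "absorb f y - gain (absorb f) y - f 1 * (v y * ((c y)\<^sup>2 + c' y)) < 0" by linarith
  next
    have "v 1 \<le> 1" using A_pos \<alpha>1 by (simp add: v_def)
    then show "0 \<le> f 1 - f 1 * v 1" using mult_left_mono[of "v 1" 1 "f 1"] f1 by simp
    have "((\<lambda>x. f x - f 1 * v x) \<longlongrightarrow> 0 - f 1 * 0) at_top" by (intro tendsto_intros S(7) v_lim)
    then show "((\<lambda>x. f x - f 1 * v x) \<longlongrightarrow> 0) at_top" by simp
  qed (rule assms(2))
  then show ?thesis by (simp add: v_def mult.assoc)
qed

text \<open>Two uses of Fubini evaluate \<open>What m\<close> as the integral of z h(z) (1 - z^m)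
  divided by m (m + 1). By unit mass that integral is 1 minus the moment of h of order m + 1; chi
  enters through this moment.\<close>

lemma What_ge:
  assumes m: "0 < m" and h: "(NN z. ennreal (z powr (m + 1) * h z)) \<le> ennreal b" "0 \<le> b" "b < 1"
  shows "(1 - b) / (m * (m + 1)) \<le> Wm m"
proof -
  have "What m = (NN t. NN r. indicator {0<..} t * (ennreal (t powr m) * ((if t < r then 1 else 0) * indicator {..<1} r * ennreal (H r / r\<^sup>2))))"
    unfolding What_def
  proof (rule nn_integral_cong)
    fix t
    show "ennreal (t powr m * W t) = (NN r. indicator {0<..} t * (ennreal (t powr m) * ((if t < r then 1 else 0) * indicator {..<1} r * ennreal (H r / r\<^sup>2))))"
    proof (cases "0 < t")
      case True
      have "ennreal (t powr m * W t) = ennreal (t powr m) * (NN r. indicator {t<..<1} r * ennreal (H r / r\<^sup>2))"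
        using True by (simp add: ennreal_mult' ennreal_W)
      also have "\<dots> = (NN r. ennreal (t powr m) * (indicator {t<..<1} r * ennreal (H r / r\<^sup>2)))"
        by (rule nn_integral_cmult[symmetric]) measurable
      also have "\<dots> = (NN r. indicator {0<..} t * (ennreal (t powr m) * ((if t < r then 1 else 0) * indicator {..<1} r * ennreal (H r / r\<^sup>2))))"
        using True by (intro nn_integral_cong) (auto split: split_indicator)
      finally show ?thesis .
    qed (simp add: W_out)
  qed
  also have "\<dots> = (NN r. NN t. indicator {0<..} t * (ennreal (t powr m) * ((if t < r then 1 else 0) * indicator {..<1} r * ennreal (H r / r\<^sup>2))))"
    by (rule lborel_pair.Fubini') measurable
  also have "\<dots> = (NN r. ennreal (1 / (m + 1)) * (indicator {0<..<1} r * (ennreal (r powr (m - 1)) * ennreal (H r))))"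
  proof (rule nn_integral_cong)
    fix r
    show "(NN t. indicator {0<..} t * (ennreal (t powr m) * ((if t < r then 1 else 0) * indicator {..<1} r * ennreal (H r / r\<^sup>2))))
      = ennreal (1 / (m + 1)) * (indicator {0<..<1} r * (ennreal (r powr (m - 1)) * ennreal (H r)))"
    proof (cases "0 < r \<and> r < 1")
      case True
      then have r: "0 < r" "r < 1" by auto
      have "(NN t. indicator {0<..} t * (ennreal (t powr m) * ((if t < r then 1 else 0) * indicator {..<1} r * ennreal (H r / r\<^sup>2))))
        = (NN t. ennreal (H r / r\<^sup>2) * (indicator {0<..<r} t * ennreal (t powr m)))"
        using r by (intro nn_integral_cong) (auto split: split_indicator simp: mult.commute)
      also have "\<dots> = ennreal (H r / r\<^sup>2) * ennreal (r powr (m + 1) / (m + 1) - 0 powr (m + 1) / (m + 1))"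
        using r m by (subst nn_integral_cmult) (auto simp only: nn_integral_powr_Ioo, auto simp: nn_integral_powr_Ioo)
      also have "\<dots> = ennreal (1 / (m + 1) * (r powr (m - 1) * H r))"
      proof -
        have "r powr (m + 1) = r powr (m - 1) * r\<^sup>2" using r powr_add[of r "m - 1" 2] by (simp add: powr_numeral add.commute)
        then have "H r / r\<^sup>2 * (r powr (m + 1) / (m + 1)) = 1 / (m + 1) * (r powr (m - 1) * H r)" using r m by simp
        then show ?thesis using m H_ge0 by (simp add: ennreal_mult'[symmetric])
      qed
      also have "\<dots> = ennreal (1 / (m + 1)) * (ennreal (r powr (m - 1)) * ennreal (H r))"
        using m by (subst ennreal_mult3) auto
      finally show ?thesis using r by simp
    next
      case False
      then have "indicator {0<..} t * (ennreal (t powr m) * ((if t < r then 1 else 0) * indicator {..<1} r * ennreal (H r / r\<^sup>2))) = 0" for t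
        by (auto split: split_indicator)
      note z = this
      show ?thesis unfolding z using False by auto
    qed
  qed
  also have "\<dots> = ennreal (1 / (m + 1)) * (NN r. indicator {0<..<1} r * (ennreal (r powr (m - 1)) * ennreal (H r)))"
    by (rule nn_integral_cmult) measurable
  also have "(NN r. indicator {0<..<1} r * (ennreal (r powr (m - 1)) * ennreal (H r)))
    = (NN r. NN z. indicator {0<..<1} r * (ennreal (r powr (m - 1)) * ((if z < r then 1 else 0) * ennreal (z * h z))))"
  proof (rule nn_integral_cong)
    fix r
    have "indicator {0<..<1} r * (ennreal (r powr (m - 1)) * ennreal (H r)) = indicator {0<..<1} r * ennreal (r powr (m - 1)) * (NN z. indicator {..<r} z * ennreal (z * h z))"
      unfolding ennreal_H by (simp only: mult.assoc)
    also have "\<dots> = (NN z. indicator {0<..<1} r * ennreal (r powr (m - 1)) * (indicator {..<r} z * ennreal (z * h z)))"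
      by (rule nn_integral_cmult[symmetric]) measurable
    also have "\<dots> = (NN z. indicator {0<..<1} r * (ennreal (r powr (m - 1)) * ((if z < r then 1 else 0) * ennreal (z * h z))))"
      by (intro nn_integral_cong) (auto simp: mult.assoc split: split_indicator)
    finally show "indicator {0<..<1} r * (ennreal (r powr (m - 1)) * ennreal (H r)) = (NN z. indicator {0<..<1} r * (ennreal (r powr (m - 1)) * ((if z < r then 1 else 0) * ennreal (z * h z))))" .
  qed
  also have "\<dots> = (NN z. NN r. indicator {0<..<1} r * (ennreal (r powr (m - 1)) * ((if z < r then 1 else 0) * ennreal (z * h z))))"
    by (rule lborel_pair.Fubini') measurable
  also have "\<dots> = (NN z. ennreal (z * h z * (1 - z powr m) / m))"
  proof (rule nn_integral_cong)
    fix z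
    show "(NN r. indicator {0<..<1} r * (ennreal (r powr (m - 1)) * ((if z < r then 1 else 0) * ennreal (z * h z)))) = ennreal (z * h z * (1 - z powr m) / m)"
    proof (cases "z \<in> {0<..<1}")
      case True
      then have z: "0 < z" "z < 1" by auto
      have "(NN r. indicator {0<..<1} r * (ennreal (r powr (m - 1)) * ((if z < r then 1 else 0) * ennreal (z * h z))))
        = (NN r. ennreal (z * h z) * (indicator {z<..<1} r * ennreal (r powr (m - 1))))"
        using z by (intro nn_integral_cong) (auto split: split_indicator simp: mult.commute)
      also have "\<dots> = ennreal (z * h z) * ennreal (1 powr (m - 1 + 1) / (m - 1 + 1) - z powr (m - 1 + 1) / (m - 1 + 1))"
        using z m by (subst nn_integral_cmult) (auto simp only: nn_integral_powr_Ioo, auto simp: nn_integral_powr_Ioo)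
      also have "\<dots> = ennreal (z * h z * (1 - z powr m) / m)"
        using zh_ge0[of z] by (subst ennreal_mult'[symmetric]) (auto simp: diff_divide_distrib right_diff_distrib)
      finally show ?thesis .
    qed (simp add: h_out)
  qed
  also have "\<dots> = (NN z. ennreal (1 / m) * ennreal (z * h z * (1 - z powr m)))"
    using m by (intro nn_integral_cong) (subst ennreal_mult'[symmetric], auto)
  also have "\<dots> = ennreal (1 / m) * (NN z. ennreal (z * h z * (1 - z powr m)))"
    by (rule nn_integral_cmult) measurable
  finally have W: "What m = ennreal (1 / (m + 1)) * (ennreal (1 / m) * (NN z. ennreal (z * h z * (1 - z powr m))))" .
  have "1 = (NN z. ennreal (z * h z * (1 - z powr m)) + ennreal (z powr (m + 1) * h z))"
    unfolding h_mass[symmetric]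
  proof (rule nn_integral_cong)
    fix z
    show "ennreal (z * h z) = ennreal (z * h z * (1 - z powr m)) + ennreal (z powr (m + 1) * h z)"
    proof (cases "z \<in> {0<..<1}")
      case True
      have "z powr m \<le> 1" using True m by (simp add: powr_le1)
      then have "ennreal (z * h z * (1 - z powr m)) + ennreal (z powr (m + 1) * h z) = ennreal (z * h z * (1 - z powr m) + z powr (m + 1) * h z)"
        using zh_ge0[of z] h_ge0[of z] by (intro ennreal_plus[symmetric]) auto
      then show ?thesis using True by (simp add: powr_add algebra_simps)
    qed (simp add: h_out)
  qed
  also have "\<dots> = (NN z. ennreal (z * h z * (1 - z powr m))) + (NN z. ennreal (z powr (m + 1) * h z))"
    by (rule nn_integral_add) measurable
  also have "\<dots> \<le> (NN z. ennreal (z * h z * (1 - z powr m))) + ennreal b" using h(1) by (rule add_left_mono)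
  finally have "ennreal 1 - ennreal b \<le> (NN z. ennreal (z * h z * (1 - z powr m)))"
    by (simp add: ennreal_minus_le_iff add.commute)
  then have "ennreal (1 - b) \<le> (NN z. ennreal (z * h z * (1 - z powr m)))"
    using h by (simp add: ennreal_minus del: ennreal_1)
  then have "ennreal (1 / (m + 1)) * (ennreal (1 / m) * ennreal (1 - b)) \<le> What m"
    unfolding W by (intro mult_left_mono) auto
  also have "What m = ennreal (Wm m)" using ennreal_Wm[OF m] by simp
  also have "ennreal (1 / (m + 1)) * (ennreal (1 / m) * ennreal (1 - b)) = ennreal ((1 - b) / (m * (m + 1)))"
    using m by (subst ennreal_mult3) (auto simp: field_simps)
  finally show ?thesis using Wm_pos[OF m] by (simp add: ennreal_le_iff)
qed

text \<open>This is (s / (e sqrt A))^(s/\<alpha>) s^q, of the form that Stirling's formula gives for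
  moments of exp (- sqrt A x^\<alpha> / \<alpha>).\<close>

definition env :: "real \<Rightarrow> real \<Rightarrow> real \<Rightarrow> real" where
  "env \<alpha> q s = exp (s / \<alpha> * (ln s - 1 - ln (sqrt A)) + q * ln s)"

text \<open>The moment recursion gains the factor \<open>s (s - 1) / (A (1 - chi / s))\<close> when \<open>s\<close> grows by \<open>\<gamma> + 2\<close>;
  \<open>env\<close>, the moment of the claimed envelope up to a power, grows at least as fast.\<close>

lemma env_step:
  assumes \<alpha>: "\<alpha> = (\<gamma> + 2) / 2" and q: "q = \<mu> / \<alpha>" "0 < \<mu>" "chi - 1 < 2 * \<mu>" and chi: "0 < chi"
    and s: "1 < s" "chi < s" "(2 * \<alpha> * \<bar>chi - 1\<bar> + 2 * \<mu> * chi) / (2 * \<mu> - chi + 1) \<le> s"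
  shows "env \<alpha> q s * (s * (s - 1) / (A * (1 - chi / s))) \<le> env \<alpha> q (s + 2 * \<alpha>)"
proof -
  have \<alpha>0: "1 \<le> \<alpha>" using \<gamma>_ge0 by (simp add: \<alpha>)
  define d where "d = 2 * \<alpha>"
  have d: "0 < d" using \<alpha>0 by (simp add: d_def)
  have q0: "0 < q" using q \<alpha>0 by simp
  have sq: "0 < sqrt A" "(sqrt A)\<^sup>2 = A" using A_pos by auto
  \<comment> \<open>From ln t \<le> t - 1 at t = s/(s + d).\<close>
  have L: "d / (s + d) \<le> ln (s + d) - ln s"
  proof -
    have "ln (s / (s + d)) \<le> s / (s + d) - 1" by (rule ln_le_minus_one) (use s d in simp)
    moreover have "ln (s / (s + d)) = ln s - ln (s + d)" using s d by (simp add: ln_div)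
    moreover have "s / (s + d) - 1 = - (d / (s + d))" using s d by (simp add: field_simps)
    ultimately show ?thesis by linarith
  qed
  \<comment> \<open>The quotient is 1 + (chi - 1)/(s - chi), and (chi - 1)/(s - chi) \<le> 2
    \<mu>/(s + d) is linear in s; solving for s with 2 \<mu> - chi + 1 > 0 gives the threshold
    assumed on s.\<close>
  have R: "(s - 1) / (s - chi) \<le> exp (2 * \<mu> / (s + d))"
  proof -
    have \<eta>: "0 < 2 * \<mu> - chi + 1" using q by simp
    have "2 * \<alpha> * \<bar>chi - 1\<bar> + 2 * \<mu> * chi \<le> s * (2 * \<mu> - chi + 1)" using s(3) \<eta> by (simp add: pos_divide_le_eq)
    moreover have "2 * \<alpha> * (chi - 1) \<le> 2 * \<alpha> * \<bar>chi - 1\<bar>" using \<alpha>0 by (intro mult_left_mono) auto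
    ultimately have "(chi - 1) * (s + d) \<le> 2 * \<mu> * (s - chi)" by (simp add: d_def algebra_simps)
    then have "(chi - 1) / (s - chi) \<le> 2 * \<mu> / (s + d)" using s d by (simp add: frac_le_eq divide_le_0_iff algebra_simps divide_simps)
    moreover have "(s - 1) / (s - chi) = 1 + (chi - 1) / (s - chi)" using s by (simp add: field_simps)
    moreover have "1 + 2 * \<mu> / (s + d) \<le> exp (2 * \<mu> / (s + d))" by (rule exp_ge_add_one_self)
    ultimately show ?thesis by linarith
  qed
  have E: "s\<^sup>2 / A = exp (2 * ln s - 2 * ln (sqrt A))"
  proof -
    have "exp (2 * ln s - 2 * ln (sqrt A)) = (exp (ln s))\<^sup>2 / (exp (ln (sqrt A)))\<^sup>2"
      by (simp add: exp_diff exp_double[symmetric] power2_eq_square exp_add[symmetric])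
    then show ?thesis using s sq by simp
  qed
  define l l' r where "l = ln s" and "l' = ln (s + d)" and "r = ln (sqrt A)"
  have "s / \<alpha> * (l - 1 - r) + q * l + (2 * l - 2 * r) + 2 * \<mu> / (s + d) \<le> (s + d) / \<alpha> * (l' - 1 - r) + q * l'"
  proof -
    \<comment> \<open>\<open>L\<close> is used twice: with weight (s + d)/\<alpha> it compensates
      the -2 in (d/\<alpha>) (l - 1 - r), and with weight q, where q d = 2 \<mu>, it pays for the
      factor from \<open>R\<close>.\<close>
    have "(s + d) / \<alpha> * (d / (s + d)) \<le> (s + d) / \<alpha> * (l' - l)"
      using L s d \<alpha>0 by (intro mult_left_mono) (auto simp: l_def l'_def)
    moreover have "(s + d) / \<alpha> * (d / (s + d)) = 2"
    proof -
      have "s + d \<noteq> 0" using s d by simp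
      then have "(s + d) / \<alpha> * (d / (s + d)) = d / \<alpha>" by simp
      then show ?thesis using \<alpha>0 by (simp add: d_def)
    qed
    ultimately have 1: "2 \<le> (s + d) / \<alpha> * (l' - l)" by simp
    have "q * (d / (s + d)) \<le> q * (l' - l)" using L q0 by (intro mult_left_mono) (auto simp: l_def l'_def)
    moreover have "q * (d / (s + d)) = 2 * \<mu> / (s + d)"
    proof -
      have "q * d = 2 * \<mu>" using q(1) \<alpha>0 by (simp add: d_def)
      then show ?thesis by (simp only: times_divide_eq_right)
    qed
    ultimately have 2: "2 * \<mu> / (s + d) \<le> q * (l' - l)" by linarith
    have "(s + d) / \<alpha> * (l' - 1 - r) = (s + d) / \<alpha> * (l' - l) + s / \<alpha> * (l - 1 - r) + d / \<alpha> * (l - 1 - r)"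
      using \<alpha>0 by (simp add: field_simps)
    moreover have "d / \<alpha> * (l - 1 - r) = 2 * l - 2 - 2 * r" using \<alpha>0 by (simp add: d_def algebra_simps)
    ultimately show ?thesis using 1 2 by (simp add: right_diff_distrib)
  qed
  then have X: "exp (s / \<alpha> * (l - 1 - r) + q * l) * (exp (2 * l - 2 * r) * exp (2 * \<mu> / (s + d))) \<le> exp ((s + d) / \<alpha> * (l' - 1 - r) + q * l')"
    by (simp add: exp_add[symmetric] add.assoc)
  have "s * (s - 1) / (A * (1 - chi / s)) = s\<^sup>2 / A * ((s - 1) / (s - chi))"
    using s A_pos by (simp add: field_simps power2_eq_square)
  also have "\<dots> \<le> s\<^sup>2 / A * exp (2 * \<mu> / (s + d))" using R A_pos by (intro mult_left_mono) auto
  finally have "env \<alpha> q s * (s * (s - 1) / (A * (1 - chi / s))) \<le> env \<alpha> q s * (s\<^sup>2 / A * exp (2 * \<mu> / (s + d)))"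
    by (rule mult_left_mono) (simp add: env_def)
  also have "\<dots> \<le> env \<alpha> q (s + d)"
    using X unfolding E env_def l_def[symmetric] l'_def[symmetric] r_def[symmetric] .
  finally show ?thesis by (simp add: d_def)
qed

text \<open>Up to powers of s, env(s) x^(-s) is smallest at s = S. Moments are available only at
  spacing 2 \<alpha>, but being within 2 \<alpha> of S costs only the factor e: the loss in the
  exponent is (S - s)^2 / (\<alpha> S), at most 1 since S \<ge> 4 \<alpha>.\<close>

lemma env_at_peak:
  assumes "1 \<le> \<alpha>" "0 < q" "0 < x" and S: "S = sqrt A * x powr \<alpha>" "4 * \<alpha> \<le> S" and s: "0 < s" "s \<le> S" "S - 2 * \<alpha> \<le> s"
  shows "s * env \<alpha> q s * x powr - s \<le> exp 1 * S powr (1 + q) * exp (- S / \<alpha>)"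
proof -
  have S0: "0 < S" using assms by simp
  have "ln S = ln (sqrt A) + \<alpha> * ln x" using A_pos assms(3) by (simp add: S(1) ln_mult ln_powr)
  then have lx: "ln x = (ln S - ln (sqrt A)) / \<alpha>" using assms(1) by simp
  have "ln (s / S) \<le> s / S - 1" by (rule ln_le_minus_one) (use s S0 in simp)
  then have "ln s - ln S \<le> s / S - 1" using s S0 by (simp add: ln_div)
  then have "s * (ln s - ln S) \<le> s * (s / S - 1)" using s by (intro mult_left_mono) auto
  moreover have "s * (s / S - 1) + (S - s) = (S - s)\<^sup>2 / S" using S0 by (simp add: field_simps power2_eq_square)
  moreover have "(S - s)\<^sup>2 / S \<le> \<alpha>"
  proof -
    have "(S - s)\<^sup>2 \<le> (2 * \<alpha>)\<^sup>2" using s by (intro power_mono) auto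
    also have "\<dots> = \<alpha> * (4 * \<alpha>)" by (simp add: power2_eq_square)
    also have "\<dots> \<le> \<alpha> * S" using S(2) assms(1) by (intro mult_left_mono) auto
    finally show ?thesis using S0 by (simp add: pos_divide_le_eq)
  qed
  ultimately have "s * (ln s - ln S - 1) \<le> \<alpha> * (1 - S / \<alpha>)" using assms(1) by (simp add: algebra_simps)
  then have ex: "s / \<alpha> * (ln s - ln S - 1) \<le> 1 - S / \<alpha>" using assms(1) by (simp add: pos_divide_le_eq mult.commute)
  have "s * env \<alpha> q s * x powr - s = s * (exp (q * ln s) * exp (s / \<alpha> * (ln s - 1 - ln (sqrt A)) - s * ln x))"
    using assms(3) by (simp add: env_def exp_add exp_diff powr_def exp_minus divide_inverse)
  also have "exp (q * ln s) = s powr q" using s by (simp add: powr_def)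
  also have "s / \<alpha> * (ln s - 1 - ln (sqrt A)) - s * ln x = s / \<alpha> * (ln s - ln S - 1)"
    unfolding lx using assms(1) by (simp add: field_simps)
  also have "s * (s powr q * exp (s / \<alpha> * (ln s - ln S - 1))) = s powr (1 + q) * exp (s / \<alpha> * (ln s - ln S - 1))"
    using s by (simp add: powr_add)
  also have "\<dots> \<le> S powr (1 + q) * exp (1 - S / \<alpha>)"
    using ex s assms(2) by (intro mult_mono powr_mono2) auto
  also have "\<dots> = exp 1 * S powr (1 + q) * exp (- S / \<alpha>)" by (simp add: exp_diff exp_minus divide_inverse)
  finally show ?thesis .
qed

lemma fixed_point_upper_bound:
  assumes fp: "fixed_point \<phi>" and \<alpha>: "\<alpha> = (\<gamma> + 2) / 2" and chi: "0 < chi"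
    and h: "\<And>m. m0 \<le> m \<Longrightarrow> (NN z. ennreal (z powr m * h z)) \<le> ennreal (chi / m)"
    and \<mu>: "(\<alpha> + chi - 1) / 2 < \<mu>"
  shows "\<exists>\<kappa>>0. \<forall>x\<ge>1. x * \<phi> x \<le> \<kappa> * x powr (1 + \<alpha> + \<mu>) * exp (- sqrt A * x powr \<alpha> / \<alpha>)"
proof -
  note S = src_solD[OF fp]
  have [measurable]: "\<phi> \<in> borel_measurable borel" by (rule S(1))
  have \<alpha>1: "1 \<le> \<alpha>" using \<gamma>_ge0 by (simp add: \<alpha>)
  define q where "q = \<mu> / \<alpha>"
  have \<mu>': "0 < \<mu>" "chi - 1 < 2 * \<mu>" using \<mu> \<alpha>1 chi by (auto simp: field_simps)
  have q: "0 < q" using \<mu>' \<alpha>1 by (simp add: q_def)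
  \<comment> \<open>Large enough for the starting index \<open>s0\<close> to exceed 1, chi, m0 and
    the threshold of \<open>env_step\<close>.\<close>
  define j0 where "j0 = nat \<lceil>\<bar>m0\<bar> + chi + 1 + \<bar>(2 * \<alpha> * \<bar>chi - 1\<bar> + 2 * \<mu> * chi) / (2 * \<mu> - chi + 1)\<bar>\<rceil>"
  \<comment> \<open>One more than 2 + (\<gamma> + 2) j0, the order of the moment bounded by
    \<open>mom_bd j0\<close>.\<close>
  define s0 where "s0 = 3 + 2 * \<alpha> * real j0"
  have "\<bar>m0\<bar> + chi + 1 + \<bar>(2 * \<alpha> * \<bar>chi - 1\<bar> + 2 * \<mu> * chi) / (2 * \<mu> - chi + 1)\<bar> \<le> real j0"
    unfolding j0_def by linarith
  moreover have "real j0 \<le> 2 * \<alpha> * real j0" using \<alpha>1 mult_right_mono[of 1 "2 * \<alpha>" "real j0"] by simp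
  ultimately have s0: "1 < s0" "chi < s0" "m0 \<le> s0" "(2 * \<alpha> * \<bar>chi - 1\<bar> + 2 * \<mu> * chi) / (2 * \<mu> - chi + 1) \<le> s0"
    using chi unfolding s0_def by linarith+
  define s where "s n = s0 + 2 * \<alpha> * real n" for n
  have s_ge: "s0 \<le> s n" for n using \<alpha>1 by (simp add: s_def)
  define C where "C = mom_bd j0 / env \<alpha> q s0"
  have env0: "0 < env \<alpha> q t" for t by (simp add: env_def)
  have C: "0 < C" using mom_bd_pos env0 by (simp add: C_def)
  \<comment> \<open>The index s n is one more than the order of the moment, which is also the decay
    exponent that \<open>antimono_moment_bound\<close> returns. The constant C makes the base case
    an equality.\<close>
  have mom: "Mo (s n - 1) (\<lambda>x. ennreal (\<phi> x)) \<le> ennreal (C * env \<alpha> q (s n))" for n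
  proof (induction n)
    case 0
    have "s 0 - 1 = 2 + (\<gamma> + 2) * real j0" by (simp add: s_def s0_def \<alpha>)
    moreover have "C * env \<alpha> q (s 0) = mom_bd j0" using env0[of s0] by (simp add: C_def s_def)
    ultimately show ?case using src_sol_moments[OF fp, of j0] by simp
  next
    case (Suc n)
    have sn: "1 < s n" "chi < s n" "m0 \<le> s n" "(2 * \<alpha> * \<bar>chi - 1\<bar> + 2 * \<mu> * chi) / (2 * \<mu> - chi + 1) \<le> s n"
      using s0 s_ge[of n] by linarith+
    have W: "(1 - chi / s n) / ((s n - 1) * (s n - 1 + 1)) \<le> Wm (s n - 1)"
      by (rule What_ge) (use sn chi h[OF sn(3)] in auto)
    have W': "0 < (1 - chi / s n) / ((s n - 1) * s n)" using sn chi by (intro divide_pos_pos) auto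
    have "Mo (s n - 1 + \<gamma> + 2) (\<lambda>x. ennreal (\<phi> x)) \<le> ennreal (C * env \<alpha> q (s n) / (A * Wm (s n - 1)))"
      by (rule src_sol_moment_step[OF fp _ Suc]) (use sn in simp)
    also have "\<dots> \<le> ennreal (C * env \<alpha> q (s (Suc n)))"
    proof (rule ennreal_leI)
      have "C * env \<alpha> q (s n) / (A * Wm (s n - 1)) \<le> C * env \<alpha> q (s n) / (A * ((1 - chi / s n) / ((s n - 1) * s n)))"
        using W W' A_pos C env0[of "s n"] by (intro divide_left_mono mult_left_mono mult_pos_pos mult_nonneg_nonneg) auto
      also have "\<dots> = C * (env \<alpha> q (s n) * (s n * (s n - 1) / (A * (1 - chi / s n))))"
        by (simp add: mult_ac)
      also have "\<dots> \<le> C * env \<alpha> q (s n + 2 * \<alpha>)"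
        using C sn by (intro mult_left_mono env_step[OF \<alpha> q_def \<mu>' chi]) auto
      finally show "C * env \<alpha> q (s n) / (A * Wm (s n - 1)) \<le> C * env \<alpha> q (s (Suc n))"
        by (simp add: s_def algebra_simps)
    qed
    also have "s n - 1 + \<gamma> + 2 = s (Suc n) - 1" by (simp add: s_def \<alpha> algebra_simps)
    finally show ?case .
  qed
  have large: "\<phi> x \<le> C * exp 1 * (sqrt A) powr (1 + q) * x powr (\<alpha> + \<mu>) * exp (- sqrt A * x powr \<alpha> / \<alpha>)"
    if x: "0 < x" and big: "s0 + 4 * \<alpha> \<le> sqrt A * x powr \<alpha>" for x
  proof -
    define SS where "SS = sqrt A * x powr \<alpha>"
    \<comment> \<open>The largest n with s n \<le> SS, so s n lies within 2 \<alpha> below the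
      optimal value.\<close>
    define n where "n = nat \<lfloor>(SS - s0) / (2 * \<alpha>)\<rfloor>"
    have "0 \<le> (SS - s0) / (2 * \<alpha>)" using big \<alpha>1 by (simp add: SS_def)
    then have "real n \<le> (SS - s0) / (2 * \<alpha>)" "(SS - s0) / (2 * \<alpha>) < real n + 1" unfolding n_def by linarith+
    then have n: "s n \<le> SS" "SS - 2 * \<alpha> \<le> s n" using \<alpha>1 by (auto simp: s_def field_simps)
    have sn: "1 < s n" using s0 s_ge[of n] by linarith
    have "\<phi> x \<le> (s n - 1 + 1) * (C * env \<alpha> q (s n)) * x powr - (s n - 1 + 1)"
      by (rule antimono_moment_bound) (use S src_sol_antimono[OF fp] mom[of n] C env0[of "s n"] x sn in auto)
    also have "\<dots> = C * (s n * env \<alpha> q (s n) * x powr - s n)" by simp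
    also have "\<dots> \<le> C * (exp 1 * SS powr (1 + q) * exp (- SS / \<alpha>))"
      using C x sn n big s0 \<alpha>1 q by (intro mult_left_mono env_at_peak) (auto simp: SS_def)
    also have "SS powr (1 + q) = (sqrt A) powr (1 + q) * x powr (\<alpha> + \<mu>)"
      using A_pos x \<alpha>1 by (simp add: SS_def powr_mult powr_powr q_def algebra_simps)
    finally show ?thesis by (simp add: SS_def mult_ac)
  qed
  have "filterlim (\<lambda>x. sqrt A * x powr \<alpha>) at_top at_top" using A_pos \<alpha>1 by real_asymp
  then have "\<forall>\<^sub>F x in at_top. s0 + 4 * \<alpha> \<le> sqrt A * x powr \<alpha>" by (auto simp: filterlim_at_top)
  then obtain X0 where X0: "\<And>x. x \<ge> X0 \<Longrightarrow> s0 + 4 * \<alpha> \<le> sqrt A * x powr \<alpha>" by (auto simp: eventually_at_top_linorder)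
  define X1 where "X1 = max X0 1"
  define \<kappa>1 where "\<kappa>1 = C * exp 1 * (sqrt A) powr (1 + q)"
  \<comment> \<open>Covers the compact range [1, X1): there \<phi> \<le> \<phi>(1), and the
    exponential is at least its value at X1.\<close>
  define \<kappa>2 where "\<kappa>2 = \<phi> 1 * exp (sqrt A * X1 powr \<alpha> / \<alpha>)"
  have \<kappa>: "0 < \<kappa>1" "0 \<le> \<kappa>2" using C A_pos S(2) by (auto simp: \<kappa>1_def \<kappa>2_def)
  have "x * \<phi> x \<le> (\<kappa>1 + \<kappa>2) * x powr (1 + \<alpha> + \<mu>) * exp (- sqrt A * x powr \<alpha> / \<alpha>)" if x: "1 \<le> x" for x
  proof -
    define P E where "P = x powr (\<alpha> + \<mu>)" and "E = exp (- sqrt A * x powr \<alpha> / \<alpha>)"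
    have P: "1 \<le> P" using x \<alpha>1 \<mu>' by (simp add: P_def ge_one_powr_ge_zero)
    have E: "0 < E" by (simp add: E_def)
    have "\<phi> x \<le> (\<kappa>1 + \<kappa>2) * (P * E)"
    proof (cases "X1 \<le> x")
      case True
      then have "\<phi> x \<le> \<kappa>1 * (P * E)" using large[of x] X0[of x] x by (simp add: X1_def \<kappa>1_def P_def E_def mult.assoc)
      also have "\<dots> \<le> (\<kappa>1 + \<kappa>2) * (P * E)" using \<kappa> P E by (intro mult_right_mono) auto
      finally show ?thesis .
    next
      case False
      have "x powr \<alpha> \<le> X1 powr \<alpha>" using False x \<alpha>1 by (intro powr_mono2) auto
      then have "sqrt A * x powr \<alpha> / \<alpha> \<le> sqrt A * X1 powr \<alpha> / \<alpha>" using A_pos \<alpha>1 by (intro divide_right_mono mult_left_mono) auto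
      then have "1 \<le> exp (sqrt A * X1 powr \<alpha> / \<alpha>) * E"
        unfolding E_def exp_add[symmetric] by simp
      then have "1 * 1 \<le> P * (exp (sqrt A * X1 powr \<alpha> / \<alpha>) * E)" using P by (intro mult_mono) auto
      then have "\<phi> 1 * 1 \<le> \<phi> 1 * (P * (exp (sqrt A * X1 powr \<alpha> / \<alpha>) * E))" using S(2)[of 1] by (intro mult_left_mono) auto
      moreover have "\<phi> x \<le> \<phi> 1" using src_sol_antimono[OF fp, of 1 x] x by simp
      ultimately have "\<phi> x \<le> \<kappa>2 * (P * E)" by (simp add: \<kappa>2_def mult_ac)
      also have "\<dots> \<le> (\<kappa>1 + \<kappa>2) * (P * E)" using \<kappa> P E by (intro mult_right_mono) auto
      finally show ?thesis .
    qed
    then have "x * \<phi> x \<le> x * ((\<kappa>1 + \<kappa>2) * (P * E))" using x by (intro mult_left_mono) auto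
    also have "\<dots> = (\<kappa>1 + \<kappa>2) * (x powr 1 * P) * E" using x by (simp add: mult_ac)
    also have "x powr 1 * P = x powr (1 + \<alpha> + \<mu>)" by (simp only: P_def powr_add add.assoc)
    finally show ?thesis by (simp add: E_def)
  qed
  then show ?thesis using \<kappa> by (intro exI[of _ "\<kappa>1 + \<kappa>2"]) auto
qed

end

section \<open>Behaviour at zero\<close>

lemma rapid0_moment_integrable:
  fixes u :: "real \<Rightarrow> real"
  assumes u: "rapid0 u" "\<And>s. s \<le> 0 \<Longrightarrow> u s = 0" and C: "\<And>s. 0 < s \<Longrightarrow> s \<le> 1 \<Longrightarrow> \<bar>u s\<bar> \<le> C" and p: "-1 < p"
  shows "integrable lborel (\<lambda>s. s powr p * u s)"
proof -
  obtain D where D: "0 \<le> D" "\<And>s. s \<ge> 1 \<Longrightarrow> \<bar>s powr p * u s\<bar> \<le> D * s powr - 2"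
    using rapid0_bound'[OF rapid0_powr[OF u(1)], of 1 p 2] by auto
  have C0: "0 \<le> C" using C[of 1] by simp
  have m: "(\<lambda>s. s powr p * u s) \<in> borel_measurable lborel"
  proof -
    have "(\<lambda>s. if 0 < s then s powr p * u s else 0) \<in> borel_measurable borel"
      using rapid0_powr[OF u(1), of p] by (intro borel_measurable_zero_ext) (simp add: rapid0_def)
    also have "(\<lambda>s. if 0 < s then s powr p * u s else 0) = (\<lambda>s. s powr p * u s)" using u(2) by (auto simp: fun_eq_iff)
    finally show ?thesis by simp
  qed
  have "(NN s. indicator {0..1} s * ennreal (s powr p)) < top"
    using p by (subst nn_integral_powr_from_0) auto
  then have i1: "integrable lborel (\<lambda>s::real. indicator {0..1} s * s powr p)"
    by (intro integrableI_nonneg) (auto simp: ennreal_mult' ennreal_indicator)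
  have "(NN s. indicator {1..} s * ennreal (s powr - 2)) < top"
    by (subst nn_integral_powr_to_inf) auto
  then have i2: "integrable lborel (\<lambda>s::real. indicator {1..} s * s powr - 2)"
    by (intro integrableI_nonneg) (auto simp: ennreal_mult' ennreal_indicator)
  have "integrable lborel (\<lambda>s. C * (indicator {0..1} s * s powr p) + D * (indicator {1..} s * s powr - 2))"
    using i1 i2 by auto
  then show ?thesis
  proof (rule Bochner_Integration.integrable_bound[OF _ m AE_I2])
    fix s
    have n: "0 \<le> C * (indicator {0..1} s * s powr p)" "0 \<le> D * (indicator {1..} s * s powr - 2)" using C0 D(1) by auto
    have "norm (s powr p * u s) \<le> C * (indicator {0..1} s * s powr p) + D * (indicator {1..} s * s powr - 2)"
    proof -
      consider "s \<le> 0" | "0 < s" "s \<le> 1" | "1 < s" by linarith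
      then show ?thesis
      proof cases
        case 2
        have "norm (s powr p * u s) \<le> C * s powr p"
          using mult_right_mono[OF C[OF 2], of "s powr p"] by (simp add: abs_mult mult.commute)
        then show ?thesis using 2 n(2) by (simp add: add_increasing2)
      next
        case 3
        then show ?thesis using D(2)[of s] n(1) by (simp add: add_increasing)
      qed (use u(2) n in auto)
    qed
    then show "norm (s powr p * u s) \<le> norm (C * (indicator {0..1} s * s powr p) + D * (indicator {1..} s * s powr - 2))"
      by (rule order_trans) simp
  qed
qed

section \<open>The kernel \<open>W\<close> near zero\<close>

context daughter_kernel
begin

lemma W_deriv:
  assumes "0 < t" "t < 1"
  shows "(W has_real_derivative - (H t / t\<^sup>2)) (at t)"
proof -
  define a where "a = t / 2"
  have a: "0 < a" "a < t" using assms by (auto simp: a_def)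
  have c: "continuous_on {a..1} (\<lambda>r. H r / r\<^sup>2)"
    using a by (intro continuous_intros continuous_on_H) auto
  have si: "set_integrable lborel {a<..<1} (\<lambda>r. H r / r\<^sup>2)"
    using W_integrand_integrable[OF a(1)] by (simp add: set_integrable_def)
  have eq: "W y = W a - integral {a..y} (\<lambda>r. H r / r\<^sup>2)" if y: "y \<in> {a<..<1}" for y
  proof -
    have "W a = (LINT r:{a<..y} \<union> {y<..<1}|lborel. H r / r\<^sup>2)"
      unfolding W_eq[OF a(1)] set_lebesgue_integral_def using y
      by (intro Bochner_Integration.integral_cong) (auto split: split_indicator)
    also have "\<dots> = (LINT r:{a<..y}|lborel. H r / r\<^sup>2) + (LINT r:{y<..<1}|lborel. H r / r\<^sup>2)"
      by (rule set_integral_Un) (use y in \<open>auto intro: set_integrable_subset[OF si]\<close>)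
    also have "(LINT r:{a<..y}|lborel. H r / r\<^sup>2) = integral {a<..y} (\<lambda>r. H r / r\<^sup>2)"
      by (intro set_borel_integral_eq_integral set_integrable_subset[OF si]) (use y in auto)
    also have "\<dots> = integral {a..y} (\<lambda>r. H r / r\<^sup>2)"
      by (rule integral_subset_negligible) (auto intro: negligible_subset[of "{a}"])
    also have "(LINT r:{y<..<1}|lborel. H r / r\<^sup>2) = W y"
      using y a by (subst W_eq) (auto simp: set_lebesgue_integral_def)
    finally show ?thesis by simp
  qed
  have "((\<lambda>y. integral {a..y} (\<lambda>r. H r / r\<^sup>2)) has_real_derivative H t / t\<^sup>2) (at t within {a..1})"
    by (rule integral_has_real_derivative[OF c]) (use a assms in auto)
  then have "((\<lambda>y. integral {a..y} (\<lambda>r. H r / r\<^sup>2)) has_real_derivative H t / t\<^sup>2) (at t)"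
    using a assms by (simp add: at_within_Icc_at)
  then have "((\<lambda>y. W a - integral {a..y} (\<lambda>r. H r / r\<^sup>2)) has_real_derivative - (H t / t\<^sup>2)) (at t)"
    by (auto intro!: derivative_eq_intros)
  then show ?thesis
    by (rule has_field_derivative_transform_within_open[of _ _ _ "{a<..<1}"]) (use a assms eq in auto)
qed

text \<open>Fubini, with the inner integral of 1/r^2 over r from max t z to 1. As t decreases to 0
  the factor z (1 / max t z - 1) increases to 1 - z, so boundedness of \<open>W\<close> near 0 is
  integrability of \<open>h\<close>.\<close>

lemma ennreal_W_eq:
  assumes t: "0 < t" "t < 1"
  shows "ennreal (W t) = (NN z. ennreal (z * h z * (1 / max t z - 1)))"
proof -
  have "ennreal (W t) = (NN r. NN z. indicator {t<..<1} r * (ennreal (1 / r\<^sup>2) * ((if z < r then 1 else 0) * ennreal (z * h z))))"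
    unfolding ennreal_W[OF t(1)]
  proof (rule nn_integral_cong)
    fix r
    have "indicator {t<..<1} r * ennreal (H r / r\<^sup>2) = indicator {t<..<1} r * ennreal (1 / r\<^sup>2) * ennreal (H r)"
      using ennreal_mult'[of "1 / r\<^sup>2" "H r"] by (simp add: mult.assoc)
    also have "\<dots> = (NN z. indicator {t<..<1} r * ennreal (1 / r\<^sup>2) * (indicator {..<r} z * ennreal (z * h z)))"
      unfolding ennreal_H by (rule nn_integral_cmult[symmetric]) measurable
    also have "\<dots> = (NN z. indicator {t<..<1} r * (ennreal (1 / r\<^sup>2) * ((if z < r then 1 else 0) * ennreal (z * h z))))"
      by (intro nn_integral_cong) (auto simp: mult.assoc split: split_indicator)
    finally show "indicator {t<..<1} r * ennreal (H r / r\<^sup>2) = (NN z. indicator {t<..<1} r * (ennreal (1 / r\<^sup>2) * ((if z < r then 1 else 0) * ennreal (z * h z))))" .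
  qed
  also have "\<dots> = (NN z. NN r. indicator {t<..<1} r * (ennreal (1 / r\<^sup>2) * ((if z < r then 1 else 0) * ennreal (z * h z))))"
    by (rule lborel_pair.Fubini') measurable
  also have "\<dots> = (NN z. ennreal (z * h z * (1 / max t z - 1)))"
  proof (rule nn_integral_cong)
    fix z
    show "(NN r. indicator {t<..<1} r * (ennreal (1 / r\<^sup>2) * ((if z < r then 1 else 0) * ennreal (z * h z)))) = ennreal (z * h z * (1 / max t z - 1))"
    proof (cases "z \<in> {0<..<1}")
      case True
      define M where "M = max t z"
      have M: "0 < M" "M \<le> 1" using True t by (auto simp: M_def)
      have "(NN r. indicator {t<..<1} r * (ennreal (1 / r\<^sup>2) * ((if z < r then 1 else 0) * ennreal (z * h z))))
        = (NN r. ennreal (z * h z) * ennreal (indicator {M<..<1} r * (1 / r\<^sup>2)))"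
        by (intro nn_integral_cong) (auto split: split_indicator simp: M_def mult.commute)
      also have "\<dots> = ennreal (z * h z) * (NN r. ennreal (indicator {M<..<1} r * (1 / r\<^sup>2)))"
        by (rule nn_integral_cmult) measurable
      also have "(NN r. ennreal (indicator {M<..<1} r * (1 / r\<^sup>2))) = ennreal (1 / M - 1)"
        using nn_integral_eq_integral[OF integral_inverse_square(1)[OF M]] integral_inverse_square(2)[OF M] by simp
      also have "ennreal (z * h z) * ennreal (1 / M - 1) = ennreal (z * h z * (1 / M - 1))"
        by (rule ennreal_mult'[symmetric, OF zh_ge0])
      finally show ?thesis by (simp add: M_def)
    qed (simp add: h_out)
  qed
  finally show ?thesis .
qed

lemma W_bounded:
  assumes "integrable lborel h" "0 < t"
  shows "W t \<le> (LBINT z. h z)"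
proof (cases "t < 1")
  case True
  have h0: "0 \<le> (LBINT z. h z)" using h_ge0 by (intro integral_nonneg_AE) auto
  have "ennreal (W t) \<le> (NN z. ennreal (h z))"
    unfolding ennreal_W_eq[OF assms(2) True]
  proof (intro nn_integral_mono ennreal_leI)
    fix z
    show "z * h z * (1 / max t z - 1) \<le> h z"
    proof (cases "z \<in> {0<..<1}")
      case True
      have "1 / max t z \<le> 1 / z" using True assms(2) by (intro divide_left_mono mult_pos_pos) auto
      then have "1 / max t z - 1 \<le> 1 / z" by linarith
      then have "z * h z * (1 / max t z - 1) \<le> z * h z * (1 / z)" using zh_ge0 by (intro mult_left_mono) auto
      then show ?thesis using True by simp
    qed (simp add: h_out)
  qed
  also have "\<dots> = ennreal (LBINT z. h z)" using assms(1) h_ge0 by (intro nn_integral_eq_integral) auto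
  finally show ?thesis using h0 by (simp add: ennreal_le_iff)
next
  case False
  have "0 \<le> (LBINT z. h z)" using h_ge0 by (intro integral_nonneg_AE) auto
  then show ?thesis using False W_out[of t] by simp
qed

text \<open>On z > t the formula of \<open>ennreal_W_eq\<close> returns h(z) - z h(z). A bound B on
  \<open>W\<close> would therefore bound the integral of \<open>h\<close> over z > t by B + 1 for
  every t, and monotone convergence would make \<open>h\<close> integrable.\<close>

lemma W_unbounded:
  assumes "\<not> integrable lborel h" shows "filterlim W at_top (at_right 0)"
proof -
  have "\<exists>t. 0 < t \<and> t < 1 \<and> B < W t" for B
  proof (rule ccontr)
    assume "\<not> (\<exists>t. 0 < t \<and> t < 1 \<and> B < W t)"
    then have B: "W t \<le> B" if "0 < t" "t < 1" for t using that by (meson not_le)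
    have "0 \<le> B" using B[of "1/2"] W_ge0[of "1/2"] by simp
    \<comment> \<open>Any sequence in (0,1) decreasing to 0 would do; the 2 keeps t 0 below
      1.\<close>
    define t where "t n = 1 / (real n + 2)" for n
    have t: "0 < t n" "t n < 1" for n by (auto simp: t_def)
    have "(NN z. indicator {t n<..} z * ennreal (h z)) \<le> ennreal (B + 1)" for n
    proof -
      have "(NN z. indicator {t n<..} z * ennreal (h z)) \<le> (NN z. ennreal (z * h z * (1 / max (t n) z - 1)) + ennreal (z * h z))"
      proof (rule nn_integral_mono)
        fix z
        show "indicator {t n<..} z * ennreal (h z) \<le> ennreal (z * h z * (1 / max (t n) z - 1)) + ennreal (z * h z)"
        proof (cases "t n < z \<and> z < 1")
          case True
          then have z: "0 < z" using t(1)[of n] by linarith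
          have "ennreal (z * h z * (1 / max (t n) z - 1)) + ennreal (z * h z) = ennreal (z * h z * (1 / max (t n) z - 1) + z * h z)"
            using True z h_ge0[of z] by (intro ennreal_plus[symmetric] mult_nonneg_nonneg) (auto simp: max_def divide_simps)
          also have "z * h z * (1 / max (t n) z - 1) + z * h z = h z" using True z by (simp add: max_def field_simps)
          finally show ?thesis using True by simp
        next
          case False
          then show ?thesis using h_out[of z] t(1)[of n] by (cases "t n < z") auto
        qed
      qed
      also have "\<dots> = ennreal (W (t n)) + 1"
        by (subst nn_integral_add) (auto simp: ennreal_W_eq[OF t] h_mass)
      also have "\<dots> \<le> ennreal B + 1" using B[OF t] by (intro add_right_mono ennreal_leI)
      also have "\<dots> = ennreal (B + 1)" using \<open>0 \<le> B\<close> by (subst ennreal_plus) auto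
      finally show ?thesis .
    qed
    then have le: "(SUP n. NN z. indicator {t n<..} z * ennreal (h z)) \<le> ennreal (B + 1)" by (rule SUP_least)
    have "(NN z. ennreal (h z)) = (NN z. (SUP n. indicator {t n<..} z * ennreal (h z)))"
    proof (rule nn_integral_cong)
      fix z
      show "ennreal (h z) = (SUP n. indicator {t n<..} z * ennreal (h z))"
      proof (cases "0 < z")
        case True
        obtain n where "1 / z < real n" using reals_Archimedean2 by blast
        then have "1 < real n * z" using True by (simp add: pos_divide_less_eq)
        then have "1 < z * (real n + 2)" using True by (simp add: algebra_simps)
        then have "t n < z" by (simp add: t_def divide_less_eq)
        then have "ennreal (h z) \<le> (SUP n. indicator {t n<..} z * ennreal (h z))" by (intro SUP_upper2[of n]) auto
        moreover have "(SUP n. indicator {t n<..} z * ennreal (h z)) \<le> ennreal (h z)"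
          by (intro SUP_least) (auto split: split_indicator)
        ultimately show ?thesis by (rule antisym)
      qed (simp add: h_out)
    qed
    also have "\<dots> = (SUP n. NN z. indicator {t n<..} z * ennreal (h z))"
    proof (rule nn_integral_monotone_convergence_SUP)
      have "t (Suc n) \<le> t n" for n by (simp add: t_def frac_le)
      then show "incseq (\<lambda>n z. indicator {t n<..} z * ennreal (h z))"
        by (intro incseq_SucI le_funI) (auto split: split_indicator intro: order_le_less_trans)
    qed measurable
    also have "\<dots> < top" using le ennreal_less_top le_less_trans by blast
    finally have "integrable lborel h" using h_ge0 by (intro integrableI_nonneg) auto
    then show False using assms by simp
  qed
  then have ex: "\<And>B. \<exists>t. 0 < t \<and> t < 1 \<and> B < W t" by blast
  show ?thesis
    unfolding filterlim_at_top eventually_at_right_field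
  proof
    fix Z
    obtain t where t: "0 < t" "Z < W t" using ex by blast
    have "Z \<le> W y" if "0 < y" "y < t" for y using W_antimono[of y t] that t by simp
    then show "\<exists>b>0. \<forall>y>0. y < b \<longrightarrow> Z \<le> W y" using t(1) by blast
  qed
qed

text \<open>The quotient of the derivatives is s H(z/s) / H(z), with limit s^(1 + lam) by the
  hypothesis on \<open>H\<close>; \<open>Hp\<close> keeps the denominator nonzero.\<close>

lemma W_ratio_tendsto:
  assumes W: "filterlim W at_top (at_right 0)" and Hp: "\<And>t. 0 < t \<Longrightarrow> 0 < H t" and s: "0 < s"
    and H: "((\<lambda>z. H (z / s) / (s powr lam * H z)) \<longlongrightarrow> 1) (at_right 0)"
  shows "((\<lambda>z. W (z / s) / W z) \<longlongrightarrow> s powr (1 + lam)) (at_right 0)"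
proof (rule lhopital_right_0_at_top[OF W])
  have e: "\<forall>\<^sub>F z in at_right 0. 0 < z \<and> z < 1 \<and> z < s"
    unfolding eventually_at_right_field using s by (intro exI[of _ "min 1 s"]) auto
  show "\<forall>\<^sub>F z in at_right 0. - (H z / z\<^sup>2) \<noteq> 0"
    using e by eventually_elim (use Hp in force)
  show "\<forall>\<^sub>F z in at_right 0. (W has_real_derivative - (H z / z\<^sup>2)) (at z)"
    using e by eventually_elim (auto intro: W_deriv)
  show "\<forall>\<^sub>F z in at_right 0. ((\<lambda>z. W (z / s)) has_real_derivative - (H (z / s) / (z / s)\<^sup>2) * (1 / s)) (at z)"
    using e
  proof eventually_elim
    case (elim z)
    show ?case
      by (rule DERIV_chain2[OF W_deriv]) (use elim s in \<open>auto intro!: derivative_eq_intros\<close>)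
  qed
  have "((\<lambda>z. s powr (1 + lam) * (H (z / s) / (s powr lam * H z))) \<longlongrightarrow> s powr (1 + lam) * 1) (at_right 0)"
    by (intro tendsto_intros H)
  moreover have "\<forall>\<^sub>F z in at_right 0. s powr (1 + lam) * (H (z / s) / (s powr lam * H z)) = (- (H (z / s) / (z / s)\<^sup>2) * (1 / s)) / (- (H z / z\<^sup>2))"
    using e
  proof eventually_elim
    case (elim z)
    have "H z \<noteq> 0" using Hp[of z] elim by simp
    then show ?case using elim s by (simp add: powr_add power2_eq_square field_simps)
  qed
  ultimately show "((\<lambda>z. (- (H (z / s) / (z / s)\<^sup>2) * (1 / s)) / (- (H z / z\<^sup>2))) \<longlongrightarrow> s powr (1 + lam)) (at_right 0)"
    by (auto elim: Lim_transform_eventually)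
qed

end

section \<open>Fixed points near zero\<close>

context fragmentation
begin

lemma fp_bound_near_0:
  assumes "fixed_point \<phi>" "0 < s"
  shows "s * \<phi> s \<le> D0" "s \<le> 1 \<Longrightarrow> loss \<phi> s \<le> A * D0"
proof -
  show 1: "s * \<phi> s \<le> D0" using src_sol_le_D0[OF assms] assms(2) by (simp add: pos_le_divide_eq mult.commute)
  assume s: "s \<le> 1"
  have "loss \<phi> s = A * (s powr \<gamma> * (s * \<phi> s))" using assms(2) by (simp add: loss_def powr_add)
  also have "\<dots> \<le> A * (1 * D0)"
    using 1 A_pos \<gamma>_ge0 s assms(2) src_solD(2)[OF assms(1)] by (intro mult_left_mono mult_mono) (auto simp: powr_le1)
  finally show "loss \<phi> s \<le> A * D0" by simp
qed

lemma fp_moment_integrable: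
  assumes "fixed_point \<phi>" "-1 < p"
  shows "integrable lborel (\<lambda>s. s powr p * (s * \<phi> s))" "integrable lborel (\<lambda>s. s powr p * loss \<phi> s)"
proof -
  note S = src_solD[OF assms(1)]
  have r: "rapid0 (\<lambda>s. s * \<phi> s)"
    by (rule rapid0_cong[OF _ rapid0_powr[OF fp_rapid0[OF assms(1)], of 1]]) simp
  show "integrable lborel (\<lambda>s. s powr p * (s * \<phi> s))"
    by (rule rapid0_moment_integrable[OF r _ _ assms(2), of D0]) (use fp_bound_near_0[OF assms(1)] S in auto)
  show "integrable lborel (\<lambda>s. s powr p * loss \<phi> s)"
    by (rule rapid0_moment_integrable[OF fp_loss(4)[OF assms(1)] _ _ assms(2), of "A * D0"])
      (use fp_bound_near_0[OF assms(1)] fp_loss[OF assms(1)] in auto)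
qed

lemma fp_nonzero:
  assumes "fixed_point \<phi>" obtains x where "0 < x" "0 < \<phi> x"
proof -
  note S = src_solD[OF assms]
  have "\<exists>x. \<phi> x \<noteq> 0"
  proof (rule ccontr)
    assume "\<nexists>x. \<phi> x \<noteq> 0"
    then have "Mo 2 (\<lambda>x. ennreal (\<phi> x)) = 0" by (simp add: Mo_def)
    then show False using S(6) by simp
  qed
  then obtain x where x: "\<phi> x \<noteq> 0" by blast
  then have "0 < x" using S(3)[of x] by (cases "x \<le> 0") auto
  then show ?thesis using that[of x] x S(2)[of x] by simp
qed

text \<open>With \<open>h\<close> integrable \<open>W\<close> is bounded, hence so is \<phi>. An
  antitone bounded function converges at 0 to its supremum l, which is positive because \<phi> is
  not zero.\<close>

lemma fp_small_size_integrable: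
  assumes fp: "fixed_point \<phi>" and h: "integrable lborel h"
  shows "\<exists>l>0. ((\<lambda>z. (z * \<phi> z) / (l * z)) \<longlongrightarrow> 1) (at_right 0)"
proof -
  note S = src_solD[OF fp]
  define B where "B = (LBINT z. h z) * (LBINT s. loss \<phi> s)"
  have li: "integrable lborel (loss \<phi>)"
  proof -
    have "(\<lambda>s. s powr 0 * loss \<phi> s) = loss \<phi>" using fp_loss(3)[OF fp] by (auto simp: fun_eq_iff)
    then show ?thesis using fp_moment_integrable(2)[OF fp, of 0] by simp
  qed
  have bd: "\<phi> x \<le> B" if x: "0 < x" for x
  proof -
    have "\<phi> x = (LBINT s. loss \<phi> s * W (x / s))" by (rule fp_T_real(2)[OF fp])
    also have "\<dots> \<le> (LBINT s. loss \<phi> s * (LBINT z. h z))"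
    proof (rule integral_mono[OF fp_T_real(1)[OF fp]])
      show "loss \<phi> s * W (x / s) \<le> loss \<phi> s * (LBINT z. h z)" for s
        using W_bounded[OF h, of "x / s"] x fp_loss(2,3)[OF fp, of s]
        by (cases "0 < s") (auto intro: mult_left_mono)
    qed (use li in auto)
    also have "\<dots> = B" by (simp add: B_def)
    finally show ?thesis .
  qed
  define l where "l = (SUP x\<in>{0<..}. \<phi> x)"
  have bdd: "bdd_above (\<phi> ` {0<..})" using bd by (auto intro!: bdd_aboveI[of _ B])
  have up: "\<phi> x \<le> l" if "0 < x" for x unfolding l_def by (rule cSUP_upper[OF _ bdd]) (use that in simp)
  obtain x0 where x0: "0 < x0" "0 < \<phi> x0" by (rule fp_nonzero[OF fp])
  have l: "0 < l" using up[OF x0(1)] x0(2) by simp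
  have lim: "(\<phi> \<longlongrightarrow> l) (at_right 0)"
  proof (rule order_tendstoI)
    fix a assume "a < l"
    then obtain x where x: "0 < x" "a < \<phi> x" unfolding l_def using less_cSUP_iff[OF _ bdd] by auto
    then show "\<forall>\<^sub>F z in at_right 0. a < \<phi> z"
      unfolding eventually_at_right_field using src_sol_antimono[OF fp, of _ x]
      by (intro exI[of _ x]) (auto intro: less_le_trans)
  next
    fix a assume "l < a"
    then show "\<forall>\<^sub>F z in at_right 0. \<phi> z < a"
      unfolding eventually_at_right_field using up by (intro exI[of _ 1]) (auto intro: le_less_trans)
  qed
  have "((\<lambda>z. \<phi> z / l) \<longlongrightarrow> l / l) (at_right 0)" by (intro tendsto_intros lim) (use l in simp)
  then have "((\<lambda>z. \<phi> z / l) \<longlongrightarrow> 1) (at_right 0)" using l by simp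
  then have "((\<lambda>z. (z * \<phi> z) / (l * z)) \<longlongrightarrow> 1) (at_right 0)"
  proof (rule Lim_transform_eventually)
    show "\<forall>\<^sub>F z in at_right 0. \<phi> z / l = z * \<phi> z / (l * z)"
      using eventually_at_right_less[of "0::real"] by eventually_elim simp
  qed
  then show ?thesis using l by blast
qed

lemma fp_small_size_nonintegrable:
  assumes fp: "fixed_point \<phi>" and h: "\<not> integrable lborel h" and lam: "-1 \<le> lam"
    and H1: "\<And>y. 0 < y \<Longrightarrow> ((\<lambda>z. H (z / y) / (y powr lam * H z)) \<longlongrightarrow> 1) (at_right 0)"
    and H2: "\<And>z y. 0 < z \<Longrightarrow> z < 1 \<Longrightarrow> z < y \<Longrightarrow> H (z / y) \<le> y powr lam * (y + 1) * H z"
  shows "((\<lambda>z. (z * \<phi> z) / ((LBINT s. s powr (1 + lam) * loss \<phi> s) * z * W z)) \<longlongrightarrow> 1) (at_right 0)"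
proof -
  note S = src_solD[OF fp] and L = fp_loss[OF fp]
  have [measurable]: "loss \<phi> \<in> borel_measurable borel" by (rule L(1))
  note Wtop = W_unbounded[OF h]
  \<comment> \<open>If \<open>H\<close> vanished up to t, its integral would add nothing below t and
    \<open>W\<close> would stay at most W t near 0, against \<open>W_unbounded\<close>.\<close>
  have Hp: "0 < H t" if t: "0 < t" for t
  proof (rule ccontr)
    assume "\<not> 0 < H t"
    then have H0: "H r = 0" if "r \<le> t" for r using H_mono[OF that] H_ge0[of r] by linarith
    have t1: "t < 1" using H0[of 1] H_eq1[of 1] by (cases "t < 1") auto
    have "W z \<le> W t" if z: "0 < z" "z < t" for z
      unfolding W_eq[OF z(1)] W_eq[OF t]
      by (rule integral_mono[OF W_integrand_integrable[OF z(1)] W_integrand_integrable[OF t]])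
        (use z t H0 H_ge0 in \<open>auto split: split_indicator\<close>)
    moreover have "\<forall>\<^sub>F z in at_right 0. W t + 1 \<le> W z" using Wtop by (auto simp: filterlim_at_top)
    then obtain b where "0 < b" "\<And>y. 0 < y \<Longrightarrow> y < b \<Longrightarrow> W t + 1 \<le> W y" by (auto simp: eventually_at_right_field)
    define y where "y = min b t / 2"
    have "0 < y" "y < b" "y < t" using \<open>0 < b\<close> t by (auto simp: y_def)
    ultimately show False using \<open>\<And>y. 0 < y \<Longrightarrow> y < b \<Longrightarrow> W t + 1 \<le> W y\<close>[of y] by fastforce
  qed
  define \<Lambda> where "\<Lambda> = (LBINT s. s powr (1 + lam) * loss \<phi> s)"
  \<comment> \<open>Majorant of \<open>loss \<phi> s\<close> W(z/s) / W(z) for z < 1/2: divide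
    \<open>Wbound\<close> by W z, use W z \<ge> W(1/2), and expand the factor s + 1.\<close>
  define G where "G s = s powr (1 + lam) * loss \<phi> s + s powr (2 + lam) * loss \<phi> s + 1 / W (1 / 2) * (s powr 1 * loss \<phi> s)" for s
  have Wh: "0 < W (1/2)" by (rule W_pos) auto
  have Gi: "integrable lborel G" unfolding G_def[abs_def]
    using lam by (intro Bochner_Integration.integrable_add integrable_mult_right fp_moment_integrable(2)[OF fp]) auto
  \<comment> \<open>For y < 1 the assumed growth bound on \<open>H\<close> applies. It says nothing
    for y \<ge> 1, where H \<le> 1 is used; the integral of y^(-2) over [1,\<infinity>) is 1 and
    yields the extra term s.\<close>
  have Wbound: "W (z / s) \<le> s powr (1 + lam) * (s + 1) * W z + s" if z: "0 < z" "z < 1" and s: "0 < s" for z s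
  proof -
    have "ennreal (W (z / s) / s) = (NN y. indicator {z<..} y * (if y < s then 1 else 0) * ennreal (H (y / s) / y\<^sup>2))"
      by (rule nn_integral_H_over_square[symmetric]) (use z s in auto)
    also have "\<dots> \<le> (NN y. ennreal (s powr lam * (s + 1)) * (indicator {z<..<1} y * ennreal (H y / y\<^sup>2)) + indicator {1..} y * ennreal (y powr - 2))"
    proof (rule nn_integral_mono)
      fix y
      show "indicator {z<..} y * (if y < s then 1 else 0) * ennreal (H (y / s) / y\<^sup>2)
        \<le> ennreal (s powr lam * (s + 1)) * (indicator {z<..<1} y * ennreal (H y / y\<^sup>2)) + indicator {1..} y * ennreal (y powr - 2)"
      proof (cases "z < y \<and> y < s")
        case True
        then have y: "0 < y" using z by simp
        show ?thesis
        proof (cases "y < 1")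
          case y1: True
          have "H (y / s) / y\<^sup>2 \<le> s powr lam * (s + 1) * H y / y\<^sup>2" using H2[OF y y1] True by (intro divide_right_mono) auto
          then have "ennreal (H (y / s) / y\<^sup>2) \<le> ennreal (s powr lam * (s + 1) * (H y / y\<^sup>2))" by (intro ennreal_leI) simp
          also have "\<dots> = ennreal (s powr lam * (s + 1)) * ennreal (H y / y\<^sup>2)" using s by (intro ennreal_mult') auto
          finally show ?thesis using True y1 by simp
        next
          case False
          have "H (y / s) / y\<^sup>2 \<le> y powr - 2" using H_le1 y by (simp add: powr_minus_divide powr_numeral divide_right_mono)
          then show ?thesis using True False by (simp add: ennreal_leI)
        qed
      qed auto
    qed
    also have "\<dots> = ennreal (s powr lam * (s + 1)) * ennreal (W z) + 1"
    proof -
      have "(NN y. indicator {1..} y * ennreal (y powr - 2)) = 1" by (subst nn_integral_powr_to_inf) auto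
      then show ?thesis by (subst nn_integral_add) (auto simp: nn_integral_cmult ennreal_W[OF z(1)])
    qed
    also have "\<dots> = ennreal (s powr lam * (s + 1) * W z + 1)"
      using s W_ge0[of z] by (simp add: ennreal_mult'[symmetric])
    finally have "W (z / s) / s \<le> s powr lam * (s + 1) * W z + 1"
      using s W_ge0[of z] by (subst (asm) ennreal_le_iff) auto
    then have "W (z / s) \<le> s * (s powr lam * (s + 1) * W z + 1)" using s by (simp add: pos_divide_le_eq mult.commute)
    also have "\<dots> = s powr (1 + lam) * (s + 1) * W z + s" using s by (simp add: powr_add algebra_simps)
    finally show ?thesis .
  qed
  have lim: "((\<lambda>z. \<phi> z / W z) \<longlongrightarrow> \<Lambda>) (at_right 0)"
    unfolding tendsto_at_iff_sequentially
  proof (intro allI impI)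
    fix X :: "nat \<Rightarrow> real" assume X00: "\<forall>i. X i \<in> {0<..} - {0}" and X: "X \<longlonglongrightarrow> 0"
    then have X0: "0 < X i" for i by auto
    have "\<forall>\<^sub>F n in sequentially. X n < 1/2" using X by (rule order_tendstoD) simp
    then obtain N where N: "\<And>n. N \<le> n \<Longrightarrow> X n < 1/2" by (auto simp: eventually_sequentially)
    define Y where "Y n = X (n + N)" for n
    have Y: "0 < Y n" "Y n < 1/2" for n using X0 N by (auto simp: Y_def)
    have Ylim: "filterlim Y (at_right 0) sequentially"
      unfolding filterlim_at Y_def using LIMSEQ_ignore_initial_segment[OF X, of N] X0
      by (auto intro!: always_eventually simp: less_imp_neq[symmetric])
    have "(\<lambda>n. LBINT s. loss \<phi> s * W (Y n / s) / W (Y n)) \<longlonglongrightarrow> \<Lambda>"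
      unfolding \<Lambda>_def
    proof (rule integral_dominated_convergence[OF _ _ Gi])
      show "AE s in lborel. (\<lambda>n. loss \<phi> s * W (Y n / s) / W (Y n)) \<longlonglongrightarrow> s powr (1 + lam) * loss \<phi> s"
      proof (rule AE_I2)
        fix s
        show "(\<lambda>n. loss \<phi> s * W (Y n / s) / W (Y n)) \<longlonglongrightarrow> s powr (1 + lam) * loss \<phi> s"
        proof (cases "0 < s")
          case True
          have "(\<lambda>n. W (Y n / s) / W (Y n)) \<longlonglongrightarrow> s powr (1 + lam)"
            by (rule filterlim_compose[OF W_ratio_tendsto[OF Wtop Hp True H1[OF True]] Ylim])
          then have "(\<lambda>n. loss \<phi> s * (W (Y n / s) / W (Y n))) \<longlonglongrightarrow> loss \<phi> s * s powr (1 + lam)" by (intro tendsto_intros)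
          then show ?thesis by (simp add: mult.commute)
        qed (use L(3) in auto)
      qed
      show "AE s in lborel. norm (loss \<phi> s * W (Y n / s) / W (Y n)) \<le> G s" for n
      proof (rule AE_I2)
        fix s
        show "norm (loss \<phi> s * W (Y n / s) / W (Y n)) \<le> G s"
        proof (cases "0 < s")
          case True
          have WY: "W (1/2) \<le> W (Y n)" using Y[of n] by (intro W_antimono) auto
          then have WY0: "0 < W (Y n)" using Wh by simp
          have "W (Y n / s) / W (Y n) \<le> (s powr (1 + lam) * (s + 1) * W (Y n) + s) / W (Y n)"
            using Wbound[of "Y n" s] Y[of n] True WY0 by (intro divide_right_mono) auto
          also have "\<dots> = s powr (1 + lam) * (s + 1) + s / W (Y n)" using WY0 by (simp add: add_divide_distrib)
          also have "\<dots> \<le> s powr (1 + lam) * (s + 1) + s / W (1/2)"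
            using WY Wh True by (intro add_left_mono divide_left_mono mult_pos_pos) auto
          finally have "loss \<phi> s * (W (Y n / s) / W (Y n)) \<le> loss \<phi> s * (s powr (1 + lam) * (s + 1) + s / W (1/2))"
            by (intro mult_left_mono L(2))
          also have "\<dots> = G s"
          proof -
            have "s powr (2 + lam) = s powr (1 + lam) * s" using True powr_add[of s "1 + lam" 1] by (simp add: add_ac)
            then show ?thesis using True by (simp add: G_def algebra_simps)
          qed
          finally show ?thesis using L(2)[of s] W_ge0 by simp
        qed (use L(3) in \<open>auto simp: G_def\<close>)
      qed
    qed measurable
    moreover have "(LBINT s. loss \<phi> s * W (Y n / s) / W (Y n)) = \<phi> (Y n) / W (Y n)" for n
      unfolding fp_T_real(2)[OF fp, of "Y n"] by simp
    ultimately have "(\<lambda>n. \<phi> (Y n) / W (Y n)) \<longlonglongrightarrow> \<Lambda>" by (simp only:)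
    then show "((\<lambda>z. \<phi> z / W z) \<circ> X) \<longlonglongrightarrow> \<Lambda>"
      unfolding comp_def Y_def by (rule LIMSEQ_offset)
  qed
  \<comment> \<open>The final division by \<Lambda> needs this. By monotonicity \<phi> is positive
    on all of (0, x0), so the integrand cannot vanish almost everywhere.\<close>
  have \<Lambda>: "0 < \<Lambda>"
  proof -
    obtain x0 where x0: "0 < x0" "0 < \<phi> x0" by (rule fp_nonzero[OF fp])
    have i: "integrable lborel (\<lambda>s. s powr (1 + lam) * loss \<phi> s)"
      using lam by (intro fp_moment_integrable(2)[OF fp]) simp
    have "0 \<le> \<Lambda>" unfolding \<Lambda>_def using L(2) by (intro integral_nonneg_AE) auto
    moreover have "\<Lambda> \<noteq> 0"
    proof
      assume "\<Lambda> = 0"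
      then have "AE s in lborel. s powr (1 + lam) * loss \<phi> s = 0"
        unfolding \<Lambda>_def using integral_nonneg_eq_0_iff_AE[OF i] L(2) by auto
      then have "AE s in lborel. s \<notin> {0<..<x0}"
      proof eventually_elim
        case (elim s)
        show ?case
        proof
          assume s: "s \<in> {0<..<x0}"
          then have "0 < \<phi> s" using src_sol_antimono[OF fp, of s x0] x0 by auto
          then show False using elim s A_pos by (auto simp: loss_def)
        qed
      qed
      then have "emeasure lborel {0<..<x0} = 0"
        by (subst (asm) AE_iff_measurable[OF _ refl]) (auto simp: greaterThanLessThan_def greaterThan_def lessThan_def Int_def)
      then show False using x0 by simp
    qed
    ultimately show ?thesis by simp
  qed
  have "((\<lambda>z. \<phi> z / W z / \<Lambda>) \<longlongrightarrow> \<Lambda> / \<Lambda>) (at_right 0)" by (intro tendsto_intros lim) (use \<Lambda> in simp)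
  then have "((\<lambda>z. \<phi> z / W z / \<Lambda>) \<longlongrightarrow> 1) (at_right 0)" using \<Lambda> by simp
  then show ?thesis unfolding \<Lambda>_def[symmetric]
  proof (rule Lim_transform_eventually)
    show "\<forall>\<^sub>F z in at_right 0. \<phi> z / W z / \<Lambda> = z * \<phi> z / (\<Lambda> * z * W z)"
      using eventually_at_right_less[of "0::real"] by eventually_elim (simp add: mult.commute)
  qed
qed

end

section \<open>Borel representatives\<close>

text \<open>Completeness of \<open>lebesgue\<close>: agreement almost everywhere with a Borel
  function already makes F measurable, and a Borel function has the same integral in
  \<open>lborel\<close> and in its completion.\<close>

lemma lebesgue_integral_eq_borel:
  fixes F G :: "real \<Rightarrow> real"
  assumes ae: "AE x in lborel. F x = G x" and G: "G \<in> borel_measurable borel"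
  shows "integrable lebesgue F \<longleftrightarrow> integrable lborel G" and "integral\<^sup>L lebesgue F = integral\<^sup>L lborel G"
proof -
  have ae': "AE x in lebesgue. F x = G x" using ae by (rule AE_completion)
  have Gm: "G \<in> borel_measurable lebesgue" using G by (simp add: measurable_completion)
  have Fm: "F \<in> borel_measurable lebesgue"
    by (rule borel_measurable_AE[OF Gm]) (use ae' in \<open>simp add: eq_commute\<close>)
  show "integrable lebesgue F \<longleftrightarrow> integrable lborel G"
    using integrable_cong_AE[OF Fm Gm ae'] integrable_completion[of G lborel] G by simp
  show "integral\<^sup>L lebesgue F = integral\<^sup>L lborel G"
    using integral_cong_AE[OF Fm Gm ae'] integral_completion[of G lborel] G by simp
qed

lemma set_lebesgue_eq_borel:
  fixes F G :: "real \<Rightarrow> real"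
  assumes "AE x in lborel. indicator S x * F x = G x" and "G \<in> borel_measurable borel"
  shows "set_integrable lebesgue S F \<longleftrightarrow> integrable lborel G" and "(LINT x:S|lebesgue. F x) = integral\<^sup>L lborel G"
  using lebesgue_integral_eq_borel[of "\<lambda>x. indicator S x * F x" G] assms
  by (auto simp: set_integrable_def set_lebesgue_integral_def)

text \<open>The map z \<mapsto> x/z is differentiable on (0,1), hence sends null sets to null sets.
  It transports statements valid for almost every z to the arguments x/y at which the kernel b
  evaluates h.\<close>

lemma AE_divide:
  fixes P :: "real \<Rightarrow> bool"
  assumes "AE z in lborel. z \<in> {0<..<1} \<longrightarrow> P z" and x: "0 < x"
  shows "AE y in lborel. x < y \<longrightarrow> P (x / y)"
proof -
  obtain N where N: "N \<in> null_sets lborel" "{z. \<not> (z \<in> {0<..<1} \<longrightarrow> P z)} \<subseteq> N"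
    using assms(1) by (auto elim!: AE_E simp: null_sets_def)
  define M where "M = {z \<in> {0<..<1}. \<not> P z}"
  have "negligible N" using N(1) by (simp add: negligible_iff_null_sets null_sets_completionI)
  then have "negligible M" by (rule negligible_subset) (use N(2) in \<open>auto simp: M_def\<close>)
  moreover have "(\<lambda>z. x / z) differentiable_on M"
  proof -
    have "(\<lambda>z. x / z) differentiable at z within M" if "z \<in> M" for z
    proof -
      have "((\<lambda>z. x / z) has_real_derivative - x / z\<^sup>2) (at z)"
        using that by (auto intro!: derivative_eq_intros simp: M_def power2_eq_square)
      then show ?thesis
        using differentiable_at_withinI real_differentiable_def by blast
    qed
    then show ?thesis by (simp add: differentiable_on_def)
  qed
  ultimately have "negligible ((\<lambda>z. x / z) ` M)"
    by (intro negligible_differentiable_image_negligible) auto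
  then have "(\<lambda>z. x / z) ` M \<in> null_sets lebesgue" by (simp add: negligible_iff_null_sets)
  then have "AE y in lebesgue. y \<notin> (\<lambda>z. x / z) ` M" by (rule AE_not_in)
  then have "AE y in lborel. y \<notin> (\<lambda>z. x / z) ` M" by (simp only: AE_completion_iff)
  then show ?thesis
  proof eventually_elim
    case (elim y)
    show ?case
    proof (intro impI, rule ccontr)
      assume "x < y" "\<not> P (x / y)"
      then have "x / y \<in> M" using x by (simp add: M_def)
      moreover have "y = x / (x / y)" using x by simp
      ultimately show False using elim by blast
    qed
  qed
qed

text \<open>The hypotheses speak about z h(z), so a Borel version of that product is taken and
  divided by z; clipping at 0 and cutting to (0,1) make the locale conditions hold
  everywhere.\<close>

lemma borel_representative:
  fixes h :: "real \<Rightarrow> real"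
  assumes nn: "\<And>z. 0 < z \<Longrightarrow> z < 1 \<Longrightarrow> 0 \<le> h z"
    and int: "set_integrable lebesgue {0<..<1} (\<lambda>z. z * h z)" and mass: "(LINT z:{0<..<1}|lebesgue. z * h z) = 1"
  shows "\<exists>h1. daughter_kernel h1 \<and> (AE z in lborel. z \<in> {0<..<1} \<longrightarrow> h z = h1 z)"
proof -
  define g where "g z = indicator {0<..<1} z * (z * h z)" for z
  have gi: "integrable lebesgue g" using int by (simp add: set_integrable_def g_def[abs_def])
  have "g \<in> borel_measurable lebesgue" using gi by simp
  then obtain g' where g': "g' \<in> borel_measurable lborel" "AE z in lborel. g z = g' z"
    using completion_ex_borel_measurable_real by blast
  have [measurable]: "g' \<in> borel_measurable borel" using g'(1) by simp
  define h1 where "h1 z = indicator {0<..<1} z * max 0 (g' z / z)" for z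
  have ae: "AE z in lborel. z \<in> {0<..<1} \<longrightarrow> h z = h1 z"
    using g'(2)
  proof eventually_elim
    case (elim z)
    show ?case
    proof
      assume z: "z \<in> {0<..<1}"
      then have "g' z = z * h z" using elim by (simp add: g_def)
      moreover have "0 < z" using z by simp
      ultimately have "g' z / z = h z" by simp
      then show "h z = h1 z" using z nn[of z] by (simp add: h1_def)
    qed
  qed
  have g0: "0 \<le> g z" for z using nn[of z] by (auto simp: g_def split: split_indicator)
  have "(NN z. ennreal (z * h1 z)) = (NN z. ennreal (g z))"
  proof (rule nn_integral_cong_AE)
    show "AE z in lborel. ennreal (z * h1 z) = ennreal (g z)"
      using ae by eventually_elim (auto simp: g_def h1_def split: split_indicator)
  qed
  also have "\<dots> = (\<integral>\<^sup>+z. ennreal (g z) \<partial>lebesgue)" by (rule nn_integral_completion[symmetric])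
  also have "\<dots> = ennreal (integral\<^sup>L lebesgue g)" by (rule nn_integral_eq_integral[OF gi]) (use g0 in auto)
  also have "integral\<^sup>L lebesgue g = 1" using mass by (simp add: set_lebesgue_integral_def g_def[abs_def])
  finally have "(NN z. ennreal (z * h1 z)) = 1" by simp
  then have "daughter_kernel h1"
    by unfold_locales (auto simp: h1_def[abs_def] split: split_indicator)
  with ae show ?thesis by blast
qed

lemma rapid0_tendsto:
  assumes "rapid0 u" shows "(u \<longlongrightarrow> 0) at_top"
proof -
  obtain C where C: "0 \<le> C" "\<And>x. x \<ge> 1 \<Longrightarrow> \<bar>u x\<bar> \<le> C * x powr - 1" using rapid0_bound'[OF assms, of 1 1] by auto
  show ?thesis
  proof (rule Lim_null_comparison)
    show "\<forall>\<^sub>F x in at_top. norm (u x) \<le> C * x powr - 1"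
      using eventually_ge_at_top[of 1] by eventually_elim (use C in simp)
    have "((\<lambda>x::real. x powr - 1) \<longlongrightarrow> 0) at_top" by real_asymp
    then show "((\<lambda>x. C * x powr - 1) \<longlongrightarrow> 0) at_top" by (rule tendsto_mult_right_zero)
  qed
qed

section \<open>Transfer between the Lebesgue formulation and the Borel operators\<close>

context daughter_kernel
begin

lemma gain_unscaled:
  assumes "0 < x"
  shows "integrable lborel (\<lambda>s. h (x / s) / s * u s) \<longleftrightarrow> integrable lborel (\<lambda>t. k t * u (x * t))"
    and "(LBINT s. h (x / s) / s * u s) = gain u x"
proof -
  have eq: "h (x / (0 + x * t)) / (0 + x * t) * u (0 + x * t) = 1 / x * (k t * u (x * t))" for t
    using assms by (simp add: k_def)
  show "integrable lborel (\<lambda>s. h (x / s) / s * u s) \<longleftrightarrow> integrable lborel (\<lambda>t. k t * u (x * t))"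
  proof -
    have "integrable lborel (\<lambda>t. 1 / x * (k t * u (x * t))) \<longleftrightarrow> integrable lborel (\<lambda>t. k t * u (x * t))"
    proof
      assume "integrable lborel (\<lambda>t. 1 / x * (k t * u (x * t)))"
      then have "integrable lborel (\<lambda>t. x * (1 / x * (k t * u (x * t))))" by (rule integrable_mult_right)
      then show "integrable lborel (\<lambda>t. k t * u (x * t))" using assms by simp
    qed (rule integrable_mult_right)
    then show ?thesis
      using lborel_integrable_real_affine_iff[of x "\<lambda>s. h (x / s) / s * u s" 0] assms unfolding eq by blast
  qed
  show "(LBINT s. h (x / s) / s * u s) = gain u x"
    using lborel_integral_real_affine[of x "\<lambda>s. h (x / s) / s * u s" 0] assms unfolding eq gain_def by simp
qed

end

text \<open>\<open>h0\<close> is the given, merely Lebesgue measurable distribution inside b, while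
  \<open>h\<close> is the Borel representative on which the operators are built.\<close>

locale fragmentation_data = fragmentation +
  fixes a h0 :: "real \<Rightarrow> real" and b :: "real \<Rightarrow> real \<Rightarrow> real"
  assumes a: "0 < x \<Longrightarrow> a x = A * x powr \<gamma>"
    and b: "0 < x \<Longrightarrow> x < y \<Longrightarrow> b x y = 1 / y * h0 (x / y)"
    and h0: "AE z in lborel. z \<in> {0<..<1} \<longrightarrow> h0 z = h z"
begin

definition ext :: "(real \<Rightarrow> real) \<Rightarrow> real \<Rightarrow> real" where "ext f x = (if 0 < x then f x else 0)"

text \<open>For y > x the argument x/y is in (0,1) and both distributions agree there for almost
  every y by \<open>AE_divide\<close>; for y \<le> x the Borel one vanishes, which replaces the
  restriction to y > x.\<close>

lemma gain_lebesgue: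
  assumes "ext f \<in> borel_measurable borel" "0 < x"
  shows "set_integrable lebesgue {x<..} (\<lambda>y. a y * b x y * f y) \<longleftrightarrow> integrable lborel (\<lambda>t. k t * absorb (ext f) (x * t))"
    and "(LINT y:{x<..}|lebesgue. a y * b x y * f y) = gain (absorb (ext f)) x"
proof -
  have m: "(\<lambda>y. h (x / y) / y * absorb (ext f) y) \<in> borel_measurable borel"
    using assms(1) unfolding absorb_def by measurable
  have ae: "AE y in lborel. indicator {x<..} y * (a y * b x y * f y) = h (x / y) / y * absorb (ext f) y"
    using AE_divide[OF h0 assms(2)]
  proof eventually_elim
    case (elim y)
    show ?case
    proof (cases "x < y")
      case True
      then have "0 < y" using assms(2) by simp
      then show ?thesis using True elim assms(2) by (simp add: a b absorb_def ext_def)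
    next
      case False
      have "h (x / y) = 0 \<or> y = 0" using False assms(2) h_out[of "x / y"] by (cases "0 < y") (auto simp: divide_simps)
      then show ?thesis using False by auto
    qed
  qed
  show "set_integrable lebesgue {x<..} (\<lambda>y. a y * b x y * f y) \<longleftrightarrow> integrable lborel (\<lambda>t. k t * absorb (ext f) (x * t))"
    using set_lebesgue_eq_borel(1)[OF ae m] gain_unscaled(1)[OF assms(2)] by simp
  show "(LINT y:{x<..}|lebesgue. a y * b x y * f y) = gain (absorb (ext f)) x"
    using set_lebesgue_eq_borel(2)[OF ae m] gain_unscaled(2)[OF assms(2)] by simp
qed

lemma half_line_lebesgue:
  fixes F G :: "real \<Rightarrow> real"
  assumes "G \<in> borel_measurable borel" "\<And>x. 0 < x \<Longrightarrow> F x = G x" "\<And>x. x \<le> 0 \<Longrightarrow> G x = 0"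
  shows "set_integrable lebesgue {0<..} F \<longleftrightarrow> integrable lborel G" "(LINT x:{0<..}|lebesgue. F x) = integral\<^sup>L lborel G"
  by (rule set_lebesgue_eq_borel[OF AE_I2 assms(1)]; use assms(2,3) in \<open>auto split: split_indicator\<close>)+

lemma is_solution_classical:
  assumes "is_solution a b f"
  shows "classical_sol (ext f) (deriv f)" and "(LINT x:{0<..}|lebesgue. x * f x) = (LBINT x. x * ext f x)"
proof -
  have f: "\<And>x. 0 \<le> x \<Longrightarrow> 0 \<le> f x" "continuous_on {0..} f" "smooth_on_pos f" "satisfies_equation a b f"
    "\<And>m. m > -1 \<Longrightarrow> f \<in> X m" "\<And>m. m > -1 \<Longrightarrow> (\<lambda>x. a x * f x) \<in> X m" "(f \<longlongrightarrow> 0) at_top" "((\<lambda>z. z * deriv f z) \<longlongrightarrow> 0) at_top"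
    using assms unfolding is_solution_def by blast+
  have m[measurable]: "ext f \<in> borel_measurable borel"
    unfolding ext_def[abs_def] by (rule borel_measurable_zero_ext) (rule continuous_on_subset[OF f(2)], auto)
  have am[measurable]: "absorb (ext f) \<in> borel_measurable borel" unfolding absorb_def[abs_def] by measurable
  have D: "(f has_real_derivative deriv f x) (at x)" "(deriv f has_real_derivative deriv (deriv f) x) (at x)" if "0 < x" for x
  proof -
    have "(deriv ^^ n) f field_differentiable at x" for n using f(3) that by (auto simp: smooth_on_pos_def)
    from this[of 0] this[of 1] show "(f has_real_derivative deriv f x) (at x)" "(deriv f has_real_derivative deriv (deriv f) x) (at x)"
      by (simp_all add: field_differentiable_derivI)
  qed
  have E: "integrable lborel (\<lambda>t. k t * absorb (ext f) (x * t))" "deriv (deriv f) x = absorb (ext f) x - gain (absorb (ext f)) x"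
    if x: "0 < x" for x
  proof -
    have "set_integrable lebesgue {x<..} (\<lambda>y. a y * b x y * f y)"
      and eq: "- deriv (deriv f) x + a x * f x = (LINT y:{x<..}|lebesgue. a y * b x y * f y)"
      using f(4) x by (auto simp: satisfies_equation_def)
    then show "integrable lborel (\<lambda>t. k t * absorb (ext f) (x * t))" using gain_lebesgue(1)[OF m x] by simp
    have "a x * f x = absorb (ext f) x" using x by (simp add: a absorb_def ext_def)
    then show "deriv (deriv f) x = absorb (ext f) x - gain (absorb (ext f)) x" using eq gain_lebesgue(2)[OF m x] by simp
  qed
  have I1: "integrable lborel (\<lambda>s. s * ext f s)"
  proof -
    have "set_integrable lebesgue {0<..} (\<lambda>x. x powr 1 * f x)"
      using f(5)[of 1] by (simp only: X_def mem_Collect_eq) 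
    also have "?this \<longleftrightarrow> ?thesis"
    proof (rule half_line_lebesgue(1))
      show "(\<lambda>s. s * ext f s) \<in> borel_measurable borel" by measurable
    qed (auto simp: ext_def)
    finally show ?thesis .
  qed
  have I2: "integrable lborel (\<lambda>s. s * absorb (ext f) s)"
  proof -
    have "set_integrable lebesgue {0<..} (\<lambda>x. x powr 1 * (a x * f x))"
      using f(6)[of 1] by (simp only: X_def mem_Collect_eq)
    also have "?this \<longleftrightarrow> ?thesis"
    proof (rule half_line_lebesgue(1))
      show "(\<lambda>s. s * absorb (ext f) s) \<in> borel_measurable borel" by measurable
    qed (auto simp: ext_def absorb_def a)
    finally show ?thesis .
  qed
  have ev: "\<forall>\<^sub>F x in at_top. f x = ext f x" using eventually_gt_at_top[of 0] by eventually_elim (simp add: ext_def)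
  show "classical_sol (ext f) (deriv f)"
    unfolding classical_sol_def pos_fun_def
  proof (intro conjI allI impI)
    show "(ext f has_real_derivative deriv f x) (at x)" if "0 < x" for x
      by (rule has_field_derivative_transform_within_open[OF D(1)[OF that], of "{0<..}"]) (use that in \<open>auto simp: ext_def\<close>)
    show "(deriv f has_real_derivative absorb (ext f) x - gain (absorb (ext f)) x) (at x)" if "0 < x" for x
      using D(2)[OF that] E(2)[OF that] by simp
    show "(ext f \<longlongrightarrow> 0) at_top" using f(7) ev by (rule Lim_transform_eventually)
  qed (use f m E I1 I2 in \<open>auto simp: ext_def\<close>)
  show "(LINT x:{0<..}|lebesgue. x * f x) = (LBINT x. x * ext f x)"
  proof (rule half_line_lebesgue(2))
    show "(\<lambda>x. x * ext f x) \<in> borel_measurable borel" by measurable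
  qed (auto simp: ext_def)
qed

lemma fixed_point_is_solution:
  assumes fp: "fixed_point \<phi>"
  shows "is_solution a b (\<lambda>x. x * \<phi> x)"
proof -
  note S = src_solD[OF fp] and L = fp_loss[OF fp]
  define f where "f = (\<lambda>x. x * \<phi> x)"
  have [measurable]: "\<phi> \<in> borel_measurable borel" "loss \<phi> \<in> borel_measurable borel" by (rule S(1), rule L(1))
  have ext: "ext f = f" using S(3) by (auto simp: ext_def f_def fun_eq_iff)
  have ab: "absorb f = loss \<phi>"
  proof
    fix s show "absorb f s = loss \<phi> s"
      using S(3)[of s] by (cases "0 < s") (auto simp: absorb_def loss_def f_def powr_add)
  qed
  have fm[measurable]: "f \<in> borel_measurable borel" unfolding f_def by measurable
  have rf: "rapid n f" for n
    unfolding f_def by (rule rapid_cong[OF _ rapid_powr[OF fp_rapid[OF fp, of n], of 1]]) simp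
  define K where "K = tail (imbalance \<phi>)"
  have d1: "deriv f x = \<phi> x - K x / x" if "0 < x" for x
    using fp_derivs(1)[OF fp that] unfolding f_def K_def by (rule DERIV_imp_deriv)
  have d2: "deriv (deriv f) x = loss \<phi> x - gain (loss \<phi>) x" if x: "0 < x" for x
  proof -
    have "deriv (deriv f) x = deriv (\<lambda>x. \<phi> x - K x / x) x"
      by (rule deriv_cong_ev) (use order_tendstoD(1)[OF filterlim_ident x] d1 in \<open>auto elim: eventually_mono\<close>)
    also have "\<dots> = loss \<phi> x - gain (loss \<phi>) x"
      using fp_derivs(2)[OF fp x] unfolding K_def by (rule DERIV_imp_deriv)
    finally show ?thesis .
  qed
  have rg: "rapid0 (gain (loss \<phi>))" by (rule rapid0_gain[OF L(4)])
  have gm[measurable]: "gain (loss \<phi>) \<in> borel_measurable borel" unfolding gain_def[abs_def] by measurable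
  have "is_solution a b f"
    unfolding is_solution_def
  proof (intro conjI allI impI)
    show "0 \<le> f x" if "0 \<le> x" for x using that S(2) by (simp add: f_def)
    \<comment> \<open>Only the left endpoint is delicate: \<phi> may blow up there, and
      \<open>fp_tendsto_0\<close> supplies the limit of x \<phi>(x).\<close>
    show "continuous_on {0..} f"
      unfolding continuous_on_eq_continuous_within
    proof
      fix x :: real assume "x \<in> {0..}"
      then consider "x = 0" | "0 < x" by fastforce
      then show "continuous (at x within {0..}) f"
      proof cases
        case 1
        have "(f \<longlongrightarrow> f 0) (at_right 0)" using fp_tendsto_0[OF fp] by (simp add: f_def)
        then show ?thesis unfolding 1 continuous_within by (simp add: at_within_Ici_at_right)
      next
        case 2
        then show ?thesis using rapid0_isCont[OF rapid_imp_0[OF rf[of 0]] 2] by (simp add: continuous_at_imp_continuous_at_within)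
      qed
    qed
    show "smooth_on_pos f" by (rule rapid_smooth[OF rf])
    show "satisfies_equation a b f"
      unfolding satisfies_equation_def
    proof (intro allI impI conjI)
      fix x :: real assume x: "0 < x"
      show "set_integrable lebesgue {x<..} (\<lambda>y. a y * b x y * f y)"
        using gain_lebesgue(1)[of f x] gain_integrable[OF L(4) x] x fm by (simp add: ext ab)
      have "a x * f x = loss \<phi> x" using x unfolding ab[symmetric] by (simp add: a absorb_def)
      then show "- deriv (deriv f) x + a x * f x = (LINT y:{x<..}|lebesgue. a y * b x y * f y)"
        using gain_lebesgue(2)[of f x] x fm d2[OF x] by (simp add: ext ab)
    qed
    show "f 0 = 0" by (simp add: f_def)
    show "f \<in> X m" if "m > -1" for m
      using fp_moment_integrable(1)[OF fp that] half_line_lebesgue(1)[of "\<lambda>s. s powr m * (s * \<phi> s)" "\<lambda>x. x powr m * f x"] S(3)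
      by (auto simp: X_def f_def)
    show "(\<lambda>x. a x * f x) \<in> X m" if "m > -1" for m
    proof -
      have "x powr m * (a x * f x) = x powr m * loss \<phi> x" if "0 < x" for x
        using that unfolding ab[symmetric] by (simp add: a absorb_def)
      then show ?thesis
        using fp_moment_integrable(2)[OF fp that] half_line_lebesgue(1)[of "\<lambda>s. s powr m * loss \<phi> s" "\<lambda>x. x powr m * (a x * f x)"] L(3)
        by (auto simp: X_def)
    qed
    show "deriv (deriv f) \<in> X m" if m: "1 \<le> m" for m
    proof -
      define G where "G s = indicator {0<..} s * (s powr m * (loss \<phi> s - gain (loss \<phi>) s))" for s
      have Gm: "G \<in> borel_measurable borel" unfolding G_def[abs_def] by measurable
      have i1: "integrable lborel (\<lambda>s. s powr m * loss \<phi> s)" using fp_moment_integrable(2)[OF fp, of m] m by simp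
      \<comment> \<open>The gain needs a separate treatment near 0: for s \<le> 1 and m \<ge> 1 one
        has s^m \<le> s, and the first moment of the gain is finite by the mass balance at x = 0.
        For s > 1 rapid decay takes over in \<open>i3\<close>.\<close>
      have i2: "integrable lborel (\<lambda>s. indicator {0<..} s * (s * gain (loss \<phi>) s))"
        using fp_flux(1)[OF fp, of 0] by (simp add: set_integrable_def)
      have i3: "integrable lborel (\<lambda>s. indicator {1<..} s * (s powr m * gain (loss \<phi>) s))"
        using rapid_integrable[OF rapid0_powr[OF rg], of 1 m] by (simp add: set_integrable_def)
      have g0: "0 \<le> gain (loss \<phi>) s" for s
        unfolding gain_def using k_ge0 L(2) by (intro integral_nonneg_AE) auto
      have "integrable lborel (\<lambda>s. s powr m * loss \<phi> s + indicator {0<..} s * (s * gain (loss \<phi>) s) + indicator {1<..} s * (s powr m * gain (loss \<phi>) s))"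
        by (intro Bochner_Integration.integrable_add i1 i2 i3)
      then have "integrable lborel G"
      proof (rule Bochner_Integration.integrable_bound[OF _ _ AE_I2])
        fix s
        define R where "R = s powr m * loss \<phi> s + indicator {0<..} s * (s * gain (loss \<phi>) s) + indicator {1<..} s * (s powr m * gain (loss \<phi>) s)"
        have "norm (G s) \<le> R"
        proof (cases "0 < s")
          case True
          have "s powr m * gain (loss \<phi>) s \<le> s * gain (loss \<phi>) s + indicator {1<..} s * (s powr m * gain (loss \<phi>) s)"
          proof (cases "1 < s")
            case False
            then have "s powr m \<le> s powr 1" using True m by (intro powr_mono') auto
            then show ?thesis using False True g0[of s] by (simp add: mult_right_mono)
          qed (use True g0[of s] in simp)
          moreover have "norm (G s) \<le> s powr m * loss \<phi> s + s powr m * gain (loss \<phi>) s"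
          proof -
            have "\<bar>loss \<phi> s - gain (loss \<phi>) s\<bar> \<le> loss \<phi> s + gain (loss \<phi>) s" using g0[of s] L(2)[of s] by simp
            then show ?thesis using True mult_left_mono[of _ _ "s powr m"] by (fastforce simp: G_def abs_mult distrib_left[symmetric])
          qed
          ultimately show ?thesis using True by (simp add: R_def)
        next
          case False
          then have "R = 0" "G s = 0" using L(3)[of s] by (auto simp: R_def G_def)
          then show ?thesis by simp
        qed
        then show "norm (G s) \<le> norm (s powr m * loss \<phi> s + indicator {0<..} s * (s * gain (loss \<phi>) s) + indicator {1<..} s * (s powr m * gain (loss \<phi>) s))"
          unfolding R_def[symmetric] by simp
      qed (use Gm in simp)
      then show ?thesis
        using half_line_lebesgue(1)[of G "\<lambda>x. x powr m * deriv (deriv f) x"] Gm d2 by (simp add: X_def G_def)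
    qed
    show "(f \<longlongrightarrow> 0) at_top" by (rule rapid0_tendsto[OF rapid_imp_0[OF rf[of 0]]])
    show "((\<lambda>z. z * deriv f z) \<longlongrightarrow> 0) at_top"
    proof -
      have rK: "rapid0 K" unfolding K_def
        by (rule rapid_imp_0[OF rapid_tail[OF rapid_imbalance[OF fp_rapid[OF fp, of 0]]]])
      \<comment> \<open>Since f' = \<phi> - K/z, one has z f'(z) = f(z) - K(z), and both terms decay
        rapidly.\<close>
      have "((\<lambda>z. f z - K z) \<longlongrightarrow> 0 - 0) at_top"
        by (intro tendsto_diff rapid0_tendsto rK rapid_imp_0[OF rf[of 0]])
      then have "((\<lambda>z. f z - K z) \<longlongrightarrow> 0) at_top" by simp
      then show ?thesis
      proof (rule Lim_transform_eventually)
        show "\<forall>\<^sub>F z in at_top. f z - K z = z * deriv f z"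
          using eventually_gt_at_top[of 0]
          by eventually_elim (simp add: d1, simp add: f_def field_simps)
      qed
    qed
  qed
  then show ?thesis by (simp add: f_def)
qed

end

section \<open>Assembly of the solution, its uniqueness and its asymptotics\<close>

theorem theorem1p2:
  fixes \<gamma> \<aa> \<alpha> m0 chi :: real
    and a h H :: "real \<Rightarrow> real"
    and b :: "real \<Rightarrow> real \<Rightarrow> real"
  assumes "\<gamma> \<ge> 0" and "\<aa> > 0"
    and a: "\<And>x. x > 0 \<Longrightarrow> a x = \<aa> * x powr \<gamma>"
    and b: "\<And>x y. 0 < x \<Longrightarrow> x < y \<Longrightarrow> b x y = 1 / y * h (x / y)"
    and h_nonneg: "\<And>z. 0 < z \<Longrightarrow> z < 1 \<Longrightarrow> h z \<ge> 0"
    and h_int: "set_integrable lebesgue {0<..<1} (\<lambda>z. z * h z)"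
    and h_mass: "(LINT z:{0<..<1}|lebesgue. z * h z) = 1"
    and "m0 \<ge> 1" and "chi > 0"
    and h_moments: "\<And>m. m \<ge> m0 \<Longrightarrow>
          (LINT z:{0<..<1}|lebesgue. z powr m * h z) \<le> chi / m"
    and \<alpha>: "\<alpha> = (\<gamma> + 2) / 2"
    and H: "\<And>z. 0 \<le> z \<Longrightarrow> z \<le> 1 \<Longrightarrow> H z = (LINT y:{0<..<z}|lebesgue. y * h y)"
  shows "\<exists>f. is_solution a b f \<and> (LINT x:{0<..}|lebesgue. x * f x) = 1 \<and>
    (\<forall>g. is_solution a b g \<and> (LINT x:{0<..}|lebesgue. x * g x) = 1 \<longrightarrow>
       (\<forall>x\<ge>0. g x = f x)) \<and>
    (\<forall>\<mu> > (\<alpha> + chi - 1) / 2. \<exists>\<kappa>>0. \<forall>x\<ge>1.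
       f 1 * x powr (- \<gamma> / 4) * exp (- sqrt \<aa> * x powr \<alpha> / \<alpha>) \<le> f x \<and>
       f x \<le> \<kappa> * x powr (1 + \<alpha> + \<mu>) * exp (- sqrt \<aa> * x powr \<alpha> / \<alpha>)) \<and>
    (set_integrable lebesgue {0<..<1} h \<longrightarrow>
       (\<exists>l>0. sim_at_0 f (\<lambda>z. l * z))) \<and>
    (\<not> set_integrable lebesgue {0<..<1} h \<longrightarrow>
       (\<forall>lam\<in>{-1..0}.
          (\<forall>y>0. sim_at_0 (\<lambda>z. H (z / y)) (\<lambda>z. y powr lam * H z)) \<and>
          (\<forall>z y. 0 < z \<and> z < 1 \<and> z < y \<longrightarrow>
             H (z / y) \<le> y powr lam * (y + 1) * H z) \<longrightarrow>
          sim_at_0 f (\<lambda>z. (LINT y:{0<..}|lebesgue. y powr (1 + lam) * a y * f y) *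
                          z * (LINT y:{z<..<1}|lebesgue. H y / y\<^sup>2))))"
proof -
  obtain h1 where h1: "daughter_kernel h1" and ae: "AE z in lborel. z \<in> {0<..<1} \<longrightarrow> h z = h1 z"
    using borel_representative[of h] h_nonneg h_int h_mass by blast
  interpret K: daughter_kernel h1 by (rule h1)
  \<comment> \<open>The operators use the Borel representative \<open>h1\<close>, while b keeps the
    given h.\<close>
  interpret D: fragmentation_data h1 \<gamma> \<aa> a h b
    by unfold_locales (use assms ae in auto)
  note [measurable] = K.h_meas
  obtain \<phi> where fp: "D.fixed_point \<phi>" using D.fixed_point_exists by blast
  note S = D.src_solD[OF fp]
  have [measurable]: "\<phi> \<in> borel_measurable borel" by (rule S(1))
  define f where "f = (\<lambda>x. x * \<phi> x)"
  have sol: "is_solution a b f" unfolding f_def by (rule D.fixed_point_is_solution[OF fp])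
  note cf = D.is_solution_classical[OF sol]
  have extf: "D.ext f = f" using S(3) by (auto simp: D.ext_def f_def fun_eq_iff)
  have mass: "(LINT x:{0<..}|lebesgue. x * f x) = 1"
  proof -
    have "(LBINT x. x powr 2 * \<phi> x) = 1"
    proof -
      have "(NN x. ennreal (x powr 2 * \<phi> x)) = 1"
        using S(6) S(2) unfolding Mo_def by (simp add: ennreal_mult)
      then show ?thesis using S(2) by (subst integral_eq_nn_integral) auto
    qed
    moreover have "(LBINT x. x * f x) = (LBINT x. x powr 2 * \<phi> x)"
    proof (intro Bochner_Integration.integral_cong refl)
      fix x show "x * f x = x powr 2 * \<phi> x"
        using S(3)[of x] by (cases "0 < x") (auto simp: f_def powr_numeral power2_eq_square)
    qed
    ultimately show ?thesis using cf(2) by (simp add: extf)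
  qed
  have unique: "g x = f x" if g: "is_solution a b g" "(LINT x:{0<..}|lebesgue. x * g x) = 1" and x: "0 \<le> x" for g x
  proof (cases "x = 0")
    case True
    have "g 0 = 0" using g(1) by (simp add: is_solution_def)
    then show ?thesis using True by (simp add: f_def)
  next
    case False
    then have x0: "0 < x" using x by simp
    note cg = D.is_solution_classical[OF g(1)]
    have "D.ext g x = D.ext f x"
      by (rule D.classical_sol_unique[OF cg(1) cf(1) _ x0]) (use cg(2) cf(2) g(2) mass in simp)
    then show ?thesis using x0 by (simp add: D.ext_def)
  qed
  have moments: "(NN z. ennreal (z powr m * h1 z)) \<le> ennreal (chi / m)" if m: "m0 \<le> m" for m
  proof -
    have p: "0 \<le> z powr m * h1 z" for z using K.h_ge0 by simp
    have ae': "AE z in lborel. indicator {0<..<1} z * (z powr m * h z) = z powr m * h1 z"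
      using ae by eventually_elim (use K.h_out in \<open>auto split: split_indicator\<close>)
    \<comment> \<open>The moment hypothesis bounds an integral whose value would be 0 by convention
      without integrability; here z^m \<le> z on (0,1), because m \<ge> m0 \<ge> 1, provides
      it.\<close>
    have i: "integrable lborel (\<lambda>z. z powr m * h1 z)"
    proof (rule Bochner_Integration.integrable_bound[OF K.zh_integrable _ AE_I2])
      fix z show "norm (z powr m * h1 z) \<le> norm (z * h1 z)"
      proof (cases "z \<in> {0<..<1}")
        case True
        then have "z powr m \<le> z powr 1" using m assms(8) by (intro powr_mono') auto
        then show ?thesis using True K.h_ge0[of z] by (simp add: abs_mult mult_right_mono)
      qed (simp add: K.h_out)
    qed measurable
    have "(LBINT z. z powr m * h1 z) \<le> chi / m"
      using set_lebesgue_eq_borel(2)[OF ae'] h_moments[OF m] by simp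
    then show ?thesis using nn_integral_eq_integral[OF i] p by (simp add: ennreal_leI)
  qed
  have large: "\<exists>\<kappa>>0. \<forall>x\<ge>1.
       f 1 * x powr (- \<gamma> / 4) * exp (- sqrt \<aa> * x powr \<alpha> / \<alpha>) \<le> f x \<and>
       f x \<le> \<kappa> * x powr (1 + \<alpha> + \<mu>) * exp (- sqrt \<aa> * x powr \<alpha> / \<alpha>)" if \<mu>: "\<mu> > (\<alpha> + chi - 1) / 2" for \<mu>
  proof -
    obtain \<kappa> where \<kappa>: "0 < \<kappa>" "\<And>x. 1 \<le> x \<Longrightarrow> x * \<phi> x \<le> \<kappa> * x powr (1 + \<alpha> + \<mu>) * exp (- sqrt \<aa> * x powr \<alpha> / \<alpha>)"
      using D.fixed_point_upper_bound[OF fp \<alpha> \<open>chi > 0\<close> moments \<mu>] by blast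
    then show ?thesis
      using D.classical_sol_lower_bound[OF cf(1) _ \<alpha>, unfolded extf] by (auto simp: f_def)
  qed
  have h_iff: "set_integrable lebesgue {0<..<1} h \<longleftrightarrow> integrable lborel h1"
  proof (rule set_lebesgue_eq_borel(1))
    show "AE z in lborel. indicator {0<..<1} z * h z = h1 z"
      using ae by eventually_elim (use K.h_out in \<open>auto split: split_indicator\<close>)
  qed measurable
  have small1: "\<exists>l>0. sim_at_0 f (\<lambda>z. l * z)" if "set_integrable lebesgue {0<..<1} h"
    using D.fp_small_size_integrable[OF fp] that h_iff unfolding sim_at_0_def f_def by blast
  have H_eq: "H z = K.H z" if "0 \<le> z" "z \<le> 1" for z
  proof -
    have "AE y in lborel. indicator {0<..<z} y * (y * h y) = indicator {..<z} y * (y * h1 y)"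
      using ae by eventually_elim (use that K.h_out in \<open>auto split: split_indicator\<close>)
    then show ?thesis unfolding H[OF that] K.H_def by (rule set_lebesgue_eq_borel(2)) measurable
  qed
  have W_eq: "(LINT y:{z<..<1}|lebesgue. H y / y\<^sup>2) = K.W z" if "0 < z" for z
    unfolding K.W_eq[OF that]
    by (rule set_lebesgue_eq_borel(2)) (use that H_eq in \<open>auto split: split_indicator\<close>)
  have small2: "sim_at_0 f (\<lambda>z. (LINT y:{0<..}|lebesgue. y powr (1 + lam) * a y * f y) * z * (LINT y:{z<..<1}|lebesgue. H y / y\<^sup>2))"
    if h: "\<not> set_integrable lebesgue {0<..<1} h" and lam: "lam \<in> {-1..0}"
      and H1: "\<forall>y>0. sim_at_0 (\<lambda>z. H (z / y)) (\<lambda>z. y powr lam * H z)"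
      and H2: "\<forall>z y. 0 < z \<and> z < 1 \<and> z < y \<longrightarrow> H (z / y) \<le> y powr lam * (y + 1) * H z" for lam
  proof -
    have "((\<lambda>z. (z * \<phi> z) / ((LBINT s. s powr (1 + lam) * D.loss \<phi> s) * z * K.W z)) \<longlongrightarrow> 1) (at_right 0)"
    proof (rule D.fp_small_size_nonintegrable[OF fp])
      show "\<not> integrable lborel h1" using h h_iff by simp
      show "-1 \<le> lam" using lam by simp
      show "((\<lambda>z. K.H (z / y) / (y powr lam * K.H z)) \<longlongrightarrow> 1) (at_right 0)" if y: "0 < y" for y
      proof (rule Lim_transform_eventually)
        show "((\<lambda>z. H (z / y) / (y powr lam * H z)) \<longlongrightarrow> 1) (at_right 0)"
          using H1 y by (simp add: sim_at_0_def)
        show "\<forall>\<^sub>F z in at_right 0. H (z / y) / (y powr lam * H z) = K.H (z / y) / (y powr lam * K.H z)"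
          unfolding eventually_at_right_field using y
          \<comment> \<open>Below min 1 y both z and z/y lie in [0,1], the range where the given H
            is specified.\<close>
          by (intro exI[of _ "min 1 y"]) (auto simp: H_eq)
      qed
      show "K.H (z / y) \<le> y powr lam * (y + 1) * K.H z" if "0 < z" "z < 1" "z < y" for z y
        using H2 that by (simp add: H_eq[symmetric])
    qed
    moreover have "(LINT y:{0<..}|lebesgue. y powr (1 + lam) * a y * f y) = (LBINT s. s powr (1 + lam) * D.loss \<phi> s)"
    proof (rule D.half_line_lebesgue(2))
      show "(\<lambda>s. s powr (1 + lam) * D.loss \<phi> s) \<in> borel_measurable borel" using D.fp_loss(1)[OF fp] by measurable
      show "x powr (1 + lam) * a x * f x = x powr (1 + lam) * D.loss \<phi> x" if "0 < x" for x
        using that by (simp add: a D.loss_def f_def powr_add)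
      show "x powr (1 + lam) * D.loss \<phi> x = 0" if "x \<le> 0" for x using D.fp_loss(3)[OF fp that] by simp
    qed
    ultimately show ?thesis
      unfolding sim_at_0_def f_def
    proof -
      assume lim: "((\<lambda>z. (z * \<phi> z) / ((LBINT s. s powr (1 + lam) * D.loss \<phi> s) * z * K.W z)) \<longlongrightarrow> 1) (at_right 0)"
        and eq: "(LINT y:{0<..}|lebesgue. y powr (1 + lam) * a y * (y * \<phi> y)) = (LBINT s. s powr (1 + lam) * D.loss \<phi> s)"
      show "((\<lambda>z. z * \<phi> z / ((LINT y:{0<..}|lebesgue. y powr (1 + lam) * a y * (y * \<phi> y)) * z * (LINT y:{z<..<1}|lebesgue. H y / y\<^sup>2))) \<longlongrightarrow> 1) (at_right 0)"
        unfolding eq using lim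
      proof (rule Lim_transform_eventually)
        show "\<forall>\<^sub>F z in at_right 0. z * \<phi> z / ((LBINT s. s powr (1 + lam) * D.loss \<phi> s) * z * K.W z)
          = z * \<phi> z / ((LBINT s. s powr (1 + lam) * D.loss \<phi> s) * z * (LINT y:{z<..<1}|lebesgue. H y / y\<^sup>2))"
          using eventually_at_right_less[of "0::real"] by eventually_elim (simp only: W_eq)
      qed
    qed
  qed
  show ?thesis
    by (rule exI[of _ f]) (use sol mass unique large small1 small2 in blast)
qed

end
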